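(* Let $n>1$ be a positive integer and let $t$ be a type with $t\neq(\infty,\infty,\ldots)$. A group $G\in\mathcal{MH}\setminus\mathcal{NIL}$ of rank $n$ and type $t$ exists if and only if $t$ is an idempotent type and there is an irreducible polynomial $f(x)\in\mathbb{Z}[x]$ of degree $n$ such that $P_0(t)\subseteq P(f)$.
   Context: All groups are abelian. A multiplication on a group $G$ is a homomorphism $\mu\colon G\otimes G\to G$ (associativity is not required). A $nil$-group is a group on which the only multiplication is the zero multiplication. $\mathcal{NIL}$ is the class of all torsion-free $nil$-groups of finite rank. The $p$-rank $r_p(G)$ is the dimension of $G/pG$ over the field with $p$ elements. A Murley group is a reduced torsion-free group $G$ of finite rank such that $r_p(G)\le 1$ for every prime $p$. A torsion-free group is homogeneous if all its non-zero elements have the same type; this common type is called the type $t(G)$ of $G$. $\mathcal{MH}$ is the class of all homogeneous Murley groups. A characteristic is a family $(\chi_p)_p$ indexed by the primes with entries in $\{0,1,2,\ldots,\infty\}$; two characteristics are equivalent if they differ in only finitely many places, and only where both are finite; a type is an equivalence class of characteristics. The type of an element is the class of its characteristic of $p$-heights. A type is idempotent if it contains a characteristic all of whose entries are $0$ or $\infty$. For a type $t$, $P_0(t)$ is the set of primes $p$ at which $t$ is finite, i.e. $t(p)<\infty$ (this does not depend on the representing characteristic). For $f(x)\in\mathbb{Z}[x]$, $P(f)$ is the set of primes $p$ such that $f(x)$ has a root in the field of $p$-adic numbers. *)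

theory Defs
  imports
    "HOL-Algebra.Free_Abelian_Groups"
    "HOL-Algebra.Generated_Groups"
    "HOL-Algebra.QuotRing"
    "HOL-Library.Extended_Nat"
    "HOL-Computational_Algebra.Computational_Algebra"
begin

text \<open>Abelian groups are \<^locale>\<open>comm_group\<close>s, hence written multiplicatively: the multiple
  $kx$ is \<open>x [^] k\<close> and the zero element is \<open>\<one>\<close>.\<close>

section \<open>Multiplications on a group\<close>

definition tensor_relations ::
  "('a, 'c) monoid_scheme \<Rightarrow> ('b, 'd) monoid_scheme \<Rightarrow> ('a \<times> 'b \<Rightarrow>\<^sub>0 int) set" where
  "tensor_relations G H =
     {frag_of (x \<otimes>\<^bsub>G\<^esub> x', y) - frag_of (x, y) - frag_of (x', y) | x x' y.
        x \<in> carrier G \<and> x' \<in> carrier G \<and> y \<in> carrier H} \<union>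
     {frag_of (x, y \<otimes>\<^bsub>H\<^esub> y') - frag_of (x, y) - frag_of (x, y') | x y y'.
        x \<in> carrier G \<and> y \<in> carrier H \<and> y' \<in> carrier H}"

definition tensor_product ::
  "('a, 'c) monoid_scheme \<Rightarrow> ('b, 'd) monoid_scheme \<Rightarrow> ('a \<times> 'b \<Rightarrow>\<^sub>0 int) set monoid" where
  "tensor_product G H =
     free_Abelian_group (carrier G \<times> carrier H) Mod
     generate (free_Abelian_group (carrier G \<times> carrier H)) (tensor_relations G H)"

definition multiplications ::
  "('a, 'c) monoid_scheme \<Rightarrow> (('a \<times> 'a \<Rightarrow>\<^sub>0 int) set \<Rightarrow> 'a) set" where
  "multiplications G = hom (tensor_product G G) G"

definition nil_group :: "('a, 'c) monoid_scheme \<Rightarrow> bool" where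
  "nil_group G \<longleftrightarrow> comm_group G \<and>
     (\<forall>\<mu> \<in> multiplications G. \<forall>u \<in> carrier (tensor_product G G). \<mu> u = \<one>\<^bsub>G\<^esub>)"

section \<open>Torsion-free groups, ranks, Murley groups\<close>

definition torsion_free :: "('a, 'c) monoid_scheme \<Rightarrow> bool" where
  "torsion_free G \<longleftrightarrow>
     (\<forall>x \<in> carrier G. \<forall>k :: nat. k > 0 \<longrightarrow> x [^]\<^bsub>G\<^esub> k = \<one>\<^bsub>G\<^esub> \<longrightarrow> x = \<one>\<^bsub>G\<^esub>)"

text \<open>Linear independence over $\mathbb{Z}/m$. For \<open>m = 0\<close> this is independence over
  $\mathbb{Z}$; for a prime \<open>m\<close> and a group annihilated by \<open>m\<close> it is independence over the field
  with \<open>m\<close> elements.\<close>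

definition independent_mod :: "nat \<Rightarrow> ('a, 'c) monoid_scheme \<Rightarrow> 'a set \<Rightarrow> bool" where
  "independent_mod m G S \<longleftrightarrow> finite S \<and> S \<subseteq> carrier G \<and>
     (\<forall>c :: 'a \<Rightarrow> int. finprod G (\<lambda>x. x [^]\<^bsub>G\<^esub> c x) S = \<one>\<^bsub>G\<^esub> \<longrightarrow> (\<forall>x \<in> S. int m dvd c x))"

definition group_rank :: "('a, 'c) monoid_scheme \<Rightarrow> enat" where
  "group_rank G = (SUP S \<in> {S. independent_mod 0 G S}. enat (card S))"

definition multiples :: "nat \<Rightarrow> ('a, 'c) monoid_scheme \<Rightarrow> 'a set" where
  "multiples m G = (\<lambda>x. x [^]\<^bsub>G\<^esub> m) ` carrier G"

definition p_rank :: "nat \<Rightarrow> ('a, 'c) monoid_scheme \<Rightarrow> enat" where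
  "p_rank p G = (SUP S \<in> {S. independent_mod p (G Mod multiples p G) S}. enat (card S))"

definition divisible_group :: "('a, 'c) monoid_scheme \<Rightarrow> bool" where
  "divisible_group G \<longleftrightarrow>
     (\<forall>x \<in> carrier G. \<forall>k :: nat. k > 0 \<longrightarrow> (\<exists>y \<in> carrier G. y [^]\<^bsub>G\<^esub> k = x))"

definition reduced_group :: "('a, 'c) monoid_scheme \<Rightarrow> bool" where
  "reduced_group G \<longleftrightarrow>
     (\<forall>D. subgroup D G \<and> divisible_group (G\<lparr>carrier := D\<rparr>) \<longrightarrow> D = {\<one>\<^bsub>G\<^esub>})"

definition murley_group :: "('a, 'c) monoid_scheme \<Rightarrow> bool" where
  "murley_group G \<longleftrightarrow> comm_group G \<and> torsion_free G \<and> reduced_group G \<and> group_rank G \<noteq> \<infinity> \<and>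
     (\<forall>p. prime p \<longrightarrow> p_rank p G \<le> 1)"

section \<open>Characteristics and types\<close>

text \<open>A characteristic is a function on all naturals of which only the values at primes matter:
  the values elsewhere are discarded by the equivalence relation.\<close>

type_synonym characteristic = "nat \<Rightarrow> enat"

definition char_equiv :: "characteristic \<Rightarrow> characteristic \<Rightarrow> bool" where
  "char_equiv \<chi> \<psi> \<longleftrightarrow>
     finite {p. prime p \<and> \<chi> p \<noteq> \<psi> p} \<and>
     (\<forall>p. prime p \<and> \<chi> p \<noteq> \<psi> p \<longrightarrow> \<chi> p \<noteq> \<infinity> \<and> \<psi> p \<noteq> \<infinity>)"

quotient_type height_type = characteristic / char_equiv
  morphisms char_of_type type_of_char
proof (rule equivpI)
  show "reflp char_equiv"
    by (simp add: reflp_def char_equiv_def)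
  show "symp char_equiv"
    unfolding symp_def char_equiv_def by (metis (mono_tags, lifting) Collect_cong)
  show "transp char_equiv"
  proof (rule transpI)
    fix \<chi> \<psi> \<theta> assume *: "char_equiv \<chi> \<psi>" "char_equiv \<psi> \<theta>"
    have "{p. prime p \<and> \<chi> p \<noteq> \<theta> p} \<subseteq> {p. prime p \<and> \<chi> p \<noteq> \<psi> p} \<union> {p. prime p \<and> \<psi> p \<noteq> \<theta> p}"
      by auto
    moreover have "finite ({p. prime p \<and> \<chi> p \<noteq> \<psi> p} \<union> {p. prime p \<and> \<psi> p \<noteq> \<theta> p})"
      using * by (simp add: char_equiv_def)
    ultimately have "finite {p. prime p \<and> \<chi> p \<noteq> \<theta> p}"
      by (rule finite_subset)
    moreover have "\<forall>p. prime p \<and> \<chi> p \<noteq> \<theta> p \<longrightarrow> \<chi> p \<noteq> \<infinity> \<and> \<theta> p \<noteq> \<infinity>"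
      using * unfolding char_equiv_def by metis
    ultimately show "char_equiv \<chi> \<theta>"
      by (simp add: char_equiv_def)
  qed
qed

lift_definition finite_primes :: "height_type \<Rightarrow> nat set" is
  "\<lambda>\<chi>. {p. prime p \<and> \<chi> p \<noteq> \<infinity>}"
  unfolding char_equiv_def by (metis (mono_tags, lifting))

definition idempotent_type :: "height_type \<Rightarrow> bool" where
  "idempotent_type t \<longleftrightarrow> (\<exists>\<chi>. type_of_char \<chi> = t \<and> (\<forall>p. prime p \<longrightarrow> \<chi> p = 0 \<or> \<chi> p = \<infinity>))"

definition height :: "('a, 'c) monoid_scheme \<Rightarrow> nat \<Rightarrow> 'a \<Rightarrow> enat" where
  "height G p x = (SUP k \<in> {k. x \<in> multiples (p ^ k) G}. enat k)"

definition element_type :: "('a, 'c) monoid_scheme \<Rightarrow> 'a \<Rightarrow> height_type" where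
  "element_type G x = type_of_char (\<lambda>p. height G p x)"

definition homogeneous :: "('a, 'c) monoid_scheme \<Rightarrow> bool" where
  "homogeneous G \<longleftrightarrow>
     (\<forall>x \<in> carrier G - {\<one>\<^bsub>G\<^esub>}. \<forall>y \<in> carrier G - {\<one>\<^bsub>G\<^esub>}. element_type G x = element_type G y)"

text \<open>Meaningful for non-trivial homogeneous groups only.\<close>

definition group_type :: "('a, 'c) monoid_scheme \<Rightarrow> height_type" where
  "group_type G = (THE t. \<forall>x \<in> carrier G - {\<one>\<^bsub>G\<^esub>}. element_type G x = t)"

definition NIL :: "'a monoid set" where
  "NIL = {G. comm_group G \<and> torsion_free G \<and> group_rank G \<noteq> \<infinity> \<and> nil_group G}"

definition MH :: "'a monoid set" where
  "MH = {G. murley_group G \<and> homogeneous G}"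

section \<open>The field of $p$-adic numbers\<close>

text \<open>The completion of $\mathbb{Q}$ for the $p$-adic absolute value: the ring of $p$-adic Cauchy
  sequences of rationals modulo the ideal of $p$-adic null sequences.\<close>

definition padic_abs :: "nat \<Rightarrow> rat \<Rightarrow> real" where
  "padic_abs p x = (if x = 0 then 0 else
     real p powi (int (multiplicity (int p) (snd (quotient_of x))) -
                  int (multiplicity (int p) (fst (quotient_of x)))))"

definition padic_Cauchy :: "nat \<Rightarrow> (nat \<Rightarrow> rat) \<Rightarrow> bool" where
  "padic_Cauchy p s \<longleftrightarrow> (\<forall>e > 0. \<exists>N. \<forall>i \<ge> N. \<forall>j \<ge> N. padic_abs p (s i - s j) < e)"

definition padic_null :: "nat \<Rightarrow> (nat \<Rightarrow> rat) \<Rightarrow> bool" where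
  "padic_null p s \<longleftrightarrow> (\<lambda>i. padic_abs p (s i)) \<longlonglongrightarrow> 0"

definition padic_Cauchy_ring :: "nat \<Rightarrow> (nat \<Rightarrow> rat) ring" where
  "padic_Cauchy_ring p =
     \<lparr>carrier = {s. padic_Cauchy p s}, monoid.mult = (\<lambda>s u i. s i * u i), one = (\<lambda>i. 1),
      zero = (\<lambda>i. 0), add = (\<lambda>s u i. s i + u i)\<rparr>"

definition padic_field :: "nat \<Rightarrow> (nat \<Rightarrow> rat) set ring" where
  "padic_field p = padic_Cauchy_ring p Quot {s. padic_null p s}"

definition int_poly_root_in :: "('a, 'c) ring_scheme \<Rightarrow> int poly \<Rightarrow> 'a \<Rightarrow> bool" where
  "int_poly_root_in R f x \<longleftrightarrow> x \<in> carrier R \<and>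
     (\<Oplus>\<^bsub>R\<^esub>i \<in> {..Polynomial.degree f}. [Polynomial.coeff f i] \<cdot>\<^bsub>R\<^esub> (x [^]\<^bsub>R\<^esub> i)) = \<zero>\<^bsub>R\<^esub>"

definition root_primes :: "int poly \<Rightarrow> nat set" where
  "root_primes f = {p. prime p \<and> (\<exists>x. int_poly_root_in (padic_field p) f x)}"

end

theory Submission
  imports Defs "HOL-Computational_Algebra.Field_as_Ring"
begin

text \<open>
  Let $P_0$ be the set of primes at which $t$ is finite; it is non-empty because
  $t \neq (\infty, \infty, \ldots)$.

  \<^bold>\<open>From a group to a polynomial.\<close> Let $G$ be a homogeneous Murley group of rank $n$ and type $t$ with a
  non-zero multiplication. The height of a product is at least the sum of the heights, so for $xy \neq 0$ the three equal
  types of $x$, $y$ and $xy$ force $t + t \le t$, that is, $t$ is idempotent. For $p \in P_0$ no non-zero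
  element has infinite $p$-height and $G/pG$ is cyclic of order $p$ (\<open>p_rank_le_1_iff\<close>), so that
  $G/p^kG$ is cyclic of order $p^k$ for every $k$. Hence $G$ is a $p$-pure subgroup of the
  $p$-adic integers, and multiplication by an element $x$ is a $p$-adic scalar: modulo each $p^k$ it is
  an integer (\<open>scalar_mod\<close>). It follows that the multiplication is commutative and
  associative and has no zero divisors (\<open>B_commute\<close>, \<open>B_assoc\<close>,
  \<open>B_no_zero_divisors\<close>). Therefore $\mathbb{Q} \otimes G$ is a field of degree $n$. By the
  primitive element theorem an element $a$ of $G$ generates it, and the minimal polynomial $f$ of $a$ is
  irreducible of degree $n$ (\<open>degree_n_generator\<close>). For every $p \in P_0$ the $p$-adic scalar by
  which $a$ acts is a root of $f$ (\<open>padic_root_of_annihilator\<close>).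

  The proof works with congruences modulo $p^k$ instead of the $p$-adic completion of $G$, and realises
  the field inside the complex numbers: the operators of multiplication by elements of $G$ commute,
  so they have a common eigenvector among the additive functions $G \to \mathbb{C}$, and its
  eigenvalues embed $G$ multiplicatively in $\mathbb{C}$ (\<open>complex_embedding\<close>).

  \<^bold>\<open>From a polynomial to a group.\<close> Let $f$ be irreducible of degree $n$ with a root $\gamma$ in
  $\mathbb{C}$ and a root $\sigma_p$ in $\mathbb{Q}_p$ for every $p \in P_0$. Each $p \in P_0$ gives an embedding
  $g(\gamma) \mapsto g(\sigma_p)$ of $K = \mathbb{Q}(\gamma)$ in $\mathbb{Q}_p$. Let $R$ be the subring
  of all elements of $K$ whose image is a $p$-adic integer for every $p \in P_0$. Up to an integer factor, every element of
  $K$ lies in $R$, so $R$ has rank $n$ (\<open>integral_multiple_in_R\<close>, \<open>group_rank_R\<close>).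
  Moreover $R = pR$ for primes $p \notin P_0$, and
  $R = \mathbb{Z} + pR$ for $p \in P_0$ (\<open>R_divide_other\<close>, \<open>R_residue\<close>), which makes all $p$-ranks at most
  $1$. A non-zero $x \in R$ divides a positive integer $m$ in $R$, so its
  height at $p \in P_0$ is bounded by that of $m$ and vanishes for almost all of these $p$
  (\<open>height_R\<close>). So $R$ is a homogeneous Murley group of type $t$, and its ring multiplication is
  not zero (\<open>group_of_R\<close>).
\<close>

section \<open>Rational linear algebra and the primitive element theorem\<close>

lemma map_poly_hom_add:
  assumes "\<phi> 0 = 0" "\<And>a b. \<phi> (a + b) = \<phi> a + \<phi> b"
  shows "map_poly \<phi> (p + q) = map_poly \<phi> p + map_poly \<phi> q"
  by (rule poly_eqI) (simp add: coeff_map_poly assms)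

lemma map_poly_hom_mult:
  fixes \<phi> :: "'a::comm_semiring_0 \<Rightarrow> 'b::comm_semiring_0"
  assumes "\<phi> 0 = 0" "\<And>a b. \<phi> (a + b) = \<phi> a + \<phi> b" "\<And>a b. \<phi> (a * b) = \<phi> a * \<phi> b"
  shows "map_poly \<phi> (p * q) = map_poly \<phi> p * map_poly \<phi> q"
proof (induction p)
  case (pCons a p)
  then show ?case
    by (simp add: map_poly_pCons map_poly_smult map_poly_hom_add assms)
qed simp

text \<open>The form of the dimension bound used throughout. A family with a repeated member is dependent for
  a trivial reason, so the bound holds for families as well as for sets.\<close>

lemma (in vector_space) family_dependent:
  assumes I: "finite I" and B: "finite B" and sub: "f ` I \<subseteq> span B" and card: "card B < card I"
  shows "\<exists>c. (\<exists>i\<in>I. c i \<noteq> 0) \<and> (\<Sum>i\<in>I. scale (c i) (f i)) = 0"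
proof (cases "inj_on f I")
  case True
  have "dependent (f ` I)"
    using independent_span_bound[OF B _ sub] card card_image[OF True] by force
  then obtain u v where u: "v \<in> f ` I" "u v \<noteq> 0" "(\<Sum>v\<in>f ` I. scale (u v) v) = 0"
    using dependent_finite[of "f ` I"] I by auto
  then show ?thesis
    by (intro exI[of _ "u \<circ> f"]) (auto simp: sum.reindex[OF True])
next
  case False
  then obtain i j where ij: "i \<in> I" "j \<in> I" "i \<noteq> j" "f i = f j"
    unfolding inj_on_def by auto
  let ?c = "\<lambda>k. if k = i then 1 else if k = j then - 1 else 0"
  have "(\<Sum>k\<in>I. scale (?c k) (f k)) = (\<Sum>k\<in>{i,j}. scale (?c k) (f k))"
    using ij I by (intro sum.mono_neutral_right) auto
  also have "\<dots> = 0" using ij by simp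
  finally show ?thesis using ij by (intro exI[of _ ?c]) auto
qed

interpretation qv: vector_space "\<lambda>(r::rat) (x::'k::field_char_0). of_rat r * x"
  by unfold_locales (simp_all add: algebra_simps of_rat_add of_rat_mult)

interpretation qp: vector_space "\<lambda>(r::rat) (x::'k::field_char_0 poly). smult (of_rat r) x"
  by unfold_locales (simp_all add: smult_add_right smult_add_left of_rat_add of_rat_mult)

definition evq :: "rat poly \<Rightarrow> 'k::field_char_0 \<Rightarrow> 'k" where
  "evq g x = poly (map_poly of_rat g) x"

lemma evq_0 [simp]: "evq 0 x = 0" and evq_1 [simp]: "evq 1 x = 1"
  and evq_pCons [simp]: "evq (pCons a g) x = of_rat a + x * evq g x"
  by (simp_all add: evq_def map_poly_pCons)

lemma evq_add [simp]: "evq (g + h) x = evq g x + evq h x"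
  by (simp add: evq_def map_poly_hom_add of_rat_add)

lemma evq_mult [simp]: "evq (g * h) x = evq g x * evq h x"
  by (simp add: evq_def map_poly_hom_mult of_rat_add of_rat_mult)

lemma evq_minus [simp]: "evq (- g) x = - evq g x"
  using evq_add[of g "- g" x] by (simp add: eq_neg_iff_add_eq_0 add.commute)

lemma evq_diff [simp]: "evq (g - h) x = evq g x - evq h x"
  using evq_add[of g "- h" x] by simp

lemma evq_smult [simp]: "evq (smult a g) x = of_rat a * evq g x"
  by (simp add: evq_def map_poly_smult of_rat_mult)

lemma evq_power [simp]: "evq (g ^ n) x = evq g x ^ n"
  by (induction n) simp_all

lemma evq_sum [simp]: "evq (\<Sum>i\<in>I. g i) x = (\<Sum>i\<in>I. evq (g i) x)"
  by (induction I rule: infinite_finite_induct) simp_all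

lemma evq_monom [simp]: "evq (monom a n) x = of_rat a * x ^ n"
  by (simp add: evq_def map_poly_monom poly_monom)

lemma evq_pcompose: "evq (pcompose g h) x = evq g (evq h x)"
  by (induction g) (simp_all add: pcompose_pCons)

lemma evq_altdef: "degree g < n \<Longrightarrow> evq g x = (\<Sum>i<n. of_rat (coeff g i) * x ^ i)"
proof -
  assume "degree g < n"
  then have "(\<Sum>i<n. monom (coeff g i) i) = (\<Sum>i\<le>degree g. monom (coeff g i) i)"
    by (intro sum.mono_neutral_right) (auto simp: coeff_eq_0)
  then have "g = (\<Sum>i<n. monom (coeff g i) i)" using poly_as_sum_of_monoms[of g] by simp
  then show ?thesis by (metis (no_types, lifting) evq_monom evq_sum sum.cong)
qed

definition Qadj :: "'k::field_char_0 \<Rightarrow> 'k set" where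
  "Qadj \<gamma> = range (\<lambda>g. evq g \<gamma>)"

lemma Qadj_self: "\<gamma> \<in> Qadj \<gamma>"
  unfolding Qadj_def by (rule range_eqI[of _ _ "[:0, 1:]"]) simp

lemma Qadj_of_rat: "of_rat r \<in> Qadj \<gamma>"
  unfolding Qadj_def by (rule range_eqI[of _ _ "[:r:]"]) simp

lemma Qadj_add: "x \<in> Qadj \<gamma> \<Longrightarrow> y \<in> Qadj \<gamma> \<Longrightarrow> x + y \<in> Qadj \<gamma>"
  unfolding Qadj_def by (auto simp flip: evq_add)

lemma Qadj_diff: "x \<in> Qadj \<gamma> \<Longrightarrow> y \<in> Qadj \<gamma> \<Longrightarrow> x - y \<in> Qadj \<gamma>"
  unfolding Qadj_def by (auto simp flip: evq_diff)

lemma Qadj_mult: "x \<in> Qadj \<gamma> \<Longrightarrow> y \<in> Qadj \<gamma> \<Longrightarrow> x * y \<in> Qadj \<gamma>"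
  unfolding Qadj_def by (auto simp flip: evq_mult)

lemma Qadj_trans: "\<gamma> \<in> Qadj \<delta> \<Longrightarrow> Qadj \<gamma> \<subseteq> Qadj \<delta>"
  unfolding Qadj_def by (auto simp flip: evq_pcompose)

lemma Qadj_span: "W \<subseteq> Qadj \<gamma> \<Longrightarrow> qv.span W \<subseteq> Qadj \<gamma>"
  by (rule qv.span_minimal)
    (auto intro!: qv.subspaceI Qadj_add Qadj_mult Qadj_of_rat Qadj_of_rat[of 0, simplified])

text \<open>Any multiple by a non-zero constant qualifies as well, so an integral polynomial can be a minimal
  polynomial without being made monic.\<close>

definition min_poly_of :: "rat poly \<Rightarrow> 'k::field_char_0 \<Rightarrow> bool" where
  "min_poly_of m x \<longleftrightarrow> m \<noteq> 0 \<and> evq m x = 0 \<and> (\<forall>g. evq g x = 0 \<longrightarrow> g \<noteq> 0 \<longrightarrow> degree m \<le> degree g)"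

lemma min_poly_exists: "g \<noteq> 0 \<Longrightarrow> evq g x = 0 \<Longrightarrow> \<exists>m. min_poly_of m x"
  using ex_has_least_nat[of "\<lambda>g. g \<noteq> 0 \<and> evq g x = 0" g degree] unfolding min_poly_of_def by auto

lemma min_poly_dvd: assumes "min_poly_of m x" "evq g x = 0" shows "m dvd g"
proof -
  have "evq (g mod m) x = evq (g - g div m * m) x"
    by (simp add: minus_div_mult_eq_mod)
  also have "\<dots> = 0" using assms unfolding min_poly_of_def by simp
  finally have "g mod m = 0"
    using assms degree_mod_less'[of m g] unfolding min_poly_of_def by fastforce
  then show ?thesis by auto
qed

lemma min_poly_degree_pos: "min_poly_of m x \<Longrightarrow> degree m > 0"
  unfolding min_poly_of_def by (cases m) (auto split: if_splits)

lemma min_poly_bezout: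
  assumes m: "min_poly_of m x" and g: "evq g x \<noteq> 0"
  shows "\<exists>u v. u * g + v * m = 1"
proof -
  let ?d = "gcd g m"
  have d0: "?d \<noteq> 0" using m unfolding min_poly_of_def by simp
  obtain h where h: "m = ?d * h" by (metis dvd_def gcd_dvd2)
  have "evq ?d x \<noteq> 0" using g by (metis dvd_def evq_mult gcd_dvd1 mult_zero_left)
  then have "evq h x = 0" using m h unfolding min_poly_of_def by (metis evq_mult mult_eq_0_iff)
  moreover have "h \<noteq> 0" using m h unfolding min_poly_of_def by auto
  ultimately have "degree m \<le> degree h" using m unfolding min_poly_of_def by auto
  moreover have "degree m = degree ?d + degree h"
    using h \<open>h \<noteq> 0\<close> d0 by (metis degree_mult_eq)
  ultimately have "degree ?d = 0" by simp
  then obtain c where c: "?d = [:c:]" by (rule degree_eq_zeroE)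
  with d0 have c0: "c \<noteq> 0" by auto
  have "fst (bezout_coefficients g m) * g + snd (bezout_coefficients g m) * m = [:c:]"
    using bezout_coefficients_fst_snd[of g m] c by simp
  then have "smult (1/c) (fst (bezout_coefficients g m)) * g + smult (1/c) (snd (bezout_coefficients g m)) * m = 1"
    using c0 by (simp flip: smult_add_right add: one_pCons)
  then show ?thesis by blast
qed

lemma powers_independent:
  assumes m: "min_poly_of m y" and c: "(\<Sum>i<degree m. of_rat (c i) * y ^ i) = 0" and i: "i < degree m"
  shows "c i = 0"
proof (rule ccontr)
  assume ci: "c i \<noteq> 0"
  define h where "h = (\<Sum>i<degree m. monom (c i) i)"
  have ch: "coeff h j = (if j < degree m then c j else 0)" for j by (simp add: h_def coeff_sum)
  have "h \<noteq> 0" using ch[of i] ci i by auto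
  moreover have "evq h y = 0" using c by (simp add: h_def)
  ultimately have "degree m \<le> degree h" using m unfolding min_poly_of_def by blast
  moreover have "degree h < degree m" using \<open>h \<noteq> 0\<close> ch[of "degree h"] by (metis leading_coeff_0_iff)
  ultimately show False by simp
qed

lemma Qadj_in_span_powers:
  assumes m: "min_poly_of m y" and x: "x \<in> Qadj y"
  shows "x \<in> qv.span ((^) y ` {..<degree m})"
proof -
  obtain g where g: "x = evq g y" using x unfolding Qadj_def by blast
  have m0: "m \<noteq> 0" "evq m y = 0" using m by (auto simp: min_poly_of_def)
  have "evq g y = evq (g div m) y * evq m y + evq (g mod m) y"
    by (metis div_mult_mod_eq evq_add evq_mult)
  then have xm: "x = evq (g mod m) y" using g m0 by simp
  have "g mod m = 0 \<or> degree (g mod m) < degree m" using m0 degree_mod_less[of m g] by simp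
  then have "degree (g mod m) < degree m" using min_poly_degree_pos[OF m] by auto
  then have "x = (\<Sum>j<degree m. of_rat (coeff (g mod m) j) * y ^ j)" using xm evq_altdef by metis
  also have "\<dots> \<in> qv.span ((^) y ` {..<degree m})"
    by (intro qv.span_sum qv.span_scale qv.span_base) auto
  finally show ?thesis .
qed

text \<open>For algebraic \<open>\<gamma>\<close>, the ring $\mathbb{Q}[\gamma]$ is already the field $\mathbb{Q}(\gamma)$.\<close>

lemma Qadj_divide:
  assumes m: "min_poly_of m \<gamma>" and "x \<in> Qadj \<gamma>" "y \<in> Qadj \<gamma>" shows "x / y \<in> Qadj \<gamma>"
proof (cases "y = 0")
  case True then show ?thesis using Qadj_of_rat[of 0] by auto
next
  case False
  obtain g where g: "y = evq g \<gamma>" using assms unfolding Qadj_def by auto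
  obtain u v where "u * g + v * m = 1" using min_poly_bezout[OF m] False g by blast
  then have "evq u \<gamma> * y + evq v \<gamma> * evq m \<gamma> = 1" using g by (metis evq_1 evq_add evq_mult)
  then have "x / y = x * evq u \<gamma>" using m False unfolding min_poly_of_def by (simp add: field_simps)
  then show ?thesis using Qadj_mult[OF assms(2), of "evq u \<gamma>"] unfolding Qadj_def by auto
qed

lemma algebraic_in_finite_span:
  assumes W: "finite W" and x: "\<And>i. x ^ i \<in> qv.span W"
  shows "\<exists>m. min_poly_of m x \<and> degree m \<le> card W"
proof -
  obtain c where c: "\<exists>i\<in>{..card W}. c i \<noteq> 0" "(\<Sum>i\<in>{..card W}. of_rat (c i) * x ^ i) = 0"
    using qv.family_dependent[of "{..card W}" W "\<lambda>i. x ^ i"] W x by auto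
  let ?g = "\<Sum>i\<in>{..card W}. monom (c i) i"
  have co: "coeff ?g j = (if j \<le> card W then c j else 0)" for j
    by (simp add: coeff_sum)
  have "?g \<noteq> 0" using c(1) co by (metis atMost_iff coeff_0)
  moreover have "evq ?g x = 0" using c(2) by simp
  moreover have "degree ?g \<le> card W" by (rule degree_le) (simp add: co)
  ultimately show ?thesis using min_poly_exists[of ?g x] unfolding min_poly_of_def
    by (meson le_trans)
qed

text \<open>A bivariate polynomial $F(T, X)$ over $\mathbb{Q}$ is a polynomial in $X$ whose coefficients are
  polynomials in $T$. This is $F(T, q(T))$.\<close>

abbreviation biev :: "rat poly poly \<Rightarrow> 'k::field_char_0 poly \<Rightarrow> 'k poly" where
  "biev F q \<equiv> poly (map_poly (map_poly of_rat) F) q"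

text \<open>$\frac{d}{dT} F(T, q(T)) = F_T(T, q(T)) + F_X(T, q(T))\, q'(T)$, where mapping \<open>pderiv\<close>
  over the coefficients gives $F_T$.\<close>

lemma biev_chain_rule:
  "pderiv (biev F q) = biev (map_poly pderiv F) q + biev (pderiv F) q * pderiv q"
proof (induction F)
  case (pCons a F)
  have d: "pderiv (map_poly of_rat g) = (map_poly of_rat (pderiv g) :: 'a poly)" for g :: "rat poly"
    by (rule poly_eqI) (simp add: coeff_pderiv coeff_map_poly of_rat_mult of_rat_add)
  have a: "map_poly (map_poly of_rat) (F + G) = map_poly (map_poly of_rat) F + (map_poly (map_poly of_rat) G :: 'a poly poly)" for F G
    by (rule map_poly_hom_add) (simp_all add: map_poly_hom_add of_rat_add)
  show ?case
    by (simp add: map_poly_pCons pderiv_pCons pderiv_add pderiv_mult d a pCons.IH algebra_simps)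
qed simp

lemma poly_biev:
  "poly (biev F q) (of_rat c) = evq (map_poly (\<lambda>h. poly h c) F) (poly q (of_rat c))"
proof (induction F)
  case (pCons a F)
  have "poly (map_poly of_rat a) (of_rat c) = (of_rat (poly a c) :: 'a)"
    by (induction a) (simp_all add: map_poly_pCons of_rat_add of_rat_mult)
  then show ?case using pCons by (simp add: map_poly_pCons)
qed simp

lemma coeffs_in_subring_mult:
  fixes p q :: "'k::comm_ring_1 poly"
  assumes "\<And>x y. x \<in> K \<Longrightarrow> y \<in> K \<Longrightarrow> x + y \<in> K" "\<And>x y. x \<in> K \<Longrightarrow> y \<in> K \<Longrightarrow> x * y \<in> K" "0 \<in> K"
    and "\<And>i. coeff p i \<in> K" "\<And>i. coeff q i \<in> K"
  shows "coeff (p * q) i \<in> K"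
proof -
  have "finite I \<Longrightarrow> (\<forall>i\<in>I. f i \<in> K) \<Longrightarrow> sum f I \<in> K" for f :: "nat \<Rightarrow> 'k" and I
    by (induction I rule: finite_induct) (use assms in auto)
  then show ?thesis unfolding coeff_mult using assms by auto
qed

text \<open>An algebraic relation between $T$ and $\alpha + T \beta$. The monomials $T^a (\alpha + T \beta)^b$ with
  $a \le N$ and $b \le d$ are polynomials in $T$ of degree at most $N + d$ with coefficients in the
  $d$-dimensional space spanned by \<open>W\<close>; for large $N$ they are too many to be independent.\<close>

lemma bivariate_relation:
  fixes \<alpha> \<beta> :: "'k::field_char_0"
  assumes K: "1 \<in> K" "\<And>x y. x \<in> K \<Longrightarrow> y \<in> K \<Longrightarrow> x - y \<in> K" "\<And>x y. x \<in> K \<Longrightarrow> y \<in> K \<Longrightarrow> x * y \<in> K"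
    and W: "finite W" "K \<subseteq> qv.span W" and "\<alpha> \<in> K" "\<beta> \<in> K"
  shows "\<exists>F. F \<noteq> 0 \<and> biev F [:\<alpha>, \<beta>:] = 0"
proof -
  let ?q = "[:\<alpha>, \<beta>:]"
  define d where "d = card W"
  \<comment> \<open>$(N + 1)(d + 1) > d (N + d + 1)$ holds as soon as $N + 1 > d^2$.\<close>
  define N where "N = d * d"
  let ?I = "{..N} \<times> {..d}"
  let ?f = "\<lambda>(a, b). monom 1 a * ?q ^ b :: 'k poly"
  let ?B = "(\<lambda>(w, k). monom w k) ` (W \<times> {..N + d})"
  have K0: "0 \<in> K" using K(2)[OF K(1) K(1)] by simp
  have Ka: "x + y \<in> K" if "x \<in> K" "y \<in> K" for x y
    using K(2)[OF that(1) K(2)[OF K0 that(2)]] by simp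
  have q: "coeff (?q ^ b) i \<in> K" for b i
  proof (induction b arbitrary: i)
    case 0 then show ?case using K0 K(1) by (cases i) auto
  next
    case (Suc b)
    show ?case unfolding power_Suc
      by (rule coeffs_in_subring_mult) (use Suc Ka K K0 assms in \<open>auto simp: coeff_pCons split: nat.split\<close>)
  qed
  have mspan: "monom x k \<in> qp.span ?B" if "x \<in> qv.span W" "k \<le> N + d" for x k
    using that(1)
  proof (induction rule: qv.span_induct_alt)
    case base then show ?case using qp.span_zero by simp
  next
    case (step r x y)
    have "monom (of_rat r * x + y) k = smult (of_rat r) (monom x k) + monom y k"
      by (simp add: smult_monom add_monom)
    moreover have "monom x k \<in> qp.span ?B" using step that(2) by (intro qp.span_base) auto
    ultimately show ?case using step by (auto intro: qp.span_add qp.span_scale)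
  qed
  have "?f i \<in> qp.span ?B" if iI: "i \<in> ?I" for i
  proof -
    obtain a b where i: "i = (a, b)" "a \<le> N" "b \<le> d" using iI by (cases i) auto
    let ?p = "monom 1 a * ?q ^ b"
    have cK: "coeff ?p j \<in> K" for j
      using q K0 by (simp add: coeff_monom_mult)
    have "degree ?p \<le> degree (monom (1::'k) a) + degree (?q ^ b)" by (rule degree_mult_le)
    also have "\<dots> \<le> a + b"
      using degree_power_le[of ?q b] degree_pCons_le[of \<alpha> "[:\<beta>:]"]
      by (intro add_mono degree_monom_le) (metis degree_pCons_0 le_trans mult.commute mult_1 mult_le_mono2 One_nat_def Suc_eq_plus1 add_0)
    finally have deg: "degree ?p \<le> N + d" using i by linarith
    have "?p = (\<Sum>k\<le>degree ?p. monom (coeff ?p k) k)" by (simp add: poly_as_sum_of_monoms)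
    also have "\<dots> \<in> qp.span ?B"
      proof (intro qp.span_sum mspan)
      fix j assume "j \<in> {..degree ?p}"
      then show "coeff ?p j \<in> qv.span W" "j \<le> N + d" using cK W(2) deg by auto
    qed
    finally show ?thesis using i by simp
  qed
  moreover have "card ?B < card ?I"
  proof -
    have "card ?B \<le> card (W \<times> {..N + d})" by (rule card_image_le) (use W in auto)
    also have "\<dots> = d * (N + d + 1)" by (simp add: card_cartesian_product d_def)
    also have "\<dots> < (N + 1) * (d + 1)" unfolding N_def by (simp add: algebra_simps)
    also have "\<dots> = card ?I" by (simp add: card_cartesian_product)
    finally show ?thesis .
  qed
  ultimately obtain c where c: "\<exists>i\<in>?I. c i \<noteq> 0" "(\<Sum>i\<in>?I. smult (of_rat (c i)) (?f i)) = 0"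
    using qp.family_dependent[of ?I ?B ?f] W by (metis (no_types, lifting) finite_SigmaI finite_atMost finite_imageI image_subsetI)
  define F where "F = (\<Sum>i\<in>?I. monom (monom (c i) (fst i)) (snd i))"
  have "coeff (coeff F b) a = c (a, b)" if "(a, b) \<in> ?I" for a b
  proof -
    have "coeff (coeff F b) a = (\<Sum>i\<in>?I. if i = (a,b) then c i else 0)"
      unfolding F_def coeff_sum by (intro sum.cong) (auto simp: coeff_sum)
    then show ?thesis using that by (simp add: sum.delta')
  qed
  then have "F \<noteq> 0" using c(1) by (metis coeff_0 surj_pair)
  have h: "map_poly (map_poly of_rat) (F + G) = map_poly (map_poly of_rat) F + (map_poly (map_poly of_rat) G :: 'k poly poly)" for F G
    by (rule map_poly_hom_add) (simp_all add: map_poly_hom_add of_rat_add)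
  have "biev (\<Sum>i\<in>J. G i) ?q = (\<Sum>i\<in>J. biev (G i) ?q)" for G and J :: "(nat \<times> nat) set"
    by (induction J rule: infinite_finite_induct) (simp_all add: h)
  then have "biev F ?q = (\<Sum>i\<in>?I. smult (of_rat (c i)) (?f i))"
    unfolding F_def
    by (auto intro!: sum.cong simp: map_poly_monom poly_monom smult_monom simp flip: mult_smult_left)
  then show ?thesis using c(2) \<open>F \<noteq> 0\<close> by auto
qed

text \<open>Choose $F$ with $F(T, \alpha + T \beta) = 0$ of least degree in $X$. Differentiation with respect to $T$ gives
  $F_T(T, \alpha + T\beta) + F_X(T, \alpha + T\beta)\, \beta = 0$, and $F_X(T, \alpha + T \beta) \neq 0$ by
  minimality. At an integer $c$ that is not a zero of the latter polynomial, this expresses $\beta$ rationally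
  in $\gamma = \alpha + c \beta$. This replaces the usual argument in a splitting field.\<close>

lemma primitive_element_two:
  fixes \<alpha> \<beta> :: "'k::field_char_0"
  assumes K: "1 \<in> K" "\<And>x y. x \<in> K \<Longrightarrow> y \<in> K \<Longrightarrow> x - y \<in> K" "\<And>x y. x \<in> K \<Longrightarrow> y \<in> K \<Longrightarrow> x * y \<in> K"
    and W: "finite W" "K \<subseteq> qv.span W" and ab: "\<alpha> \<in> K" "\<beta> \<in> K"
  shows "\<exists>\<gamma>\<in>K. \<alpha> \<in> Qadj \<gamma> \<and> \<beta> \<in> Qadj \<gamma>"
proof -
  let ?q = "[:\<alpha>, \<beta>:]"
  obtain F0 where F0: "F0 \<noteq> 0 \<and> biev F0 ?q = 0" using bivariate_relation[OF assms] by blast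
  obtain F where F: "F \<noteq> 0" "biev F ?q = 0"
    and min: "\<And>G. G \<noteq> 0 \<Longrightarrow> biev G ?q = 0 \<Longrightarrow> degree F \<le> degree G"
    using ex_has_least_nat[of "\<lambda>F. F \<noteq> 0 \<and> biev F ?q = 0" F0 degree] F0 by auto
  have "degree F > 0"
  proof (rule ccontr)
    assume "\<not> degree F > 0"
    then obtain g where g: "F = [:g:]" by (metis degree_eq_zeroE gr0I)
    then have "map_poly of_rat g = (0 :: 'k poly)" using F by (simp add: map_poly_pCons)
    then have "g = 0" by (subst (asm) map_poly_eq_0_iff) auto
    then show False using F g by simp
  qed
  then have "pderiv F \<noteq> 0" "degree (pderiv F) < degree F" by (auto simp: pderiv_eq_0_iff degree_pderiv)
  then have H0: "biev (pderiv F) ?q \<noteq> 0" (is "?H \<noteq> 0") using min by fastforce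
  have "finite {x. poly ?H x = 0}" using H0 poly_roots_finite by blast
  moreover have "infinite (range (of_nat :: nat \<Rightarrow> 'k))"
    using range_inj_infinite[OF inj_of_nat] .
  ultimately have "\<not> range (of_nat :: nat \<Rightarrow> 'k) \<subseteq> {x. poly ?H x = 0}"
    using finite_subset by blast
  \<comment> \<open>A non-zero polynomial has only finitely many roots, so one of the natural numbers avoids them.\<close>
  then obtain c :: nat where c: "poly ?H (of_nat c) \<noteq> 0" by auto
  define \<gamma> where "\<gamma> = \<alpha> + of_nat c * \<beta>"
  have K0: "0 \<in> K" using K(2)[OF K(1) K(1)] by simp
  have Ka: "x + y \<in> K" if "x \<in> K" "y \<in> K" for x y
    using K(2)[OF that(1) K(2)[OF K0 that(2)]] by simp
  have "of_nat m * \<beta> \<in> K" for m :: nat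
    by (induction m) (use K0 Ka ab in \<open>auto simp: algebra_simps\<close>)
  then have gK: "\<gamma> \<in> K" unfolding \<gamma>_def using Ka ab by auto
  then have "\<gamma> ^ i \<in> K" for i by (induction i) (use K in auto)
  then obtain m where m: "min_poly_of m \<gamma>"
    using algebraic_in_finite_span[OF W(1), of \<gamma>] W(2) by blast
  have q: "poly ?q (of_rat (of_nat c)) = \<gamma>" by (simp add: \<gamma>_def)
  have "biev (map_poly pderiv F) ?q + ?H * [:\<beta>:] = 0"
    using biev_chain_rule[of F ?q] F(2) by (simp add: pderiv_pCons)
  then have "poly (biev (map_poly pderiv F) ?q + ?H * [:\<beta>:]) (of_rat (of_nat c)) = 0" by simp
  then have "poly (biev (map_poly pderiv F) ?q) (of_rat (of_nat c)) + poly ?H (of_rat (of_nat c)) * \<beta> = 0"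
    by (simp only: poly_add poly_mult) simp
  moreover have "poly ?H (of_rat (of_nat c)) \<noteq> 0" using c by simp
  ultimately obtain u v where uv: "evq u \<gamma> + evq v \<gamma> * \<beta> = 0" "evq v \<gamma> \<noteq> 0"
    unfolding poly_biev q by blast
  then have "evq v \<gamma> * \<beta> = - evq u \<gamma>" by (simp add: eq_neg_iff_add_eq_0 add.commute)
  then have "\<beta> = evq (- u) \<gamma> / evq v \<gamma>" using uv(2) by (simp add: field_simps)
  moreover have "evq (- u) \<gamma> \<in> Qadj \<gamma>" "evq v \<gamma> \<in> Qadj \<gamma>" unfolding Qadj_def by blast+
  ultimately have b: "\<beta> \<in> Qadj \<gamma>" using Qadj_divide[OF m] by metis
  have "\<alpha> = \<gamma> - of_rat (of_nat c) * \<beta>" unfolding \<gamma>_def by simp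
  also have "\<dots> \<in> Qadj \<gamma>" by (intro Qadj_diff Qadj_self Qadj_mult Qadj_of_rat b)
  finally have "\<alpha> \<in> Qadj \<gamma>" .
  then show ?thesis using b gK by blast
qed

text \<open>Stated for a subring of finite rank, such as the image of a group with a multiplication. The
  generator is then found in the subring itself and not only in its field of fractions.\<close>

theorem primitive_element:
  fixes K :: "'k::field_char_0 set"
  assumes K: "1 \<in> K" "\<And>x y. x \<in> K \<Longrightarrow> y \<in> K \<Longrightarrow> x - y \<in> K" "\<And>x y. x \<in> K \<Longrightarrow> y \<in> K \<Longrightarrow> x * y \<in> K"
    and W: "finite W" "K \<subseteq> qv.span W"
  shows "\<exists>\<gamma>\<in>K. K \<subseteq> Qadj \<gamma>"
proof -
  obtain B where B: "B \<subseteq> K" "qv.independent B" "K \<subseteq> qv.span B"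
    using qv.maximal_independent_subset by blast
  have "finite B" using qv.independent_span_bound[OF W(1) B(2)] B W by auto
  then have "B \<subseteq> K \<Longrightarrow> \<exists>\<gamma>\<in>K. B \<subseteq> Qadj \<gamma>"
  proof (induction B rule: finite_induct)
    case empty then show ?case using K(1) by auto
  next
    case (insert b B)
    then obtain \<gamma> where g: "\<gamma> \<in> K" "B \<subseteq> Qadj \<gamma>" by auto
    obtain \<delta> where "\<delta> \<in> K" "\<gamma> \<in> Qadj \<delta>" "b \<in> Qadj \<delta>"
      using primitive_element_two[OF K W g(1), of b] insert by auto
    then show ?case using Qadj_trans g by blast
  qed
  then show ?thesis using B Qadj_span by blast
qed

section \<open>The p-adic absolute value and roots in the field of p-adic numbers\<close>

lemma padic_abs_0 [simp]: "padic_abs p 0 = 0"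
  by (simp add: padic_abs_def)

text \<open>The definition refers to reduced fractions; this frees the calculations from that.\<close>

lemma padic_abs_fraction:
  assumes p: "prime p" and "a \<noteq> 0" "b \<noteq> 0"
  shows "padic_abs p (of_int a / of_int b) =
    real p powi (int (multiplicity (int p) b) - int (multiplicity (int p) a))"
proof -
  obtain u v where uv: "quotient_of (of_int a / of_int b) = (u, v)" by fastforce
  then have v: "v > 0" and eq: "(of_int a / of_int b :: rat) = of_int u / of_int v"
    using quotient_of_denom_pos quotient_of_div by auto
  have "(of_int (a * v) :: rat) = of_int (u * b)"
    using eq v assms by (simp add: field_simps)
  then have e: "a * v = u * b" by (simp only: of_int_eq_iff)
  then have "u \<noteq> 0" using v assms by auto
  moreover have pe: "prime_elem (int p)" using p by simp
  ultimately have "multiplicity (int p) a + multiplicity (int p) v = multiplicity (int p) u + multiplicity (int p) b"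
    using e assms v prime_elem_multiplicity_mult_distrib[OF pe]
    by (metis less_irrefl)
  then have "int (multiplicity (int p) v) - int (multiplicity (int p) u) =
      int (multiplicity (int p) b) - int (multiplicity (int p) a)" by linarith
  then show ?thesis using uv assms unfolding padic_abs_def by simp
qed

lemma rat_fraction: "\<exists>a b. b \<noteq> 0 \<and> x = of_int a / of_int b" for x :: rat
  by (metis prod.exhaust quotient_of_denom_pos quotient_of_div less_irrefl)

lemma padic_abs_nonneg [simp]: "padic_abs p x \<ge> 0"
  by (simp add: padic_abs_def)

lemma padic_abs_mult: assumes p: "prime p" shows "padic_abs p (x * y) = padic_abs p x * padic_abs p y"
proof (cases "x = 0 \<or> y = 0")
  case False
  obtain a b where x: "b \<noteq> 0" "x = of_int a / of_int b" using rat_fraction by blast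
  obtain c d where y: "d \<noteq> 0" "y = of_int c / of_int d" using rat_fraction by blast
  have ac: "a \<noteq> 0" "c \<noteq> 0" using False x y by auto
  have "x * y = of_int (a * c) / of_int (b * d)" using x y by simp
  then have "padic_abs p (x * y) = real p powi (int (multiplicity (int p) (b * d)) - int (multiplicity (int p) (a * c)))"
    using padic_abs_fraction[OF p, of "a * c" "b * d"] ac x y by simp
  also have "\<dots> = real p powi ((int (multiplicity (int p) b) - int (multiplicity (int p) a)) + (int (multiplicity (int p) d) - int (multiplicity (int p) c)))"
    using p ac x y by (simp add: prime_elem_multiplicity_mult_distrib algebra_simps)
  also have "\<dots> = padic_abs p x * padic_abs p y"
    using padic_abs_fraction[OF p] ac x y prime_gt_0_nat[OF p] by (subst power_int_add) auto
  finally show ?thesis .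
qed auto

lemma padic_abs_ultrametric: assumes p: "prime p" shows "padic_abs p (x + y) \<le> max (padic_abs p x) (padic_abs p y)"
proof (cases "x = 0 \<or> y = 0 \<or> x + y = 0")
  case False
  obtain a b where x: "b \<noteq> 0" "x = of_int a / of_int b" using rat_fraction by blast
  obtain c d where y: "d \<noteq> 0" "y = of_int c / of_int d" using rat_fraction by blast
  let ?m = "multiplicity (int p)"
  define u v w where "u = a * d" and "v = c * b" and "w = b * d"
  have e: "x = of_int u / of_int w" "y = of_int v / of_int w" "x + y = of_int (u + v) / of_int w"
    using x y by (simp_all add: u_def v_def w_def field_simps)
  have nz: "u \<noteq> 0" "v \<noteq> 0" "w \<noteq> 0" "u + v \<noteq> 0" using False x y e by auto
  have "int p ^ min (?m u) (?m v) dvd u + v"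
    by (intro dvd_add) (auto intro: multiplicity_dvd')
  then have m: "min (?m u) (?m v) \<le> ?m (u + v)"
    using p nz by (intro multiplicity_geI) auto
  have p1: "real p \<ge> 1" using p prime_ge_1_nat by auto
  have "padic_abs p (x + y) = real p powi (int (?m w) - int (?m (u + v)))"
    using padic_abs_fraction[OF p, of "u + v" w] nz e by simp
  also have "\<dots> \<le> real p powi (int (?m w) - int (min (?m u) (?m v)))"
    using p1 m by (intro power_int_increasing) auto
  also have "\<dots> \<le> max (padic_abs p x) (padic_abs p y)"
    using padic_abs_fraction[OF p, of u w] padic_abs_fraction[OF p, of v w] nz e
    by (auto simp: min_def)
  finally show ?thesis .
qed (auto simp: le_max_iff_disj)

lemma padic_abs_of_int_le_iff:
  assumes p: "prime p" shows "padic_abs p (of_int a) \<le> 1 / real p ^ k \<longleftrightarrow> int p ^ k dvd a"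
proof (cases "a = 0")
  case False
  have p1: "real p > 1" using p prime_gt_1_nat by auto
  have "padic_abs p (of_int a) = real p powi (0 - int (multiplicity (int p) a))"
    using padic_abs_fraction[OF p False, of 1] by simp
  also have "\<dots> = 1 / real p ^ multiplicity (int p) a"
    by (simp add: power_int_minus divide_inverse)
  finally have "padic_abs p (of_int a) = 1 / real p ^ multiplicity (int p) a" .
  then have "padic_abs p (of_int a) \<le> 1 / real p ^ k \<longleftrightarrow>
      real p ^ k \<le> real p ^ multiplicity (int p) a"
    using p1 by (simp add: inverse_le_iff_le flip: inverse_eq_divide)
  also have "\<dots> \<longleftrightarrow> k \<le> multiplicity (int p) a"
    using p1 power_increasing_iff by blast
  also have "\<dots> \<longleftrightarrow> int p ^ k dvd a"
    using False p prime_gt_1_nat[OF p] by (subst power_dvd_iff_le_multiplicity) auto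
  finally show ?thesis .
qed auto

lemma padic_abs_of_int_le_1: "prime p \<Longrightarrow> padic_abs p (of_int a) \<le> 1"
  using padic_abs_of_int_le_iff[of p a 0] by simp

lemma padic_abs_1 [simp]: "padic_abs p 1 = 1"
  by (simp add: padic_abs_def)

lemma padic_abs_uminus [simp]: "padic_abs p (- x) = padic_abs p x"
proof -
  have "multiplicity (int p) (- k) = multiplicity (int p) k" for k
    by (simp add: multiplicity_def)
  then show ?thesis by (simp add: padic_abs_def rat_uminus_code case_prod_beta)
qed

lemma padic_abs_diff: "prime p \<Longrightarrow> padic_abs p (x - y) \<le> max (padic_abs p x) (padic_abs p y)"
  using padic_abs_ultrametric[of p x "- y"] by simp

lemma padic_abs_inverse_of_nat:
  assumes p: "prime p" and q: "prime q"
  shows "padic_abs p (1 / of_nat q) = (if p = q then real p else 1)"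
proof -
  have q0: "int q \<noteq> 0" using q prime_gt_0_nat[of q] by auto
  have "padic_abs p (1 / of_nat q) = real p powi (int (multiplicity (int p) (int q)))"
    using padic_abs_fraction[OF p, of 1 "int q"] q0 by simp
  moreover have "multiplicity (int p) (int q) = (if p = q then 1 else 0)"
    using p q prime_multiplicity_other[of "int p" "int q"] by auto
  ultimately show ?thesis by simp
qed

lemma padic_abs_power: "prime p \<Longrightarrow> padic_abs p (x ^ n) = padic_abs p x ^ n"
  by (induction n) (simp_all add: padic_abs_mult)

lemma padic_abs_of_nat_self: assumes "prime p" shows "padic_abs p (of_nat p) = 1 / real p"
proof -
  have "padic_abs p (of_nat p) * padic_abs p (1 / of_nat p) = 1"
    using assms prime_gt_0_nat[of p] by (simp flip: padic_abs_mult)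
  then show ?thesis using assms padic_abs_inverse_of_nat[OF assms assms] prime_gt_0_nat[OF assms]
    by (simp add: field_simps)
qed

text \<open>The residue field of $\mathbb{Z}_{(p)}$ is represented by integers: if $r = u/v$ with $p \nmid v$, then $v$ is invertible modulo $p$.\<close>

lemma padic_integer_residue:
  assumes p: "prime p" and r: "padic_abs p r \<le> 1"
  shows "\<exists>a. padic_abs p (r - of_int a) \<le> 1 / real p"
proof -
  obtain u v where uv: "quotient_of r = (u, v)" by fastforce
  then have v: "v > 0" "coprime u v" and eq: "r = of_int u / of_int v"
    using quotient_of_denom_pos quotient_of_div quotient_of_coprime by auto
  have nd: "\<not> int p dvd v"
  proof
    assume d: "int p dvd v"
    then have nu: "\<not> int p dvd u" using v(2) p
      by (metis coprime_common_divisor not_prime_unit prime_int_nat_transfer prime_nat_int_transfer)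
    then have "u \<noteq> 0" by auto
    have "multiplicity (int p) v \<ge> 1" using d v(1) p by (intro multiplicity_geI) auto
    moreover have "multiplicity (int p) u = 0" using nu by (rule not_dvd_imp_multiplicity_0)
    ultimately have "padic_abs p r = real p powi (int (multiplicity (int p) v))" "multiplicity (int p) v \<ge> 1"
      using padic_abs_fraction[OF p \<open>u \<noteq> 0\<close>, of v] v eq by auto
    then have "padic_abs p r > 1" using p prime_gt_1_nat[of p] by (simp add: one_less_power)
    then show False using r by simp
  qed
  then have "coprime (int p) v" using p by (meson prime_imp_coprime prime_nat_int_transfer)
  then obtain s t where st: "s * int p + t * v = 1" using bezout_int[of "int p" v] by auto
  have "multiplicity (int p) v = 0" using nd by (rule not_dvd_imp_multiplicity_0)
  then have v1: "padic_abs p (1 / of_int v) = 1" using padic_abs_fraction[OF p, of 1 v] v by simp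
  have "t * v = 1 - s * int p" using st by simp
  then have tv: "(of_int t * of_int v :: rat) = 1 - of_int s * of_nat p"
    by (metis of_int_1 of_int_diff of_int_mult of_int_of_nat_eq)
  have "r - of_int (u * t) = of_int u * (1 - of_int t * of_int v) * (1 / of_int v)"
    using v eq by (simp add: field_simps)
  also have "\<dots> = of_int (u * s * int p) * (1 / of_int v)" by (simp add: tv)
  finally have "padic_abs p (r - of_int (u * t)) = padic_abs p (of_int (u * s * int p))"
    using p v1 by (simp only: padic_abs_mult)
  also have "\<dots> \<le> 1 / real p ^ 1" using padic_abs_of_int_le_iff[OF p] by (metis dvd_triv_right power_one_right)
  finally show ?thesis unfolding power_one_right by (rule exI)
qed

lemma padic_Cauchy_bounded:
  assumes p: "prime p" and s: "padic_Cauchy p s"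
  shows "\<exists>C N. C > 0 \<and> (\<forall>i\<ge>N. padic_abs p (s i) \<le> C)"
proof -
  obtain N where N: "\<forall>i\<ge>N. \<forall>j\<ge>N. padic_abs p (s i - s j) < 1"
    using s unfolding padic_Cauchy_def by (meson zero_less_one)
  have "padic_abs p (s i) \<le> max 1 (padic_abs p (s N))" if "i \<ge> N" for i
    using padic_abs_ultrametric[OF p, of "s i - s N" "s N"] N that by force
  then show ?thesis by (intro exI[of _ "max 1 (padic_abs p (s N))"] exI[of _ N]) auto
qed

lemma padic_Cauchy_const [simp]: "padic_Cauchy p (\<lambda>i. c)"
  by (simp add: padic_Cauchy_def)

lemma padic_Cauchy_add:
  assumes p: "prime p" and s: "padic_Cauchy p s" "padic_Cauchy p u"
  shows "padic_Cauchy p (\<lambda>i. s i + u i)"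
  unfolding padic_Cauchy_def
proof (intro allI impI)
  fix e :: real assume "e > 0"
  then obtain M N where M: "\<forall>i\<ge>M. \<forall>j\<ge>M. padic_abs p (s i - s j) < e" "\<forall>i\<ge>N. \<forall>j\<ge>N. padic_abs p (u i - u j) < e"
    using s unfolding padic_Cauchy_def by meson
  have "padic_abs p (s i + u i - (s j + u j)) < e" if "i \<ge> max M N" "j \<ge> max M N" for i j
    using padic_abs_ultrametric[OF p, of "s i - s j" "u i - u j"] M that
    by (force simp: add_diff_add)
  then show "\<exists>N. \<forall>i\<ge>N. \<forall>j\<ge>N. padic_abs p (s i + u i - (s j + u j)) < e" by blast
qed

lemma padic_Cauchy_uminus: "padic_Cauchy p s \<Longrightarrow> padic_Cauchy p (\<lambda>i. - s i)"
proof -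
  have "padic_abs p (- s i - - s j) = padic_abs p (s i - s j)" for i j
    using padic_abs_uminus[of p "s i - s j"] by simp
  then show "padic_Cauchy p s \<Longrightarrow> padic_Cauchy p (\<lambda>i. - s i)" unfolding padic_Cauchy_def by simp
qed

lemma padic_Cauchy_mult:
  assumes p: "prime p" and s: "padic_Cauchy p s" "padic_Cauchy p u"
  shows "padic_Cauchy p (\<lambda>i. s i * u i)"
  unfolding padic_Cauchy_def
proof (intro allI impI)
  fix e :: real assume e: "e > 0"
  obtain C D K L where C: "C > 0" "\<forall>i\<ge>K. padic_abs p (s i) \<le> C" and D: "D > 0" "\<forall>i\<ge>L. padic_abs p (u i) \<le> D"
    using padic_Cauchy_bounded[OF p s(1)] padic_Cauchy_bounded[OF p s(2)] by blast
  obtain M where M: "\<forall>i\<ge>M. \<forall>j\<ge>M. padic_abs p (s i - s j) < e / D"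
    using s e D(1) unfolding padic_Cauchy_def by (meson divide_pos_pos)
  obtain N where N: "\<forall>i\<ge>N. \<forall>j\<ge>N. padic_abs p (u i - u j) < e / C"
    using s e C(1) unfolding padic_Cauchy_def by (meson divide_pos_pos)
  have "padic_abs p (s i * u i - s j * u j) < e" if ij: "i \<ge> max (max M N) (max K L)" "j \<ge> max (max M N) (max K L)" for i j
  proof -
    have "padic_abs p (s i * (u i - u j)) \<le> C * padic_abs p (u i - u j)"
      using C ij p by (simp add: padic_abs_mult mult_right_mono)
    also have "\<dots> < C * (e / C)" using N ij C(1) by (intro mult_strict_left_mono) auto
    finally have 1: "padic_abs p (s i * (u i - u j)) < e" using C(1) by simp
    have "padic_abs p ((s i - s j) * u j) \<le> padic_abs p (s i - s j) * D"
      using D ij p by (simp add: padic_abs_mult mult_left_mono)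
    also have "\<dots> < (e / D) * D" using M ij D(1) by (intro mult_strict_right_mono) auto
    finally have 2: "padic_abs p ((s i - s j) * u j) < e" using D(1) by simp
    have "s i * u i - s j * u j = s i * (u i - u j) + (s i - s j) * u j" by (simp add: algebra_simps)
    then show ?thesis using padic_abs_ultrametric[OF p, of "s i * (u i - u j)" "(s i - s j) * u j"] 1 2 by simp
  qed
  then show "\<exists>N. \<forall>i\<ge>N. \<forall>j\<ge>N. padic_abs p (s i * u i - s j * u j) < e" by blast
qed

lemma padic_Cauchy_poly:
  assumes p: "prime p" and s: "padic_Cauchy p s" shows "padic_Cauchy p (\<lambda>i. poly g (s i))"
  by (induction g) (simp_all add: padic_Cauchy_add padic_Cauchy_mult p s)

lemma padic_null_iff: "padic_null p s \<longleftrightarrow> (\<forall>e>0. \<exists>N. \<forall>i\<ge>N. padic_abs p (s i) < e)"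
  unfolding padic_null_def LIMSEQ_iff by simp

lemma padic_null_imp_Cauchy: assumes p: "prime p" and "padic_null p s" shows "padic_Cauchy p s"
  unfolding padic_Cauchy_def
proof (intro allI impI)
  fix e :: real assume e: "e > 0"
  then obtain N where "\<forall>i\<ge>N. padic_abs p (s i) < e" using assms(2) padic_null_iff by blast
  then show "\<exists>N. \<forall>i\<ge>N. \<forall>j\<ge>N. padic_abs p (s i - s j) < e"
    using padic_abs_diff[OF p] by (intro exI[of _ N]) (smt (verit, best))
qed

lemma padic_null_add: assumes p: "prime p" and "padic_null p s" "padic_null p u"
  shows "padic_null p (\<lambda>i. s i + u i)"
  unfolding padic_null_iff
proof (intro allI impI)
  fix e :: real assume e: "e > 0"
  then obtain N M where "\<forall>i\<ge>N. padic_abs p (s i) < e" "\<forall>i\<ge>M. padic_abs p (u i) < e"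
    using assms padic_null_iff by metis
  then have "padic_abs p (s i + u i) < e" if "i \<ge> max N M" for i
    using padic_abs_ultrametric[OF p, of "s i" "u i"] that by force
  then show "\<exists>N. \<forall>i\<ge>N. padic_abs p (s i + u i) < e" by blast
qed

lemma padic_null_mult: assumes p: "prime p" and s: "padic_null p s" and u: "padic_Cauchy p u"
  shows "padic_null p (\<lambda>i. s i * u i)"
  unfolding padic_null_iff
proof (intro allI impI)
  fix e :: real assume e: "e > 0"
  obtain D L where D: "D > 0" "\<forall>i\<ge>L. padic_abs p (u i) \<le> D" using padic_Cauchy_bounded[OF p u] by blast
  obtain N where N: "\<forall>i\<ge>N. padic_abs p (s i) < e / D" using s e D(1) padic_null_iff by (meson divide_pos_pos)
  have "padic_abs p (s i * u i) < e" if "i \<ge> max N L" for i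
  proof -
    have "padic_abs p (s i * u i) \<le> padic_abs p (s i) * D" using D that p by (simp add: padic_abs_mult mult_left_mono)
    also have "\<dots> < (e / D) * D" using N that D(1) by (intro mult_strict_right_mono) auto
    finally show ?thesis using D(1) by simp
  qed
  then show "\<exists>N. \<forall>i\<ge>N. padic_abs p (s i * u i) < e" by blast
qed

lemma padic_Cauchy_ring_simps:
  "carrier (padic_Cauchy_ring p) = {s. padic_Cauchy p s}"
  "s \<otimes>\<^bsub>padic_Cauchy_ring p\<^esub> u = (\<lambda>i. s i * u i)"
  "s \<oplus>\<^bsub>padic_Cauchy_ring p\<^esub> u = (\<lambda>i. s i + u i)"
  "\<one>\<^bsub>padic_Cauchy_ring p\<^esub> = (\<lambda>i. 1)" "\<zero>\<^bsub>padic_Cauchy_ring p\<^esub> = (\<lambda>i. 0)"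
  by (simp_all add: padic_Cauchy_ring_def)

lemma cring_padic_Cauchy_ring: assumes p: "prime p" shows "cring (padic_Cauchy_ring p)"
proof (rule cringI)
  show "abelian_group (padic_Cauchy_ring p)"
  proof (rule abelian_groupI)
    fix x assume "x \<in> carrier (padic_Cauchy_ring p)"
    then show "\<exists>y\<in>carrier (padic_Cauchy_ring p). y \<oplus>\<^bsub>padic_Cauchy_ring p\<^esub> x = \<zero>\<^bsub>padic_Cauchy_ring p\<^esub>"
      by (intro bexI[of _ "\<lambda>i. - x i"]) (simp_all add: padic_Cauchy_ring_simps padic_Cauchy_uminus)
  qed (simp_all add: padic_Cauchy_ring_simps padic_Cauchy_add p algebra_simps)
  show "Group.comm_monoid (padic_Cauchy_ring p)"
    by (rule comm_monoidI) (simp_all add: padic_Cauchy_ring_simps padic_Cauchy_mult p algebra_simps)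
qed (simp_all add: padic_Cauchy_ring_simps algebra_simps)

lemma ideal_padic_null: assumes p: "prime p" shows "ideal {s. padic_null p s} (padic_Cauchy_ring p)"
proof -
  interpret cring "padic_Cauchy_ring p" by (rule cring_padic_Cauchy_ring[OF p])
  have m: "padic_null p (\<lambda>i. - s i)" if "padic_null p s" for s using that by (simp add: padic_null_iff)
  show ?thesis
  proof (rule idealI)
    show "subgroup {s. padic_null p s} (add_monoid (padic_Cauchy_ring p))"
    proof (rule group.subgroupI[OF a_group])
      show "{s. padic_null p s} \<subseteq> carrier (add_monoid (padic_Cauchy_ring p))"
        using padic_null_imp_Cauchy[OF p] by (auto simp: padic_Cauchy_ring_simps)
      show "{s. padic_null p s} \<noteq> {}" by (auto simp: padic_null_iff intro!: exI[of _ "\<lambda>i. 0"])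
      fix a assume a: "a \<in> {s. padic_null p s}"
      have "inv\<^bsub>add_monoid (padic_Cauchy_ring p)\<^esub> a = (\<lambda>i. - a i)"
        by (rule group.inv_equality[OF a_group])
          (use a m padic_null_imp_Cauchy[OF p] in \<open>auto simp: padic_Cauchy_ring_simps\<close>)
      then show "inv\<^bsub>add_monoid (padic_Cauchy_ring p)\<^esub> a \<in> {s. padic_null p s}" using a m by simp
    qed (auto simp: padic_Cauchy_ring_simps padic_null_add p)
  qed (auto simp: padic_Cauchy_ring_simps padic_null_mult p mult.commute ring_axioms)
qed

text \<open>Brings roots in the quotient ring down to sequences of rational numbers. The projection from the ring of Cauchy
  sequences is a ring homomorphism, and operations on sequences are pointwise.\<close>

lemma int_poly_root_in_padic_field_iff:
  assumes p: "prime p"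
  shows "(\<exists>x. int_poly_root_in (padic_field p) f x) \<longleftrightarrow>
    (\<exists>s. padic_Cauchy p s \<and> padic_null p (\<lambda>i. poly (map_poly of_int f) (s i)))"
proof -
  let ?R = "padic_Cauchy_ring p" and ?I = "{s. padic_null p s}"
  interpret R: cring ?R by (rule cring_padic_Cauchy_ring[OF p])
  interpret I: ideal ?I ?R by (rule ideal_padic_null[OF p])
  interpret Q: cring "?R Quot ?I" by (rule I.quotient_is_cring[OF cring_padic_Cauchy_ring[OF p]])
  interpret h: ring_hom_ring ?R "?R Quot ?I" "(+>\<^bsub>?R\<^esub>) ?I" by (rule I.rcos_ring_hom_ring)
  interpret hc: ring_hom_cring ?R "?R Quot ?I" "(+>\<^bsub>?R\<^esub>) ?I"
    by (intro ring_hom_cring.intro ring_hom_cring_axioms.intro R.cring_axioms Q.cring_axioms h.homh)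
  interpret ha: group_hom "add_monoid ?R" "add_monoid (?R Quot ?I)" "(+>\<^bsub>?R\<^esub>) ?I"
    using h.a_group_hom .
  have nat: "[k] \<cdot>\<^bsub>?R\<^esub> s = (\<lambda>i. of_nat k * s i)" if "s \<in> carrier ?R" for k :: nat and s
  proof (induction k)
    case (Suc k)
    have "[Suc k] \<cdot>\<^bsub>?R\<^esub> s = [k] \<cdot>\<^bsub>?R\<^esub> s \<oplus>\<^bsub>?R\<^esub> s" by (rule R.add.nat_pow_Suc)
    then show ?case using Suc by (simp add: padic_Cauchy_ring_simps algebra_simps)
  qed (simp add: padic_Cauchy_ring_simps)
  have neg: "\<ominus>\<^bsub>?R\<^esub> s = (\<lambda>i. - s i)" if "s \<in> carrier ?R" for s
    by (rule R.minus_equality)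
      (use that in \<open>simp_all add: padic_Cauchy_ring_simps padic_Cauchy_uminus\<close>)
  have int: "[k] \<cdot>\<^bsub>?R\<^esub> s = (\<lambda>i. of_int k * s i)" if s: "s \<in> carrier ?R" for k :: int and s
  proof (cases "k \<ge> 0")
    case True
    then show ?thesis using nat[OF s, of "nat k"] by (simp add: add_pow_int_ge)
  next
    case False
    have "[nat (- k)] \<cdot>\<^bsub>?R\<^esub> s \<in> carrier ?R" using s by (rule R.add.nat_pow_closed)
    then show ?thesis using False nat[OF s, of "nat (- k)"] neg by (simp add: add_pow_int_lt)
  qed
  have pw: "s [^]\<^bsub>?R\<^esub> n = (\<lambda>i. s i ^ n)" for s and n :: nat
    by (induction n) (simp_all add: padic_Cauchy_ring_simps mult.commute)
  have fs: "finsum ?R g J = (\<lambda>i. \<Sum>j\<in>J. g j i)" if "finite J" "g \<in> J \<rightarrow> carrier ?R" for g and J :: "nat set"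
    using that by (induction J) (auto simp: padic_Cauchy_ring_simps)
  have key: "(\<Oplus>\<^bsub>?R Quot ?I\<^esub>i\<in>{..degree f}. [coeff f i] \<cdot>\<^bsub>?R Quot ?I\<^esub> ((?I +>\<^bsub>?R\<^esub> s) [^]\<^bsub>?R Quot ?I\<^esub> i))
    = ?I +>\<^bsub>?R\<^esub> (\<lambda>i. poly (map_poly of_int f) (s i))" if s: "s \<in> carrier ?R" for s
  proof -
    have sc: "s [^]\<^bsub>?R\<^esub> i \<in> carrier ?R" for i :: nat using s by simp
    have tc: "[coeff f i] \<cdot>\<^bsub>?R\<^esub> (s [^]\<^bsub>?R\<^esub> i) \<in> carrier ?R" for i :: nat
      using R.add.int_pow_closed[OF sc] by simp
    have "[coeff f i] \<cdot>\<^bsub>?R Quot ?I\<^esub> ((?I +>\<^bsub>?R\<^esub> s) [^]\<^bsub>?R Quot ?I\<^esub> i) = ?I +>\<^bsub>?R\<^esub> ([coeff f i] \<cdot>\<^bsub>?R\<^esub> (s [^]\<^bsub>?R\<^esub> i))" for i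
      using ha.hom_int_pow[of "s [^]\<^bsub>?R\<^esub> i" "coeff f i"] sc h.hom_nat_pow[OF s, of i]
      by (simp add: add_pow_def)
    then have "(\<Oplus>\<^bsub>?R Quot ?I\<^esub>i\<in>{..degree f}. [coeff f i] \<cdot>\<^bsub>?R Quot ?I\<^esub> ((?I +>\<^bsub>?R\<^esub> s) [^]\<^bsub>?R Quot ?I\<^esub> i))
      = (\<Oplus>\<^bsub>?R Quot ?I\<^esub>i\<in>{..degree f}. ((+>\<^bsub>?R\<^esub>) ?I \<circ> (\<lambda>i. [coeff f i] \<cdot>\<^bsub>?R\<^esub> (s [^]\<^bsub>?R\<^esub> i))) i)"
      by simp
    also have "\<dots> = ?I +>\<^bsub>?R\<^esub> (\<Oplus>\<^bsub>?R\<^esub>i\<in>{..degree f}. [coeff f i] \<cdot>\<^bsub>?R\<^esub> (s [^]\<^bsub>?R\<^esub> i))"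
      using tc by (intro hc.hom_finsum[symmetric]) auto
    also have "(\<Oplus>\<^bsub>?R\<^esub>i\<in>{..degree f}. [coeff f i] \<cdot>\<^bsub>?R\<^esub> (s [^]\<^bsub>?R\<^esub> i)) = (\<lambda>i. poly (map_poly of_int f) (s i))"
    proof -
      have d: "degree (map_poly rat_of_int f) = degree f" by (rule degree_map_poly) simp
      have "(\<Oplus>\<^bsub>?R\<^esub>i\<in>{..degree f}. [coeff f i] \<cdot>\<^bsub>?R\<^esub> (s [^]\<^bsub>?R\<^esub> i)) = (\<lambda>i. \<Sum>j\<in>{..degree f}. ([coeff f j] \<cdot>\<^bsub>?R\<^esub> (s [^]\<^bsub>?R\<^esub> j)) i)"
        using tc by (intro fs) auto
      then show ?thesis unfolding int[OF sc] unfolding pw by (simp add: poly_altdef d coeff_map_poly)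
    qed
    finally show ?thesis .
  qed
  have zero: "?I +>\<^bsub>?R\<^esub> u = \<zero>\<^bsub>?R Quot ?I\<^esub> \<longleftrightarrow> padic_null p u" if u: "u \<in> carrier ?R" for u
  proof -
    have "\<zero>\<^bsub>?R Quot ?I\<^esub> = ?I" unfolding FactRing_def by simp
    moreover have "u \<in> ?I +>\<^bsub>?R\<^esub> u" using I.a_rcos_self[OF u] .
    moreover have "u \<in> ?I \<Longrightarrow> ?I +>\<^bsub>?R\<^esub> u = ?I" by (rule I.a_rcos_const)
    ultimately show ?thesis by (metis mem_Collect_eq)
  qed
  have "int_poly_root_in (padic_field p) f x \<longleftrightarrow> (\<exists>s. x = ?I +>\<^bsub>?R\<^esub> s \<and> padic_Cauchy p s \<and> padic_null p (\<lambda>i. poly (map_poly of_int f) (s i)))" for x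
  proof -
    have "x \<in> carrier (padic_field p) \<longleftrightarrow> (\<exists>s \<in> carrier ?R. x = ?I +>\<^bsub>?R\<^esub> s)"
      by (auto simp: padic_field_def FactRing_def A_RCOSETS_def' a_r_coset_def)
    moreover have "int_poly_root_in (padic_field p) f (?I +>\<^bsub>?R\<^esub> s) \<longleftrightarrow> padic_null p (\<lambda>i. poly (map_poly of_int f) (s i))" if s: "s \<in> carrier ?R" for s
    proof -
      have "(\<lambda>i. poly (map_poly of_int f) (s i)) \<in> carrier ?R"
        using s padic_Cauchy_poly[OF p] by (simp add: padic_Cauchy_ring_simps)
      then show ?thesis
        using key[OF s] zero h.hom_closed[OF s] unfolding int_poly_root_in_def padic_field_def by simp
    qed
    moreover have "int_poly_root_in (padic_field p) f x \<Longrightarrow> x \<in> carrier (padic_field p)"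
      by (simp add: int_poly_root_in_def)
    ultimately show ?thesis by (auto simp: padic_Cauchy_ring_simps(1))
  qed
  then show ?thesis by blast
qed

section \<open>Multiplications and bilinear maps\<close>

definition bimultiplicative :: "('a, 'c) monoid_scheme \<Rightarrow> ('a \<Rightarrow> 'a \<Rightarrow> 'a) \<Rightarrow> bool" where
  "bimultiplicative G b \<longleftrightarrow>
    (\<forall>x\<in>carrier G. \<forall>y\<in>carrier G. b x y \<in> carrier G) \<and>
    (\<forall>x\<in>carrier G. \<forall>x'\<in>carrier G. \<forall>y\<in>carrier G. b (x \<otimes>\<^bsub>G\<^esub> x') y = b x y \<otimes>\<^bsub>G\<^esub> b x' y) \<and>
    (\<forall>x\<in>carrier G. \<forall>y\<in>carrier G. \<forall>y'\<in>carrier G. b x (y \<otimes>\<^bsub>G\<^esub> y') = b x y \<otimes>\<^bsub>G\<^esub> b x y')"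

lemma tensor_relations_normal:
  fixes G :: "('a, 'c) monoid_scheme" (structure)
  assumes "comm_group G"
  defines "F \<equiv> free_Abelian_group (carrier G \<times> carrier G)"
  shows "tensor_relations G G \<subseteq> carrier F" "generate F (tensor_relations G G) \<lhd> F"
proof -
  interpret G: comm_group G by fact
  interpret F: comm_group F unfolding F_def by (rule abelian_free_Abelian_group)
  have d: "a - b - c \<in> carrier F" if "a \<in> carrier F" "b \<in> carrier F" "c \<in> carrier F" for a b c
    using that keys_diff[of a b] keys_diff[of "a - b" c] unfolding F_def carrier_free_Abelian_group_iff by blast
  have f: "frag_of (x, y) \<in> carrier F" if "x \<in> carrier G" "y \<in> carrier G" for x y
    using that unfolding F_def by simp
  show "tensor_relations G G \<subseteq> carrier F"
    unfolding tensor_relations_def by (auto intro!: d f)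
  then show "generate F (tensor_relations G G) \<lhd> F"
    by (intro F.subgroup_imp_normal F.generate_is_subgroup)
qed

text \<open>The universal property of the tensor product: the free abelian group extends \<open>b\<close>
  additively, and the extension kills the tensor relations.\<close>

lemma multiplication_of_bimultiplicative:
  fixes G :: "('a, 'c) monoid_scheme" (structure)
  assumes G: "comm_group G" and b: "bimultiplicative G b"
  shows "\<exists>\<mu>\<in>multiplications G. \<forall>x\<in>carrier G. \<forall>y\<in>carrier G. \<exists>u\<in>carrier (tensor_product G G). \<mu> u = b x y"
proof -
  interpret G: comm_group G by fact
  define F where "F = free_Abelian_group (carrier G \<times> carrier G)"
  define N where "N = generate F (tensor_relations G G)"
  interpret F: comm_group F unfolding F_def by (rule abelian_free_Abelian_group)
  have R: "tensor_relations G G \<subseteq> carrier F" and N: "N \<lhd> F"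
    using tensor_relations_normal[OF G] by (simp_all add: F_def N_def)
  have "(\<lambda>(x, y). b x y) ` (carrier G \<times> carrier G) \<subseteq> carrier G"
    using b by (auto simp: bimultiplicative_def)
  then obtain h where h: "h \<in> hom F G"
    and hf: "\<And>z. z \<in> carrier G \<times> carrier G \<Longrightarrow> h (frag_of z) = (\<lambda>(x, y). b x y) z"
    using G.free_Abelian_group_universal unfolding F_def by metis
  interpret h: group_hom F G h by (rule group_hom.intro) (auto simp: h group_hom_axioms_def F.is_group)
  have hd: "h (a - b - c) = h a \<otimes> inv h b \<otimes> inv h c"
    if "a \<in> carrier F" "b \<in> carrier F" "c \<in> carrier F" for a b c
  proof -
    have "a - b - c = a \<otimes>\<^bsub>F\<^esub> inv\<^bsub>F\<^esub> b \<otimes>\<^bsub>F\<^esub> inv\<^bsub>F\<^esub> c"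
      using that by (simp add: F_def)
    then show ?thesis using that by simp
  qed
  have f: "frag_of (x, y) \<in> carrier F" if "x \<in> carrier G" "y \<in> carrier G" for x y
    using that unfolding F_def by simp
  have bc: "b x y \<in> carrier G" if "x \<in> carrier G" "y \<in> carrier G" for x y
    using b that by (auto simp: bimultiplicative_def)
  have c: "u \<otimes> v \<otimes> inv u \<otimes> inv v = \<one>" if "u \<in> carrier G" "v \<in> carrier G" for u v
  proof -
    have "u \<otimes> v \<otimes> inv u \<otimes> inv v = (u \<otimes> v) \<otimes> inv (u \<otimes> v)"
      using that by (simp add: G.inv_mult G.m_assoc)
    then show ?thesis using that by simp
  qed
  have "tensor_relations G G \<subseteq> kernel F G h"
  proof
    fix r assume r: "r \<in> tensor_relations G G"
    then have "h r = \<one>"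
      unfolding tensor_relations_def
      using b by (auto simp: hd hf f bc c bimultiplicative_def)
    then show "r \<in> kernel F G h" using R r by (auto simp: kernel_def)
  qed
  then have NK: "N \<subseteq> kernel F G h"
    unfolding N_def by (rule F.generate_subgroup_incl[OF _ h.subgroup_kernel])
  obtain g where g: "g \<in> hom (F Mod N) G" "\<And>x. x \<in> carrier F \<Longrightarrow> g (N #>\<^bsub>F\<^esub> x) = h x"
  proof (rule FactGroup_universal[OF h N])
    fix x y assume xy: "x \<in> carrier F" "y \<in> carrier F" "N #>\<^bsub>F\<^esub> x = N #>\<^bsub>F\<^esub> y"
    have "subgroup N F" using N by (rule normal_imp_subgroup)
    then have "x \<in> N #>\<^bsub>F\<^esub> y" using xy F.rcos_self by blast
    then obtain n where n: "n \<in> N" "x = n \<otimes>\<^bsub>F\<^esub> y" unfolding r_coset_def by auto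
    then have "n \<in> carrier F" "h n = \<one>" using NK by (auto simp: kernel_def)
    then show "h x = h y" using n xy by simp
  qed (rule that)
  have T: "tensor_product G G = F Mod N" by (simp add: tensor_product_def F_def N_def)
  show ?thesis
  proof (intro bexI[of _ g] ballI)
    show "g \<in> multiplications G" unfolding multiplications_def T by (rule g)
    fix x y assume xy: "x \<in> carrier G" "y \<in> carrier G"
    show "\<exists>u\<in>carrier (tensor_product G G). g u = b x y"
      using g(2)[OF f[OF xy]] hf xy f[OF xy] by (intro bexI[of _ "N #>\<^bsub>F\<^esub> frag_of (x, y)"]) (auto simp: T carrier_FactGroup)
  qed
qed

text \<open>The converse: restrict \<open>\<mu>\<close> to pure tensors. As these generate the tensor product, a
  multiplication that vanishes on them is zero.\<close>

lemma bimultiplicative_of_multiplication: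
  fixes G :: "('a, 'c) monoid_scheme" (structure)
  assumes G: "comm_group G" and mu: "\<mu> \<in> multiplications G"
  shows "\<exists>b. bimultiplicative G b \<and>
    ((\<forall>x\<in>carrier G. \<forall>y\<in>carrier G. b x y = \<one>) \<longrightarrow> (\<forall>u\<in>carrier (tensor_product G G). \<mu> u = \<one>))"
proof -
  interpret G: comm_group G by fact
  define F where "F = free_Abelian_group (carrier G \<times> carrier G)"
  define N where "N = generate F (tensor_relations G G)"
  interpret F: comm_group F unfolding F_def by (rule abelian_free_Abelian_group)
  have R: "tensor_relations G G \<subseteq> carrier F" and N: "N \<lhd> F"
    using tensor_relations_normal[OF G] by (simp_all add: F_def N_def)
  interpret N: normal N F by fact
  have T: "tensor_product G G = F Mod N" by (simp add: tensor_product_def F_def N_def)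
  define h where "h = (\<lambda>u. \<mu> (N #>\<^bsub>F\<^esub> u))"
  have h: "h \<in> hom F G"
    using hom_compose[OF N.r_coset_hom_Mod, of \<mu> G] mu unfolding multiplications_def T h_def comp_def by simp
  interpret h: group_hom F G h by (rule group_hom.intro) (auto simp: h group_hom_axioms_def F.is_group)
  have hN: "h u = \<one>" if "u \<in> N" for u
  proof -
    have "N #>\<^bsub>F\<^esub> u = N #>\<^bsub>F\<^esub> \<one>\<^bsub>F\<^esub>"
      using that N.rcos_const[OF F.is_group] N.subset by (simp add: F.coset_mult_one)
    then show ?thesis using h.hom_one by (simp add: h_def)
  qed
  have hR: "h r = \<one>" if "r \<in> tensor_relations G G" for r
    using hN that generate.incl[of r] unfolding N_def by blast
  have f: "frag_of (x, y) \<in> carrier F" if "x \<in> carrier G" "y \<in> carrier G" for x y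
    using that unfolding F_def by simp
  have hd: "h a = h b \<otimes> h c" if "h (a - b - c) = \<one>" "a \<in> carrier F" "b \<in> carrier F" "c \<in> carrier F" for a b c
  proof -
    have "a - b - c = a \<otimes>\<^bsub>F\<^esub> inv\<^bsub>F\<^esub> b \<otimes>\<^bsub>F\<^esub> inv\<^bsub>F\<^esub> c"
      using that by (simp add: F_def)
    then have "h a \<otimes> inv h b \<otimes> inv h c = \<one>" using that by simp
    then have "\<one> = h a \<otimes> inv (h b \<otimes> h c)"
      using that by (simp add: G.inv_mult G.m_assoc)
    then show ?thesis using that G.inv_solve_right[of "\<one>" "h a" "h b \<otimes> h c"] by simp
  qed
  have r1: "frag_of (x \<otimes> x', y) - frag_of (x, y) - frag_of (x', y) \<in> tensor_relations G G"
    if "x \<in> carrier G" "x' \<in> carrier G" "y \<in> carrier G" for x x' y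
    unfolding tensor_relations_def using that by blast
  have r2: "frag_of (y, x \<otimes> x') - frag_of (y, x) - frag_of (y, x') \<in> tensor_relations G G"
    if "x \<in> carrier G" "x' \<in> carrier G" "y \<in> carrier G" for x x' y
    unfolding tensor_relations_def using that by blast
  define b where "b = (\<lambda>x y. h (frag_of (x, y)))"
  have "bimultiplicative G b"
    unfolding bimultiplicative_def
  proof (intro conjI ballI)
    fix x x' y assume x: "x \<in> carrier G" "x' \<in> carrier G" "y \<in> carrier G"
    show "b x y \<in> carrier G" unfolding b_def using f x by simp
    show "b (x \<otimes> x') y = b x y \<otimes> b x' y"
      unfolding b_def by (rule hd[OF hR[OF r1]]) (use x f in simp_all)
    show "b y (x \<otimes> x') = b y x \<otimes> b y x'"
      unfolding b_def by (rule hd[OF hR[OF r2]]) (use x f in simp_all)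
  qed
  moreover have "\<mu> u = \<one>"
    if b1: "\<And>x y. x \<in> carrier G \<Longrightarrow> y \<in> carrier G \<Longrightarrow> b x y = \<one>" and u: "u \<in> carrier (tensor_product G G)" for u
  proof -
    obtain v where v: "v \<in> carrier F" "u = N #>\<^bsub>F\<^esub> v" using u by (auto simp: T carrier_FactGroup)
    have "h v = \<one>"
    proof (rule free_Abelian_group_induct[of v "carrier G \<times> carrier G" "\<lambda>v. h v = \<one>"])
      show "Poly_Mapping.keys v \<subseteq> carrier G \<times> carrier G" using v by (simp add: F_def)
      show "h 0 = \<one>" using h.hom_one by (simp add: F_def)
      show "h (frag_of a) = \<one>" if "a \<in> carrier G \<times> carrier G" for a
        using that b1 by (auto simp: b_def)
      fix x y assume xy: "Poly_Mapping.keys x \<subseteq> carrier G \<times> carrier G" "Poly_Mapping.keys y \<subseteq> carrier G \<times> carrier G"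
        "h x = \<one>" "h y = \<one>"
      then have "x - y = x \<otimes>\<^bsub>F\<^esub> inv\<^bsub>F\<^esub> y" "x \<in> carrier F" "y \<in> carrier F" by (simp_all add: F_def)
      then show "h (x - y) = \<one>" using xy by simp
    qed
    then show ?thesis using v by (simp add: h_def)
  qed
  ultimately show ?thesis by blast
qed

section \<open>Abelian groups as additive subgroups of a ring of characteristic zero\<close>

locale Z_submodule =
  fixes A :: "'v::{idom, ring_char_0} set"
  assumes zero_closed [simp]: "0 \<in> A"
    and diff_closed: "x \<in> A \<Longrightarrow> y \<in> A \<Longrightarrow> x - y \<in> A"
begin

lemma minus_closed: "x \<in> A \<Longrightarrow> - x \<in> A"
  using diff_closed[of 0 x] by simp

lemma add_closed: "x \<in> A \<Longrightarrow> y \<in> A \<Longrightarrow> x + y \<in> A"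
  using diff_closed[of x "- y"] minus_closed by simp

lemma of_nat_closed: "x \<in> A \<Longrightarrow> of_nat k * x \<in> A"
  by (induction k) (simp_all add: add_closed algebra_simps)

lemma of_int_closed: "x \<in> A \<Longrightarrow> of_int k * x \<in> A"
  using of_nat_closed minus_closed by (cases k rule: int_cases2) force+

lemma sum_closed: "(\<And>i. i \<in> I \<Longrightarrow> f i \<in> A) \<Longrightarrow> sum f I \<in> A"
  by (induction I rule: infinite_finite_induct) (auto simp: add_closed)

end

text \<open>The group \<open>G\<close>, written multiplicatively, is identified with an additive subgroup \<open>A\<close> of a domain of
  characteristic zero. The multiplication of the domain serves only to write integer multiples as
  \<open>of_int k * x\<close>. Both directions of the theorem use such a model: rational polynomials
  of bounded degree (coordinate vectors) in one, complex numbers in the other.\<close>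

locale additive_model = Z_submodule A for A :: "'v::{idom, ring_char_0} set" +
  fixes G :: "'a monoid" (structure) and \<phi> :: "'v \<Rightarrow> 'a"
  assumes comm_group: "comm_group G"
    and bij: "bij_betw \<phi> A (carrier G)"
    and add: "x \<in> A \<Longrightarrow> y \<in> A \<Longrightarrow> \<phi> (x + y) = \<phi> x \<otimes> \<phi> y"
begin

sublocale G: comm_group G by (rule comm_group)

lemma phi_closed [simp]: "x \<in> A \<Longrightarrow> \<phi> x \<in> carrier G"
  using bij by (auto simp: bij_betw_def)

lemma phi_surj: "x \<in> carrier G \<Longrightarrow> \<exists>y\<in>A. x = \<phi> y"
  using bij by (auto simp: bij_betw_def)

lemma phi_inj: "x \<in> A \<Longrightarrow> y \<in> A \<Longrightarrow> \<phi> x = \<phi> y \<longleftrightarrow> x = y"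
  using bij by (auto simp: bij_betw_def inj_on_def)

lemma phi_0: "\<phi> 0 = \<one>"
  using add[of 0 0] by (metis G.l_cancel_one add_0 phi_closed zero_closed)

lemma phi_eq_one: "x \<in> A \<Longrightarrow> \<phi> x = \<one> \<longleftrightarrow> x = 0"
  using phi_inj[of x 0] phi_0 by simp

lemma phi_nat_pow: "x \<in> A \<Longrightarrow> \<phi> x [^] (k :: nat) = \<phi> (of_nat k * x)"
proof (induction k)
  case (Suc k)
  have "of_nat (Suc k) * x = of_nat k * x + x" by (simp add: algebra_simps)
  then show ?case using Suc by (simp only: G.nat_pow_Suc add of_nat_closed)
qed (simp add: phi_0)

lemma phi_uminus: "x \<in> A \<Longrightarrow> \<phi> (- x) = inv \<phi> x"
  using add[of "- x" x] minus_closed[of x] phi_0 by (intro G.inv_equality[symmetric]) auto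

lemma phi_int_pow: "x \<in> A \<Longrightarrow> \<phi> x [^] (k :: int) = \<phi> (of_int k * x)"
proof (cases k rule: int_cases2)
  case (nonneg n)
  then show "x \<in> A \<Longrightarrow> ?thesis" by (simp add: int_pow_int phi_nat_pow)
next
  case (nonpos n)
  then show "x \<in> A \<Longrightarrow> ?thesis" by (simp add: G.int_pow_neg int_pow_int phi_nat_pow of_nat_closed flip: phi_uminus)
qed

lemma phi_sum: "finite S \<Longrightarrow> (\<And>s. s \<in> S \<Longrightarrow> f s \<in> A) \<Longrightarrow> finprod G (\<lambda>s. \<phi> (f s)) S = \<phi> (sum f S)"
  by (induction S rule: finite_induct) (simp_all add: phi_0 add sum_closed Pi_def)

lemma multiples_iff: "x \<in> A \<Longrightarrow> \<phi> x \<in> multiples m G \<longleftrightarrow> (\<exists>y\<in>A. x = of_nat m * y)"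
  unfolding multiples_def using phi_surj
  by (auto simp: image_iff) (metis phi_nat_pow phi_inj of_nat_closed phi_closed)+

text \<open>The set of \<open>k\<close> such that $p^k$ divides \<open>x\<close> is downward closed. So the supremum that
  defines the height exceeds exactly these \<open>k\<close>.\<close>

lemma height_ge_iff: assumes x: "x \<in> A"
  shows "enat k \<le> height G p (\<phi> x) \<longleftrightarrow> (\<exists>y\<in>A. x = of_nat p ^ k * y)"
proof -
  let ?P = "\<lambda>k. \<exists>y\<in>A. x = of_nat p ^ k * y"
  have h: "height G p (\<phi> x) = (SUP k \<in> {k. ?P k}. enat k)"
    unfolding height_def using multiples_iff[OF x] by simp
  have down: "?P j" if "?P k" "j \<le> k" for j k
  proof -
    obtain y where y: "y \<in> A" "x = of_nat p ^ k * y" using \<open>?P k\<close> by auto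
    have "of_nat p ^ k = (of_nat p ^ j * of_nat (p ^ (k - j)) :: 'v)"
      using \<open>j \<le> k\<close> by (simp flip: power_add)
    then show ?thesis using y of_nat_closed[OF y(1), of "p ^ (k - j)"] by (metis mult.assoc)
  qed
  have P0: "?P 0" using x by auto
  show ?thesis
  proof
    assume "?P k" then show "enat k \<le> height G p (\<phi> x)" unfolding h by (intro SUP_upper) simp
  next
    assume k: "enat k \<le> height G p (\<phi> x)"
    show "?P k"
    proof (rule ccontr)
      assume nk: "\<not> ?P k"
      then have "k > 0" using P0 by (cases k) auto
      have "height G p (\<phi> x) \<le> enat (k - 1)"
        unfolding h
      proof (intro SUP_least)
        fix j assume "j \<in> {k. ?P k}"
        then have "\<not> k \<le> j" using nk down by blast
        then show "enat j \<le> enat (k - 1)" by simp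
      qed
      then have "enat k \<le> enat (k - 1)" using k by (rule order_trans[rotated])
      then show False using \<open>k > 0\<close> by simp
    qed
  qed
qed

lemma torsion_free: "torsion_free G"
  unfolding torsion_free_def
proof (intro ballI allI impI)
  fix x and k :: nat assume x: "x \<in> carrier G" "k > 0" "x [^] k = \<one>"
  obtain y where y: "y \<in> A" "x = \<phi> y" using phi_surj x by blast
  then have "of_nat k * y = 0" using x phi_nat_pow[of y k] phi_eq_one[OF of_nat_closed] by simp
  then show "x = \<one>" using x y phi_0 by simp
qed

definition Z_independent :: "'v set \<Rightarrow> bool" where
  "Z_independent S \<longleftrightarrow> (\<forall>c :: 'v \<Rightarrow> int. (\<Sum>x\<in>S. of_int (c x) * x) = 0 \<longrightarrow> (\<forall>x\<in>S. c x = 0))"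

lemma independent_mod_0_iff: assumes S: "S \<subseteq> A"
  shows "independent_mod 0 G (\<phi> ` S) \<longleftrightarrow> finite S \<and> Z_independent S"
proof -
  have inj: "inj_on \<phi> S" using bij S by (auto simp: bij_betw_def inj_on_def)
  have fin: "finite (\<phi> ` S) \<longleftrightarrow> finite S" using inj by (rule finite_image_iff)
  have key: "finprod G (\<lambda>x. x [^] c x) (\<phi> ` S) = \<one> \<longleftrightarrow> (\<Sum>x\<in>S. of_int (c (\<phi> x)) * x) = 0"
    if "finite S" for c :: "'a \<Rightarrow> int"
  proof -
    have "finprod G (\<lambda>x. x [^] c x) (\<phi> ` S) = finprod G (\<lambda>x. \<phi> x [^] c (\<phi> x)) S"
      using inj S by (intro G.finprod_reindex) auto
    also have "\<dots> = finprod G (\<lambda>x. \<phi> (of_int (c (\<phi> x)) * x)) S"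
      using S by (intro G.finprod_cong') (auto simp: phi_int_pow of_int_closed)
    also have "\<dots> = \<phi> (\<Sum>x\<in>S. of_int (c (\<phi> x)) * x)"
      using S that by (intro phi_sum) (auto intro: of_int_closed)
    finally show ?thesis using S by (simp add: phi_eq_one sum_closed of_int_closed subset_iff)
  qed
  show ?thesis
  proof (cases "finite S")
    case True
    have "(\<forall>c :: 'a \<Rightarrow> int. (\<Sum>x\<in>S. of_int (c (\<phi> x)) * x) = 0 \<longrightarrow> (\<forall>x\<in>\<phi> ` S. c x = 0)) \<longleftrightarrow> Z_independent S"
      unfolding Z_independent_def
    proof (intro iffI allI impI ballI)
      fix c :: "'v \<Rightarrow> int" and x
      assume H: "\<forall>c :: 'a \<Rightarrow> int. (\<Sum>x\<in>S. of_int (c (\<phi> x)) * x) = 0 \<longrightarrow> (\<forall>x\<in>\<phi> ` S. c x = 0)"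
        and c: "(\<Sum>x\<in>S. of_int (c x) * x) = 0" and x: "x \<in> S"
      have e: "inv_into S \<phi> (\<phi> x) = x" if "x \<in> S" for x using inj that by simp
      have "(\<Sum>x\<in>S. of_int ((c \<circ> inv_into S \<phi>) (\<phi> x)) * x) = 0" using c e by simp
      then have "(c \<circ> inv_into S \<phi>) (\<phi> x) = 0" using H x by blast
      then show "c x = 0" using e x by simp
    qed auto
    then show ?thesis unfolding independent_mod_def using key[OF True] fin S True by auto
  qed (use fin in \<open>auto simp: independent_mod_def\<close>)
qed

lemma group_rank_eq: "group_rank G = (SUP S\<in>{S. S \<subseteq> A \<and> finite S \<and> Z_independent S}. enat (card S))"
proof -
  let ?L = "{S. S \<subseteq> A \<and> finite S \<and> Z_independent S}"
  have "{S. independent_mod 0 G S} = (`) \<phi> ` ?L"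
  proof (intro equalityI subsetI)
    fix T assume "T \<in> {S. independent_mod 0 G S}"
    then have T: "independent_mod 0 G T" "T \<subseteq> \<phi> ` A" using bij by (auto simp: independent_mod_def bij_betw_def)
    then obtain S where "S \<subseteq> A" "T = \<phi> ` S" by (meson subset_imageE)
    then show "T \<in> (`) \<phi> ` ?L" using T independent_mod_0_iff[of S] by auto
  qed (use independent_mod_0_iff in auto)
  moreover have "card (\<phi> ` S) = card S" if "S \<in> ?L" for S
    using that bij by (intro card_image) (auto simp: bij_betw_def inj_on_def)
  ultimately show ?thesis unfolding group_rank_def by (simp add: image_image)
qed

text \<open>Calculations in $G/pG$ become congruences modulo $p$ in \<open>A\<close>.\<close>

lemma quotient_model:
  fixes p :: nat
  defines "\<pi> \<equiv> \<lambda>x. multiples p G #> \<phi> x"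
  shows "comm_group (G Mod multiples p G)"
    "carrier (G Mod multiples p G) = \<pi> ` A"
    "x \<in> A \<Longrightarrow> y \<in> A \<Longrightarrow> \<pi> (x + y) = \<pi> x \<otimes>\<^bsub>G Mod multiples p G\<^esub> \<pi> y"
    "x \<in> A \<Longrightarrow> \<pi> x [^]\<^bsub>G Mod multiples p G\<^esub> (k :: int) = \<pi> (of_int k * x)"
    "x \<in> A \<Longrightarrow> y \<in> A \<Longrightarrow> \<pi> x = \<pi> y \<longleftrightarrow> (\<exists>z\<in>A. x - y = of_nat p * z)"
    "\<one>\<^bsub>G Mod multiples p G\<^esub> = \<pi> 0"
proof -
  let ?N = "multiples p G"
  have Nim: "?N = \<phi> ` {of_nat p * z | z. z \<in> A}"
  proof (intro equalityI subsetI)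
    fix x assume "x \<in> ?N"
    moreover then have "x \<in> carrier G" by (auto simp: multiples_def)
    then obtain y where "y \<in> A" "x = \<phi> y" using phi_surj by blast
    ultimately show "x \<in> \<phi> ` {of_nat p * z | z. z \<in> A}" using multiples_iff by blast
  qed (use multiples_iff of_nat_closed in auto)
  have sub: "subgroup ?N G"
  proof (rule G.subgroupI)
    show "?N \<subseteq> carrier G" by (auto simp: multiples_def)
    show "?N \<noteq> {}" using Nim zero_closed by blast
    fix a assume "a \<in> ?N"
    then obtain z where z: "z \<in> A" "a = \<phi> (of_nat p * z)" using Nim by auto
    then have "inv a = \<phi> (of_nat p * (- z))" by (simp add: phi_uminus of_nat_closed)
    then show "inv a \<in> ?N" using Nim z minus_closed by blast
    fix b assume "b \<in> ?N"
    then obtain w where w: "w \<in> A" "b = \<phi> (of_nat p * w)" using Nim by auto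
    have "a \<otimes> b = \<phi> (of_nat p * (z + w))"
      using w z by (simp add: distrib_left add of_nat_closed)
    then show "a \<otimes> b \<in> ?N" using Nim z w add_closed by blast
  qed
  then interpret N: normal ?N G by (rule G.subgroup_imp_normal)
  show "comm_group (G Mod ?N)" by (rule G.abelian_FactGroup[OF sub])
  interpret Q: comm_group "G Mod ?N" by (rule G.abelian_FactGroup[OF sub])
  interpret h: group_hom G "G Mod ?N" "\<lambda>x. ?N #> x"
    by (rule group_hom.intro) (auto simp: group_hom_axioms_def N.r_coset_hom_Mod)
  show "carrier (G Mod ?N) = \<pi> ` A"
    using bij unfolding \<pi>_def carrier_FactGroup bij_betw_def by (metis image_image)
  show "x \<in> A \<Longrightarrow> y \<in> A \<Longrightarrow> \<pi> (x + y) = \<pi> x \<otimes>\<^bsub>G Mod ?N\<^esub> \<pi> y"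
    unfolding \<pi>_def using h.hom_mult[of "\<phi> x" "\<phi> y"] by (simp add: add)
  show "x \<in> A \<Longrightarrow> \<pi> x [^]\<^bsub>G Mod ?N\<^esub> (k :: int) = \<pi> (of_int k * x)"
    unfolding \<pi>_def using h.hom_int_pow[of "\<phi> x" k] by (simp add: phi_int_pow)
  show "\<one>\<^bsub>G Mod ?N\<^esub> = \<pi> 0"
    unfolding \<pi>_def phi_0 using h.hom_one by simp
  show "\<pi> x = \<pi> y \<longleftrightarrow> (\<exists>z\<in>A. x - y = of_nat p * z)" if xy: "x \<in> A" "y \<in> A"
  proof -
    have "\<pi> x = \<pi> y \<longleftrightarrow> \<phi> x \<in> ?N #> \<phi> y"
      unfolding \<pi>_def using xy G.repr_independence[OF _ _ sub] G.rcos_self[OF _ sub]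
      by (metis phi_closed)
    also have "\<dots> \<longleftrightarrow> (\<exists>z\<in>A. \<phi> x = \<phi> (of_nat p * z) \<otimes> \<phi> y)"
      unfolding r_coset_def Nim by auto
    also have "\<dots> \<longleftrightarrow> (\<exists>z\<in>A. x = of_nat p * z + y)"
      using xy by (simp add: phi_inj of_nat_closed add_closed flip: add)
    finally show ?thesis by (simp add: algebra_simps)
  qed
qed

end

context additive_model begin

text \<open>The $p$-rank is at most $1$ iff $G/pG$ is cyclic. If $g \notin pG$, any $x$ is dependent on $g$ modulo $p$; the
  coefficient of $x$ is then invertible modulo $p$, since otherwise $g$ would lie in $pG$.\<close>

lemma p_rank_le_1_iff:
  assumes p: "prime p"
  shows "p_rank p G \<le> 1 \<longleftrightarrow> (\<exists>g\<in>A. \<forall>x\<in>A. \<exists>a::int. \<exists>y\<in>A. x = of_int a * g + of_nat p * y)"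
proof -
  let ?N = "multiples p G" and ?Q = "G Mod multiples p G"
  define \<pi> where "\<pi> = (\<lambda>x. ?N #>\<^bsub>G\<^esub> \<phi> x)"
  have pi: "?N #>\<^bsub>G\<^esub> \<phi> x = \<pi> x" for x by (simp add: \<pi>_def)
  note Q = quotient_model[where p = p, unfolded pi]
  interpret Q: comm_group ?Q by (rule Q)
  have piC: "\<pi> x \<in> carrier ?Q" if "x \<in> A" for x using that Q(2) by auto
  have pi0: "\<pi> x = \<one>\<^bsub>?Q\<^esub> \<longleftrightarrow> (\<exists>z\<in>A. x = of_nat p * z)" if "x \<in> A" for x
    using Q(5)[OF that zero_closed] Q(6) by simp
  have two: "finprod ?Q (\<lambda>X. X [^]\<^bsub>?Q\<^esub> c X) {\<pi> x, \<pi> y} = \<pi> (of_int (c (\<pi> x)) * x + of_int (c (\<pi> y)) * y)"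
    if "x \<in> A" "y \<in> A" "\<pi> x \<noteq> \<pi> y" for x y and c :: "'a set \<Rightarrow> int"
    using that piC by (simp add: Q(3,4) of_int_closed Pi_def del: mult_FactGroup one_FactGroup)
  show ?thesis
  proof
    assume le: "p_rank p G \<le> 1"
    show "\<exists>g\<in>A. \<forall>x\<in>A. \<exists>a::int. \<exists>y\<in>A. x = of_int a * g + of_nat p * y"
    proof (cases "\<forall>x\<in>A. \<exists>z\<in>A. x = of_nat p * z")
      case True
      then show ?thesis by (intro bexI[of _ 0]) auto
    next
      case False
      then obtain g where g: "g \<in> A" "\<not> (\<exists>z\<in>A. g = of_nat p * z)" by auto
      have "\<exists>a::int. \<exists>y\<in>A. x = of_int a * g + of_nat p * y" if x: "x \<in> A" for x
      proof (cases "\<pi> x = \<pi> g")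
        case True
        then obtain z where "z \<in> A" "x - g = of_nat p * z" using Q(5)[OF x g(1)] by auto
        then show ?thesis by (intro exI[of _ 1] bexI[of _ z]) (auto simp: algebra_simps)
      next
        case False
        have "\<not> independent_mod p ?Q {\<pi> x, \<pi> g}"
        proof
          assume "independent_mod p ?Q {\<pi> x, \<pi> g}"
          then have "enat (card {\<pi> x, \<pi> g}) \<le> p_rank p G"
            unfolding p_rank_def by (intro SUP_upper) auto
          then have "enat (card {\<pi> x, \<pi> g}) \<le> 1" using le by (rule order_trans)
          then show False using False by (simp add: one_enat_def)
        qed
        then obtain c :: "'a set \<Rightarrow> int" where
          c: "finprod ?Q (\<lambda>X. X [^]\<^bsub>?Q\<^esub> c X) {\<pi> x, \<pi> g} = \<one>\<^bsub>?Q\<^esub>" "\<not> (int p dvd c (\<pi> x) \<and> int p dvd c (\<pi> g))"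
          unfolding independent_mod_def using piC x g(1) by auto
        define a b where "a = c (\<pi> x)" and "b = c (\<pi> g)"
        have ab: "of_int a * x + of_int b * g \<in> A" using x g by (auto intro!: add_closed of_int_closed)
        obtain z where z: "z \<in> A" "of_int a * x + of_int b * g = of_nat p * z"
          using c(1) pi0[OF ab] unfolding two[OF x g(1) False] a_def b_def by blast
        have pi: "prime (int p)" using p by simp
        have "\<not> int p dvd a"
        proof
          assume "int p dvd a"
          then obtain a' where a': "a = int p * a'" by auto
          have "\<not> int p dvd b" using c(2) \<open>int p dvd a\<close> by (simp add: a_def b_def)
          then have "coprime (int p) b" using pi by (simp add: prime_imp_coprime)
          then obtain s t where "s * int p + t * b = 1" using bezout_int[of "int p" b] by auto
          then have st: "(of_int s * of_nat p + of_int t * of_int b :: 'v) = 1"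
            by (metis of_int_1 of_int_add of_int_mult of_int_of_nat_eq)
          have bg: "of_int b * g = of_nat p * (z - of_int a' * x)"
            using z(2) a' by (simp add: algebra_simps)
          have "g = (of_int s * of_nat p + of_int t * of_int b) * g" using st by simp
          also have "\<dots> = of_nat p * (of_int s * g) + of_int t * (of_int b * g)" by (simp add: algebra_simps)
          also have "\<dots> = of_nat p * (of_int s * g + of_int t * (z - of_int a' * x))"
            unfolding bg by (simp add: algebra_simps)
          finally show False
            using g z x by (metis add_closed diff_closed of_int_closed)
        qed
        then have "coprime (int p) a" using pi by (simp add: prime_imp_coprime)
        then obtain s t where "s * int p + t * a = 1" using bezout_int[of "int p" a] by auto
        then have st: "(of_int s * of_nat p + of_int t * of_int a :: 'v) = 1"
          by (metis of_int_1 of_int_add of_int_mult of_int_of_nat_eq)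
        have ax: "of_int a * x = of_nat p * z - of_int b * g" using z(2) by (simp add: algebra_simps)
        have "x = (of_int s * of_nat p + of_int t * of_int a) * x" using st by simp
        also have "\<dots> = of_nat p * (of_int s * x) + of_int t * (of_int a * x)" by (simp add: algebra_simps)
        also have "\<dots> = of_int (- t * b) * g + of_nat p * (of_int s * x + of_int t * z)"
          unfolding ax by (simp add: algebra_simps)
        finally show ?thesis using x z by (blast intro: add_closed of_int_closed)
      qed
      then show ?thesis using g(1) by blast
    qed
  next
    assume "\<exists>g\<in>A. \<forall>x\<in>A. \<exists>a::int. \<exists>y\<in>A. x = of_int a * g + of_nat p * y"
    then obtain g where g: "g \<in> A" "\<And>x. x \<in> A \<Longrightarrow> \<exists>a::int. \<exists>y\<in>A. x = of_int a * g + of_nat p * y"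
      by blast
    have "card S \<le> 1" if S: "independent_mod p ?Q S" for S
    proof (rule ccontr)
      assume "\<not> card S \<le> 1"
      then obtain X Y where XY: "X \<in> S" "Y \<in> S" "X \<noteq> Y"
        using S unfolding independent_mod_def by (metis card_le_Suc0_iff_eq One_nat_def)
      have fin: "finite S" and sub: "S \<subseteq> carrier ?Q" 
        using S by (simp_all only: independent_mod_def)
      have "X \<in> \<pi> ` A" "Y \<in> \<pi> ` A" using XY(1,2) sub unfolding Q(2) by (simp_all only: subset_iff)
      then obtain x y where xy: "x \<in> A" "X = \<pi> x" "y \<in> A" "Y = \<pi> y" by blast
      obtain a u b v where uv: "u \<in> A" "x = of_int a * g + of_nat p * u" "v \<in> A" "y = of_int b * g + of_nat p * v"
        using g(2) xy by meson
      \<comment> \<open>Modulo $p$, $x = a g$ and $y = b g$ satisfy $b x - a y = 0$.\<close>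
      define c :: "'a set \<Rightarrow> int" where "c = (\<lambda>Z. if Z = X then b else if Z = Y then - a else 0)"
      have "finprod ?Q (\<lambda>Z. Z [^]\<^bsub>?Q\<^esub> c Z) S = finprod ?Q (\<lambda>Z. Z [^]\<^bsub>?Q\<^esub> c Z) {X, Y}"
        using fin sub XY by (intro Q.finprod_mono_neutral_cong_right) (auto simp: c_def)
      also have "\<dots> = \<pi> (of_int (c X) * x + of_int (c Y) * y)" using two[of x y c] xy XY by simp
      also have "of_int (c X) * x + of_int (c Y) * y = of_nat p * (of_int b * u - of_int a * v)"
        using XY by (simp add: c_def uv algebra_simps)
      also have "\<pi> (of_nat p * (of_int b * u - of_int a * v)) = \<one>\<^bsub>?Q\<^esub>"
        using pi0 uv by (metis diff_closed of_int_closed of_nat_closed)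
      finally have "\<forall>Z\<in>S. int p dvd c Z" using S unfolding independent_mod_def by blast
      then have "int p dvd c X" "int p dvd c Y" using XY by auto
      then have "int p dvd a" "int p dvd b" using XY by (auto simp: c_def)
      then obtain a' b' where ab: "a = int p * a'" "b = int p * b'" by (auto elim!: dvdE)
      have "x - y = of_nat p * (of_int a' * g + u - (of_int b' * g + v))"
        unfolding uv ab by (simp add: algebra_simps)
      moreover have "of_int a' * g + u - (of_int b' * g + v) \<in> A"
        using g uv by (auto intro!: diff_closed add_closed of_int_closed)
      ultimately have "X = Y" using Q(5)[of x y] xy by blast
      then show False using XY by simp
    qed
    then show "p_rank p G \<le> 1" unfolding p_rank_def by (intro SUP_least) (auto simp: one_enat_def)
  qed
qed

end

definition biadditive_on :: "'v::ab_group_add set \<Rightarrow> ('v \<Rightarrow> 'v \<Rightarrow> 'v) \<Rightarrow> bool" where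
  "biadditive_on A B \<longleftrightarrow> (\<forall>x\<in>A. \<forall>y\<in>A. B x y \<in> A) \<and>
    (\<forall>x\<in>A. \<forall>x'\<in>A. \<forall>y\<in>A. B (x + x') y = B x y + B x' y) \<and>
    (\<forall>x\<in>A. \<forall>y\<in>A. \<forall>y'\<in>A. B x (y + y') = B x y + B x y')"

context additive_model begin

lemma not_nil_groupI:
  assumes B: "biadditive_on A B" and xy: "x \<in> A" "y \<in> A" "B x y \<noteq> 0"
  shows "\<not> nil_group G"
proof -
  define \<psi> where "\<psi> = the_inv_into A \<phi>"
  have inj: "inj_on \<phi> A" using bij by (simp add: bij_betw_def)
  have psi: "\<psi> (\<phi> x) = x" if "x \<in> A" for x using that inj by (simp add: \<psi>_def the_inv_into_f_f)
  have psiA: "\<psi> u \<in> A" "\<phi> (\<psi> u) = u" if u: "u \<in> carrier G" for u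
    using phi_surj[OF u] psi by auto
  have psi_mult: "\<psi> (u \<otimes>\<^bsub>G\<^esub> v) = \<psi> u + \<psi> v" if "u \<in> carrier G" "v \<in> carrier G" for u v
    using that psiA psi add add_closed by metis
  let ?b = "\<lambda>u v. \<phi> (B (\<psi> u) (\<psi> v))"
  have "bimultiplicative G ?b"
    using B psiA unfolding bimultiplicative_def biadditive_on_def by (auto simp: psi_mult add)
  then obtain \<mu> where "\<mu> \<in> multiplications G" and
    mu: "\<forall>x\<in>carrier G. \<forall>y\<in>carrier G. \<exists>u\<in>carrier (tensor_product G G). \<mu> u = ?b x y"
    using multiplication_of_bimultiplicative[OF comm_group] by blast
  moreover obtain u where "u \<in> carrier (tensor_product G G)" "\<mu> u = \<phi> (B x y)"
    using mu phi_closed xy psi by metis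
  moreover have "\<phi> (B x y) \<noteq> \<one>\<^bsub>G\<^esub>" using B xy phi_eq_one unfolding biadditive_on_def by blast
  ultimately show ?thesis unfolding nil_group_def by metis
qed

lemma not_nil_groupD:
  assumes "\<not> nil_group G"
  shows "\<exists>B. biadditive_on A B \<and> (\<exists>x\<in>A. \<exists>y\<in>A. B x y \<noteq> 0)"
proof -
  define \<psi> where "\<psi> = the_inv_into A \<phi>"
  have inj: "inj_on \<phi> A" using bij by (simp add: bij_betw_def)
  have psi: "\<psi> (\<phi> x) = x" if "x \<in> A" for x using that inj by (simp add: \<psi>_def the_inv_into_f_f)
  have psiA: "\<psi> u \<in> A" "\<phi> (\<psi> u) = u" if u: "u \<in> carrier G" for u
    using phi_surj[OF u] psi by auto
  have psi_mult: "\<psi> (u \<otimes>\<^bsub>G\<^esub> v) = \<psi> u + \<psi> v" if "u \<in> carrier G" "v \<in> carrier G" for u v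
    using that psiA psi add add_closed by metis
  obtain \<mu> u where mu: "\<mu> \<in> multiplications G" "u \<in> carrier (tensor_product G G)" "\<mu> u \<noteq> \<one>\<^bsub>G\<^esub>"
    using assms comm_group unfolding nil_group_def by auto
  obtain b where b: "bimultiplicative G b"
    "(\<forall>x\<in>carrier G. \<forall>y\<in>carrier G. b x y = \<one>\<^bsub>G\<^esub>) \<longrightarrow> (\<forall>u\<in>carrier (tensor_product G G). \<mu> u = \<one>\<^bsub>G\<^esub>)"
    using bimultiplicative_of_multiplication[OF comm_group mu(1)] by blast
  obtain x y where xy: "x \<in> carrier G" "y \<in> carrier G" "b x y \<noteq> \<one>\<^bsub>G\<^esub>" using b(2) mu by blast
  let ?B = "\<lambda>x y. \<psi> (b (\<phi> x) (\<phi> y))"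
  have "biadditive_on A ?B"
    using b(1) psiA unfolding bimultiplicative_def biadditive_on_def by (auto simp: psi_mult add)
  moreover have "?B (\<psi> x) (\<psi> y) \<noteq> 0"
    using xy b(1) psiA phi_0 unfolding bimultiplicative_def by metis
  ultimately show ?thesis using psiA xy by (intro exI[of _ ?B]) blast
qed

end

section \<open>Biadditive products on groups that embed in the p-adic integers\<close>

text \<open>A group with $A/pA$ generated by \<open>g\<close> and without non-zero elements of infinite $p$-height, that is, a
  $p$-pure subgroup of the $p$-adic integers, with a non-zero biadditive product on it.\<close>

locale padic_product = Z_submodule A for A :: "'v::{idom, ring_char_0} set" +
  fixes B :: "'v \<Rightarrow> 'v \<Rightarrow> 'v" and p :: nat and g :: 'v
  assumes biadditive: "biadditive_on A B"
    and nonzero: "\<exists>x\<in>A. \<exists>y\<in>A. B x y \<noteq> 0"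
    and prime: "prime p"
    and g: "g \<in> A"
    and cyclic: "x \<in> A \<Longrightarrow> \<exists>a::int. \<exists>y\<in>A. x = of_int a * g + of_nat p * y"
    and separated: "x \<in> A \<Longrightarrow> (\<And>k. \<exists>y\<in>A. x = of_nat p ^ k * y) \<Longrightarrow> x = 0"
begin

lemma B_closed: "x \<in> A \<Longrightarrow> y \<in> A \<Longrightarrow> B x y \<in> A"
  and B_add_left: "x \<in> A \<Longrightarrow> x' \<in> A \<Longrightarrow> y \<in> A \<Longrightarrow> B (x + x') y = B x y + B x' y"
  and B_add_right: "x \<in> A \<Longrightarrow> y \<in> A \<Longrightarrow> y' \<in> A \<Longrightarrow> B x (y + y') = B x y + B x y'"
  using biadditive by (auto simp: biadditive_on_def)

lemma B_0_left: "y \<in> A \<Longrightarrow> B 0 y = 0" and B_0_right: "y \<in> A \<Longrightarrow> B y 0 = 0"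
  using B_add_left[of 0 0 y] B_add_right[of y 0 0] by auto

lemma B_of_nat_left: "x \<in> A \<Longrightarrow> y \<in> A \<Longrightarrow> B (of_nat k * x) y = of_nat k * B x y"
  and B_of_nat_right: "x \<in> A \<Longrightarrow> y \<in> A \<Longrightarrow> B x (of_nat k * y) = of_nat k * B x y"
  by (induction k) (auto simp: B_0_left B_0_right B_add_left B_add_right of_nat_closed distrib_right)

lemma B_minus_left: "x \<in> A \<Longrightarrow> y \<in> A \<Longrightarrow> B (- x) y = - B x y"
  and B_minus_right: "x \<in> A \<Longrightarrow> y \<in> A \<Longrightarrow> B x (- y) = - B x y"
  using B_add_left[of "- x" x y] B_add_right[of x "- y" y]
  by (auto simp: minus_closed B_0_left B_0_right eq_neg_iff_add_eq_0)

lemma B_of_int_left: "x \<in> A \<Longrightarrow> y \<in> A \<Longrightarrow> B (of_int k * x) y = of_int k * B x y"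
  and B_of_int_right: "x \<in> A \<Longrightarrow> y \<in> A \<Longrightarrow> B x (of_int k * y) = of_int k * B x y"
  by (cases k rule: int_cases2;
      simp add: B_of_nat_left B_of_nat_right B_minus_left B_minus_right of_nat_closed)+

definition pcong :: "nat \<Rightarrow> 'v \<Rightarrow> 'v \<Rightarrow> bool" where
  "pcong k x y \<longleftrightarrow> (\<exists>z\<in>A. x - y = of_nat p ^ k * z)"

lemma ppow_closed: "z \<in> A \<Longrightarrow> of_nat p ^ k * z \<in> A"
  using of_nat_closed[of z "p ^ k"] by simp

lemma pcong_refl [simp]: "pcong k x x"
  unfolding pcong_def by (rule bexI[of _ 0]) auto

lemma pcongI: "z \<in> A \<Longrightarrow> x - y = of_nat p ^ k * z \<Longrightarrow> pcong k x y"
  unfolding pcong_def by blast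

lemma pcongE: assumes "pcong k x y" obtains z where "z \<in> A" "x - y = of_nat p ^ k * z"
  using assms unfolding pcong_def by blast

lemma pcong_sym: assumes "pcong k x y" shows "pcong k y x"
proof -
  obtain z where z: "z \<in> A" "x - y = of_nat p ^ k * z" using assms by (rule pcongE)
  have "y - x = - (x - y)" by simp
  also have "\<dots> = of_nat p ^ k * (- z)" unfolding z(2) by simp
  finally show ?thesis using z minus_closed pcongI by blast
qed

lemma pcong_add: assumes "pcong k x y" "pcong k x' y'" shows "pcong k (x + x') (y + y')"
proof -
  obtain z where z: "z \<in> A" "x - y = of_nat p ^ k * z" using assms(1) by (rule pcongE)
  obtain w where w: "w \<in> A" "x' - y' = of_nat p ^ k * w" using assms(2) by (rule pcongE)
  have "x + x' - (y + y') = (x - y) + (x' - y')" by simp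
  also have "\<dots> = of_nat p ^ k * (z + w)" unfolding z w by (simp add: distrib_left)
  finally show ?thesis using z w add_closed pcongI by blast
qed

lemma pcong_trans: assumes "pcong k x y" "pcong k y z" shows "pcong k x z"
  using pcong_add[OF assms] unfolding pcong_def by simp

lemma pcong_of_int: assumes "pcong k x y" shows "pcong k (of_int c * x) (of_int c * y)"
proof -
  obtain z where z: "z \<in> A" "x - y = of_nat p ^ k * z" using assms by (rule pcongE)
  have "of_int c * x - of_int c * y = of_int c * (x - y)" by (simp add: right_diff_distrib)
  also have "\<dots> = of_nat p ^ k * (of_int c * z)" unfolding z by (simp add: mult.left_commute)
  finally show ?thesis using z of_int_closed pcongI by blast
qed

lemma pcong_sum: "(\<And>i. i \<in> I \<Longrightarrow> pcong k (f i) (h i)) \<Longrightarrow> pcong k (sum f I) (sum h I)"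
  by (induction I rule: infinite_finite_induct) (auto simp: pcong_add)

lemma pcong_weaken: assumes "pcong k x y" "j \<le> k" shows "pcong j x y"
proof -
  obtain z where z: "z \<in> A" "x - y = of_nat p ^ k * z" using assms unfolding pcong_def by blast
  then have "x - y = of_nat p ^ j * (of_nat p ^ (k - j) * z)"
    using assms(2) by (simp flip: mult.assoc power_add)
  then show ?thesis unfolding pcong_def using ppow_closed z by blast
qed

lemma
  assumes "x \<in> A" "y \<in> A" "z \<in> A" "pcong k x y"
  shows pcong_B_left: "pcong k (B x z) (B y z)" and pcong_B_right: "pcong k (B z x) (B z y)"
proof -
  obtain w where w: "w \<in> A" "x - y = of_nat p ^ k * w" using assms unfolding pcong_def by blast
  then have x: "x = y + of_nat (p ^ k) * w" by (simp add: algebra_simps)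
  have "B x z - B y z = of_nat p ^ k * B w z"
    unfolding x using w assms by (simp only: B_add_left B_of_nat_left of_nat_closed) simp
  then show "pcong k (B x z) (B y z)" unfolding pcong_def using w assms B_closed by blast
  have "B z x - B z y = of_nat p ^ k * B z w"
    unfolding x using w assms by (simp only: B_add_right B_of_nat_right of_nat_closed) simp
  then show "pcong k (B z x) (B z y)" unfolding pcong_def using w assms B_closed by blast
qed

lemma pcong_all_eq: "x \<in> A \<Longrightarrow> y \<in> A \<Longrightarrow> (\<And>k. pcong k x y) \<Longrightarrow> x = y"
  using separated[of "x - y"] diff_closed unfolding pcong_def by simp

lemma cyclic_power: "x \<in> A \<Longrightarrow> \<exists>a::int. pcong k x (of_int a * g)"
proof (induction k)
  case 0 then show ?case using g unfolding pcong_def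
    by (intro exI[of _ 0] bexI[of _ x]) auto
next
  case (Suc k)
  then obtain a z where a: "z \<in> A" "x - of_int a * g = of_nat p ^ k * z" unfolding pcong_def by blast
  obtain b y where b: "y \<in> A" "z = of_int b * g + of_nat p * y" using cyclic[OF a(1)] by blast
  have "x - of_int (a + int p ^ k * b) * g = of_nat p ^ Suc k * y"
    using a b by (simp add: algebra_simps)
  then show ?case unfolding pcong_def using b by blast
qed

text \<open>If $g \in pA$ then $A = pA$, and every element of $A$ has infinite $p$-height.\<close>

lemma g_not_divisible: "y \<in> A \<Longrightarrow> g \<noteq> of_nat p * y"
proof
  assume y: "y \<in> A" "g = of_nat p * y"
  have d: "\<exists>z\<in>A. x = of_nat p * z" if "x \<in> A" for x
  proof -
    obtain a u where "u \<in> A" "x = of_int a * g + of_nat p * u" using cyclic \<open>x \<in> A\<close> by blast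
    then have "x = of_nat p * (of_int a * y + u)" using y by (simp add: algebra_simps)
    then show ?thesis using y \<open>u \<in> A\<close> by (blast intro: add_closed of_int_closed)
  qed
  have "\<exists>z\<in>A. x = of_nat p ^ k * z" if "x \<in> A" for x k
  proof (induction k)
    case (Suc k)
    then obtain z where "z \<in> A" "x = of_nat p ^ k * z" by blast
    moreover then obtain w where "w \<in> A" "z = of_nat p * w" using d by blast
    ultimately show ?case by (intro bexI[of _ w]) (auto simp: algebra_simps)
  qed (use that in auto)
  then have "x = 0" if "x \<in> A" for x using that separated by blast
  then show False using nonzero B_closed by blast
qed

text \<open>The generator has order exactly $p^k$ modulo $p^kA$. Hence congruences between multiples of \<open>g\<close> are congruences
  between integers.\<close>

lemma dvd_of_pcong_0: "pcong k (of_int c * g) 0 \<Longrightarrow> int p ^ k dvd c"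
proof (induction k)
  case (Suc k)
  then obtain z where z: "z \<in> A" "of_int c * g = of_nat p ^ Suc k * z" unfolding pcong_def by auto
  have "int p ^ k dvd c" using Suc pcong_weaken[of "Suc k" _ _ k] by simp
  then obtain d where d: "c = int p ^ k * d" by auto
  have p0: "(of_nat p :: 'v) \<noteq> 0" using prime prime_gt_0_nat[of p] by simp
  have dg: "of_int d * g = of_nat p * z"
  proof -
    have "of_nat p ^ k * (of_int d * g) = of_nat p ^ k * (of_nat p * z)"
      using z d by (simp add: mult.assoc power_commutes mult.left_commute)
    then show ?thesis using p0 by simp
  qed
  have "int p dvd d"
  proof (rule ccontr)
    assume "\<not> int p dvd d"
    then have "coprime (int p) d" using prime by (simp add: prime_imp_coprime)
    then obtain s t where "s * int p + t * d = 1" using bezout_int[of "int p" d] by auto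
    then have "(of_int s * of_nat p + of_int t * of_int d :: 'v) = 1"
      by (metis of_int_1 of_int_add of_int_mult of_int_of_nat_eq)
    then have "g = (of_int s * of_nat p + of_int t * of_int d) * g" by simp
    also have "\<dots> = of_nat p * (of_int s * g) + of_int t * (of_int d * g)" by (simp add: algebra_simps)
    also have "\<dots> = of_nat p * (of_int s * g + of_int t * z)" unfolding dg by (simp add: algebra_simps)
    finally show False using g_not_divisible z g by (metis add_closed of_int_closed)
  qed
  then show ?case using d by auto
qed simp

text \<open>If $x \equiv a g$ and $gg \equiv b g$ modulo $p^k$, then $xz \equiv ab\,z$ for all $z$. As \<open>k\<close> varies,
  these integers approximate the $p$-adic number $c_p x$, where $c_p$ is the constant that describes the
  product inside the $p$-adic integers.\<close>

lemma scalar_mod: assumes x: "x \<in> A"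
  shows "\<exists>m::int. \<forall>z\<in>A. pcong k (B x z) (of_int m * z)"
proof -
  obtain a b :: int where a: "pcong k x (of_int a * g)" and b: "pcong k (B g g) (of_int b * g)"
    using cyclic_power x B_closed g by meson
  have "pcong k (B x z) (of_int (a * b) * z)" if z: "z \<in> A" for z
  proof -
    obtain c :: int where c: "pcong k z (of_int c * g)" using cyclic_power z by blast
    have "pcong k (B x z) (B (of_int a * g) z)" using pcong_B_left a x z g of_int_closed by blast
    also have "B (of_int a * g) z = of_int a * B g z" using B_of_int_left g z by simp
    finally have 1: "pcong k (B x z) (of_int a * B g z)" .
    have "pcong k (B g z) (B g (of_int c * g))" using pcong_B_right c g z of_int_closed by blast
    also have "B g (of_int c * g) = of_int c * B g g" using B_of_int_right g by simp
    finally have 2: "pcong k (B g z) (of_int c * B g g)" .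
    have "pcong k (B x z) (of_int a * (of_int c * (of_int b * g)))"
      using 1 2 b by (meson pcong_trans pcong_of_int)
    also have "of_int a * (of_int c * (of_int b * g)) = of_int (a * b) * (of_int c * g)" by simp
    finally show ?thesis using pcong_of_int[OF pcong_sym[OF c], of "a * b"] pcong_trans by blast
  qed
  then show ?thesis by blast
qed

lemma product_mod:
  assumes x: "x \<in> A" and y: "y \<in> A" and a: "pcong k x (of_int a * g)" and b: "pcong k y (of_int b * g)"
  shows "pcong k (B x y) (of_int (a * b) * B g g)"
proof -
  have "pcong k (B x y) (B (of_int a * g) y)" using pcong_B_left a x y g of_int_closed by blast
  moreover have "pcong k (B (of_int a * g) y) (B (of_int a * g) (of_int b * g))"
    using pcong_B_right b y g of_int_closed by blast
  moreover have "B (of_int a * g) (of_int b * g) = of_int (a * b) * B g g"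
    using g by (simp add: B_of_int_left B_of_int_right of_int_closed)
  ultimately show ?thesis using pcong_trans by metis
qed

lemma B_commute: assumes x: "x \<in> A" and y: "y \<in> A" shows "B x y = B y x"
proof (rule pcong_all_eq)
  fix k
  obtain a b :: int where "pcong k x (of_int a * g)" "pcong k y (of_int b * g)"
    using cyclic_power x y by meson
  then have "pcong k (B x y) (of_int (a * b) * B g g)" "pcong k (B y x) (of_int (b * a) * B g g)"
    using product_mod x y by auto
  then show "pcong k (B x y) (B y x)" using pcong_trans pcong_sym by (metis mult.commute)
qed (use x y B_closed in auto)

text \<open>Multiplication by \<open>x\<close> is multiplication by an integer modulo each $p^k$, and multiplication by an integer commutes with
  \<open>B\<close> in its first argument.\<close>

lemma B_assoc: assumes x: "x \<in> A" and y: "y \<in> A" and z: "z \<in> A" shows "B (B x y) z = B x (B y z)"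
proof (rule pcong_all_eq)
  fix k
  obtain m :: int where m: "\<And>z. z \<in> A \<Longrightarrow> pcong k (B x z) (of_int m * z)"
    using scalar_mod[OF x] by blast
  have "pcong k (B (B x y) z) (B (of_int m * y) z)"
    by (rule pcong_B_left[OF B_closed[OF x y] of_int_closed[OF y] z m[OF y]])
  also have "B (of_int m * y) z = of_int m * B y z" by (rule B_of_int_left[OF y z])
  finally show "pcong k (B (B x y) z) (B x (B y z))"
    by (rule pcong_trans[OF _ pcong_sym[OF m[OF B_closed[OF y z]]]])
qed (use x y z B_closed in auto)

lemma primitive_part:
  assumes x: "x \<in> A" "x \<noteq> 0"
  shows "\<exists>i. \<exists>y\<in>A. x = of_nat p ^ i * y \<and> (\<forall>z\<in>A. y \<noteq> of_nat p * z)"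
proof -
  obtain k where k: "\<not> (\<exists>y\<in>A. x = of_nat p ^ k * y)" using separated x by blast
  define i where "i = (LEAST k. \<not> (\<exists>y\<in>A. x = of_nat p ^ k * y))"
  have i: "\<not> (\<exists>y\<in>A. x = of_nat p ^ i * y)" unfolding i_def by (rule LeastI) (rule k)
  have "i \<noteq> 0" using i x by (metis mult_1 power_0)
  then obtain j where j: "i = Suc j" using not0_implies_Suc by blast
  have "\<exists>y\<in>A. x = of_nat p ^ j * y" using not_less_Least[of j "\<lambda>k. \<not> (\<exists>y\<in>A. x = of_nat p ^ k * y)"] j
    unfolding i_def[symmetric] by auto
  then obtain y where y: "y \<in> A" "x = of_nat p ^ j * y" by blast
  moreover have "y \<noteq> of_nat p * z" if "z \<in> A" for z
    using i j y that by (metis mult.assoc power_Suc2)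
  ultimately show ?thesis by blast
qed

text \<open>After division by powers of $p$ both factors are prime to $p$, so $xy = 0$ forces $gg \in p^k A$ for all
  $k$. Then $gg = 0$, and the whole product vanishes.\<close>

lemma B_no_zero_divisors:
  assumes x: "x \<in> A" "x \<noteq> 0" and y: "y \<in> A" "y \<noteq> 0" shows "B x y \<noteq> 0"
proof
  assume xy: "B x y = 0"
  obtain i u where u: "u \<in> A" "x = of_nat p ^ i * u" "\<forall>z\<in>A. u \<noteq> of_nat p * z"
    using primitive_part x by blast
  obtain j v where v: "v \<in> A" "y = of_nat p ^ j * v" "\<forall>z\<in>A. v \<noteq> of_nat p * z"
    using primitive_part y by blast
  have "B x y = of_nat (p ^ i) * (of_nat (p ^ j) * B u v)"
    using u v by (simp add: B_of_nat_left B_of_nat_right of_nat_closed flip: of_nat_power)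
  then have uv: "B u v = 0" using xy prime prime_gt_0_nat[of p] by auto
  have gg: "B g g = 0"
  proof (rule pcong_all_eq)
    fix k
    \<comment> \<open>The congruences are taken modulo $p^{k+1}$: for $k = 0$ a congruence modulo $p^k$ would not show
      that $a$ is prime to $p$.\<close>
    have nd: "coprime (int p ^ k) a" if w: "w \<in> A" "\<forall>z\<in>A. w \<noteq> of_nat p * z" and a: "pcong (Suc k) w (of_int a * g)" for w and a :: int
    proof -
      have "\<not> int p dvd a"
      proof
        assume "int p dvd a"
        then obtain c where c: "a = int p * c" by auto
        obtain z where z: "z \<in> A" "w - of_int a * g = of_nat p ^ Suc k * z" using a unfolding pcong_def by blast
        then have "w = of_nat p * (of_int c * g + of_nat p ^ k * z)" using c by (simp add: algebra_simps)
        then show False using w z g by (metis add_closed of_int_closed ppow_closed)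
      qed
      then show ?thesis using prime by (simp add: prime_imp_coprime)
    qed
    obtain a b :: int where ab: "pcong (Suc k) u (of_int a * g)" "pcong (Suc k) v (of_int b * g)"
      using cyclic_power u v by meson
    have "coprime (int p ^ k) (a * b)" using nd[of u a] nd[of v b] u v ab by simp
    then obtain s t where "s * int p ^ k + t * (a * b) = 1" using bezout_int[of "int p ^ k" "a * b"] by auto
    then have "of_int (s * int p ^ k + t * (a * b)) * B g g = B g g" by simp
    then have st: "B g g = of_nat p ^ k * (of_int s * B g g) + of_int t * (of_int (a * b) * B g g)"
      by (simp add: algebra_simps)
    have "pcong k 0 (of_int (a * b) * B g g)"
      using product_mod[of u v k a b] uv u v ab pcong_weaken[of "Suc k" _ _ k] by auto
    then have "pcong k (of_int t * (of_int (a * b) * B g g)) (of_int t * 0)"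
      using pcong_of_int pcong_sym by blast
    moreover have "pcong k (of_nat p ^ k * (of_int s * B g g)) 0"
      unfolding pcong_def using B_closed g of_int_closed by auto
    ultimately show "pcong k (B g g) 0" using pcong_add st by fastforce
  qed (use g B_closed in auto)
  have "B x' y' = 0" if xy': "x' \<in> A" "y' \<in> A" for x' y'
  proof (rule pcong_all_eq)
    fix k
    obtain a b :: int where "pcong k x' (of_int a * g)" "pcong k y' (of_int b * g)"
      using cyclic_power xy' by meson
    then show "pcong k (B x' y') 0" using product_mod[of x' y' k a b] xy' gg by simp
  qed (use xy' B_closed in auto)
  then show False using nonzero by blast
qed

lemma iterate_closed: "a \<in> A \<Longrightarrow> x \<in> A \<Longrightarrow> (B a ^^ i) x \<in> A"
  by (induction i) (auto simp: B_closed)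

text \<open>If $f(a) = 0$ and \<open>a\<close> acts on \<open>A\<close> as the integer $s_k$ modulo $p^k$, then $f(s_k)$ kills the
  generator \<open>g\<close> modulo $p^k$. So the $s_k$ converge to a root of $f$. Here $f(a)$ is understood
  as an operator, because \<open>A\<close> need not contain a unit element for \<open>B\<close>.\<close>

lemma padic_root_of_annihilator:
  assumes a: "a \<in> A"
    and f: "\<And>x. x \<in> A \<Longrightarrow> (\<Sum>i\<le>degree f. of_int (coeff f i) * (B a ^^ i) x) = 0"
  shows "\<exists>s::nat \<Rightarrow> int. \<forall>k. int p ^ k dvd poly f (s k) \<and> int p ^ k dvd s (Suc k) - s k"
proof -
  obtain s :: "nat \<Rightarrow> int" where s: "\<And>k z. z \<in> A \<Longrightarrow> pcong k (B a z) (of_int (s k) * z)"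
    using scalar_mod[OF a] by metis
  have pw: "pcong k ((B a ^^ i) g) (of_int (s k ^ i) * g)" for k i
  proof (induction i)
    case (Suc i)
    have "pcong k ((B a ^^ Suc i) g) (of_int (s k) * (B a ^^ i) g)"
      using s iterate_closed a g by simp
    then show ?case using pcong_of_int[OF Suc, of "s k"] pcong_trans
      by (metis mult.assoc of_int_mult power_Suc)
  qed simp
  have "int p ^ k dvd poly f (s k)" for k
  proof (rule dvd_of_pcong_0)
    have "pcong k (\<Sum>i\<le>degree f. of_int (coeff f i) * (B a ^^ i) g) (\<Sum>i\<le>degree f. of_int (coeff f i) * (of_int (s k ^ i) * g))"
      by (intro pcong_sum pcong_of_int pw)
    moreover have "(\<Sum>i\<le>degree f. of_int (coeff f i) * (of_int (s k ^ i) * g)) = of_int (poly f (s k)) * g"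
      by (simp add: poly_altdef sum_distrib_right mult.assoc)
    ultimately show "pcong k (of_int (poly f (s k)) * g) 0" using f[OF g] pcong_sym by simp
  qed
  moreover have "int p ^ k dvd s (Suc k) - s k" for k
  proof (rule dvd_of_pcong_0)
    have "pcong k (of_int (s (Suc k)) * g) (of_int (s k) * g)"
      using s[OF g] pcong_weaken[of "Suc k" _ _ k] by (meson le_SucI order_refl pcong_sym pcong_trans)
    then show "pcong k (of_int (s (Suc k) - s k) * g) 0"
      unfolding pcong_def by (simp add: algebra_simps)
  qed
  ultimately show ?thesis by blast
qed

end

section \<open>Integral polynomials\<close>

lemma common_denominator:
  fixes c :: "'b \<Rightarrow> rat"
  assumes "finite S" shows "\<exists>k d. k > 0 \<and> (\<forall>x\<in>S. of_int (d x) = of_int k * c x)"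
  using assms
proof (induction S rule: finite_induct)
  case empty show ?case by (intro exI[of _ 1]) auto
next
  case (insert x S)
  then obtain k d where k: "k > 0" "\<forall>x\<in>S. of_int (d x) = of_int k * c x" by blast
  obtain a b where ab: "quotient_of (c x) = (a, b)" by fastforce
  then have b: "b > 0" "c x = of_int a / of_int b" using quotient_of_denom_pos quotient_of_div by auto
  show ?case
    by (intro exI[of _ "k * b"] exI[of _ "\<lambda>y. if y = x then k * a else b * d y"])
      (use k b in \<open>auto simp: mult.commute mult.left_commute\<close>)
qed

lemma clear_denominators: "\<exists>k F. k > 0 \<and> map_poly rat_of_int F = smult (of_int k) g"
proof (induction g)
  case 0 show ?case by (intro exI[of _ 1] exI[of _ 0]) simp
next
  case (pCons c g)
  then obtain k F where F: "k > 0" "map_poly rat_of_int F = smult (of_int k) g" by blast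
  obtain a b where ab: "quotient_of c = (a, b)" by fastforce
  then have b: "b > 0" "c = of_int a / of_int b" using quotient_of_denom_pos quotient_of_div by auto
  have "map_poly rat_of_int (pCons (k * a) (smult b F)) = pCons (of_int (k * a)) (smult (of_int b) (map_poly rat_of_int F))"
    by (simp add: map_poly_pCons map_poly_smult)
  also have "\<dots> = smult (of_int (k * b)) (pCons c g)" unfolding F using b by (simp add: mult.commute)
  finally show ?case using F b by (intro exI[of _ "k * b"] exI[of _ "pCons (k * a) (smult b F)"]) simp
qed

lemma smult_sum_right: "smult k (sum f I) = (\<Sum>i\<in>I. smult k (f i))"
  by (induction I rule: infinite_finite_induct) (simp_all add: smult_add_right)

lemma degree_map_of_int [simp]: "degree (map_poly rat_of_int F) = degree F"
  by (rule degree_map_poly) simp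

lemma map_of_int_eq_0_iff [simp]: "map_poly rat_of_int F = 0 \<longleftrightarrow> F = 0"
  by (rule map_poly_eq_0_iff) auto

lemma map_of_int_mult: "map_poly rat_of_int (F * G) = map_poly rat_of_int F * map_poly rat_of_int G"
  by (rule map_poly_hom_mult) simp_all

text \<open>The primitive integral multiple of the minimal polynomial. In a factorisation one factor vanishes at
  \<open>y\<close> and has full degree by minimality; the other one is then a constant dividing the content.\<close>

lemma irreducible_int_poly_of_min_poly:
  assumes m: "min_poly_of m y"
  shows "\<exists>f::int poly. irreducible f \<and> degree f = degree m \<and> evq (map_poly of_int f) y = 0"
proof -
  obtain k F where F: "k > 0" "map_poly rat_of_int F = smult (of_int k) m" using clear_denominators by blast
  have F0: "F \<noteq> 0" "degree F = degree m"
    using F m degree_map_of_int[of F] unfolding min_poly_of_def by (auto simp flip: map_of_int_eq_0_iff)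
  define f where "f = primitive_part F"
  have f: "F = smult (content F) f" "content f = 1" "f \<noteq> 0" "degree f = degree m"
    using F0 by (auto simp: f_def)
  have "evq (map_poly of_int F) y = of_rat (of_int (content F)) * evq (map_poly of_int f) y"
    by (subst f(1)) (simp add: map_poly_smult)
  moreover have "evq (map_poly of_int F) y = 0" unfolding F using m by (simp add: min_poly_of_def)
  ultimately have fy: "evq (map_poly of_int f) y = 0" using F0 by simp
  have unit: "is_unit h" if gh: "f = g * h" and g: "evq (map_poly of_int g) y = 0" for g h
  proof -
    have nz: "g \<noteq> 0" "h \<noteq> 0" using gh f(3) by auto
    have "degree m \<le> degree g" using m g nz unfolding min_poly_of_def by (metis degree_map_of_int map_of_int_eq_0_iff)
    then have "degree h = 0" using gh nz f(4) degree_mult_eq[of g h] by simp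
    then obtain c where c: "h = [:c:]" by (rule degree_eq_zeroE)
    then have "[:c:] dvd f" using gh by (metis dvd_triv_right)
    then have "c dvd 1" using f(2) by (simp add: const_poly_dvd_iff_dvd_content)
    then show ?thesis using c by (simp add: is_unit_const_poly_iff)
  qed
  have "irreducible f"
  proof (rule irreducibleI)
    show "\<not> is_unit f" using f(4) min_poly_degree_pos[OF m] by (auto simp: is_unit_poly_iff)
    fix g h assume gh: "f = g * h"
    then have "evq (map_poly of_int g) y = 0 \<or> evq (map_poly of_int h) y = 0"
      using fy by (simp add: map_of_int_mult)
    then show "is_unit g \<or> is_unit h" using unit[of g h] unit[of h g] gh by (auto simp: mult.commute)
  qed (rule f(3))
  then show ?thesis using f fy by blast
qed

section \<open>Embedding a commutative product in the complex numbers\<close>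

text \<open>Evaluation with a sequence in place of the powers of a number. With $\varphi_i = h(a^i x)$ it
  describes the action of the polynomial in multiplication by $a$ on the functional $h$.\<close>

definition formal_eval :: "'k::comm_ring_1 poly \<Rightarrow> (nat \<Rightarrow> 'k) \<Rightarrow> 'k" where
  "formal_eval G \<phi> = (\<Sum>i\<le>degree G. coeff G i * \<phi> i)"

lemma formal_eval_0 [simp]: "formal_eval 0 \<phi> = 0"
  by (simp add: formal_eval_def)

lemma formal_eval_pCons: "formal_eval (pCons c G) \<phi> = c * \<phi> 0 + formal_eval G (\<lambda>i. \<phi> (Suc i))"
proof (cases "G = 0")
  case False
  then show ?thesis unfolding formal_eval_def by (simp add: sum.atMost_Suc_shift del: sum.atMost_Suc)
qed (simp add: formal_eval_def)

lemma formal_eval_diff: "formal_eval G (\<lambda>i. \<phi> i - \<psi> i) = formal_eval G \<phi> - formal_eval G \<psi>"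
  by (simp add: formal_eval_def right_diff_distrib sum_subtractf)

lemma formal_eval_cmult: "formal_eval G (\<lambda>i. c * \<phi> i) = c * formal_eval G \<phi>"
  by (simp add: formal_eval_def sum_distrib_left mult.left_commute)

lemma formal_eval_add: "formal_eval (G + H) \<phi> = formal_eval G \<phi> + formal_eval H \<phi>"
proof (induction G arbitrary: H \<phi>)
  case (pCons c G)
  show ?case
  proof (cases H)
    case (pCons d H')
    then show ?thesis using pCons.IH[of H' "\<lambda>i. \<phi> (Suc i)"] \<open>H = _\<close> by (simp add: formal_eval_pCons algebra_simps)
  qed
qed simp

lemma formal_eval_linear_factor: "formal_eval ([:- r, 1:] * Q) \<phi> = formal_eval Q (\<lambda>i. \<phi> (Suc i) - r * \<phi> i)"
proof -
  have "[:- r, 1:] * Q = pCons 0 Q + smult (- r) Q" by simp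
  moreover have "formal_eval (smult (- r) Q) \<phi> = - r * formal_eval Q \<phi>"
    by (induction Q arbitrary: \<phi>) (simp_all add: formal_eval_pCons algebra_simps)
  ultimately show ?thesis by (simp only: formal_eval_add) (simp add: formal_eval_pCons formal_eval_diff formal_eval_cmult)
qed

text \<open>Coordinate vectors of length \<open>n\<close> are rational polynomials of degree less than \<open>n\<close>; the group
  contains the standard basis.\<close>

locale finite_rank_product = padic_product A B p g
  for A :: "rat poly set" and B p g +
  fixes n :: nat
  assumes n_pos: "n > 0"
    and basis: "i < n \<Longrightarrow> monom 1 i \<in> A"
    and bounded: "x \<in> A \<Longrightarrow> n \<le> i \<Longrightarrow> coeff x i = 0"
begin

lemma integral_multiple: assumes "x \<in> A"
  shows "\<exists>k c. k > 0 \<and> of_int k * x = (\<Sum>i<n. of_int (c i) * monom 1 i)"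
proof -
  obtain k F where F: "k > 0" "map_poly rat_of_int F = smult (of_int k) x" using clear_denominators by blast
  have "of_int k * x = map_poly rat_of_int F" using F by (simp add: of_int_poly)
  also have "\<dots> = (\<Sum>i<n. of_int (coeff F i) * monom 1 i)"
  proof (rule poly_eqI)
    fix j
    have "rat_of_int (coeff F j) = 0" if "\<not> j < n"
      using that bounded[OF assms, of j] F(2) coeff_map_poly[of rat_of_int F j] by simp
    then show "coeff (map_poly rat_of_int F) j = coeff (\<Sum>i<n. of_int (coeff F i) * monom 1 i) j"
      by (simp add: coeff_sum coeff_map_poly of_int_poly smult_monom)
  qed
  finally show ?thesis using F(1) by (intro exI[of _ k] exI[of _ "coeff F"]) simp
qed

definition additive_functional :: "(rat poly \<Rightarrow> complex) \<Rightarrow> bool" where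
  "additive_functional h \<longleftrightarrow> (\<forall>x\<in>A. \<forall>y\<in>A. h (x + y) = h x + h y)"

lemma functional_add: "additive_functional h \<Longrightarrow> x \<in> A \<Longrightarrow> y \<in> A \<Longrightarrow> h (x + y) = h x + h y"
  by (simp add: additive_functional_def)

lemma functional_0: "additive_functional h \<Longrightarrow> h 0 = 0"
  using functional_add[of h 0 0] by simp

lemma functional_minus: "additive_functional h \<Longrightarrow> x \<in> A \<Longrightarrow> h (- x) = - h x"
  using functional_add[of h x "- x"] functional_0[of h] minus_closed by (simp add: minus_unique)

lemma functional_of_nat: "additive_functional h \<Longrightarrow> x \<in> A \<Longrightarrow> h (of_nat k * x) = of_nat k * h x"
  by (induction k) (auto simp: functional_0 functional_add of_nat_closed distrib_right)

lemma functional_of_int: "additive_functional h \<Longrightarrow> x \<in> A \<Longrightarrow> h (of_int k * x) = of_int k * h x"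
  by (cases k rule: int_cases2) (simp_all add: functional_of_nat functional_minus of_nat_closed)

lemma functional_sum: "additive_functional h \<Longrightarrow> (\<And>i. i \<in> I \<Longrightarrow> f i \<in> A) \<Longrightarrow> h (sum f I) = (\<Sum>i\<in>I. h (f i))"
  by (induction I rule: infinite_finite_induct) (auto simp: functional_0 functional_add sum_closed)

lemma B_sum_left: "(\<And>i. i \<in> I \<Longrightarrow> f i \<in> A) \<Longrightarrow> x \<in> A \<Longrightarrow> B (sum f I) x = (\<Sum>i\<in>I. B (f i) x)"
  by (induction I rule: infinite_finite_induct) (auto simp: B_0_left B_add_left sum_closed)

lemma B_sum_right: "(\<And>i. i \<in> I \<Longrightarrow> f i \<in> A) \<Longrightarrow> x \<in> A \<Longrightarrow> B x (sum f I) = (\<Sum>i\<in>I. B x (f i))"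
  by (induction I rule: infinite_finite_induct) (auto simp: B_0_right B_add_right sum_closed)

definition annihilates :: "int poly \<Rightarrow> rat poly \<Rightarrow> bool" where
  "annihilates f a \<longleftrightarrow> (\<forall>x\<in>A. (\<Sum>i\<le>degree f. of_int (coeff f i) * (B a ^^ i) x) = 0)"

lemma B_funpow_commute: "a \<in> A \<Longrightarrow> b \<in> A \<Longrightarrow> x \<in> A \<Longrightarrow> B b ((B a ^^ i) x) = (B a ^^ i) (B b x)"
proof (induction i)
  case (Suc i)
  then have "B b (B a ((B a ^^ i) x)) = B a (B b ((B a ^^ i) x))"
    by (metis B_assoc B_commute iterate_closed)
  then show ?case using Suc by simp
qed simp

text \<open>The elements $a, a^2, \ldots, a^{n+1}$ are dependent. In a relation of least degree the first coefficient does not vanish, since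
  otherwise a factor $a$ could be cancelled. Multiplying the relation by \<open>x\<close> and cancelling $a$ gives the operator identity.\<close>

lemma annihilator_exists:
  assumes a: "a \<in> A" "a \<noteq> 0"
  shows "\<exists>f. coeff f 0 \<noteq> 0 \<and> annihilates f a"
proof -
  let ?P = "\<lambda>f::int poly. f \<noteq> 0 \<and> (\<Sum>i\<le>degree f. of_int (coeff f i) * (B a ^^ i) a) = 0"
  have mem: "(B a ^^ i) x \<in> A" if "x \<in> A" for i x using iterate_closed a that by blast
  have "\<exists>f. ?P f"
  proof -
    have "x \<in> qp.span (monom 1 ` {..<n})" if x: "x \<in> A" for x
    proof -
      have "x = (\<Sum>i<n. smult (of_rat (coeff x i)) (monom 1 i))"
        by (rule poly_eqI) (use bounded[OF x] in \<open>auto simp: coeff_sum smult_monom\<close>)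
      also have "\<dots> \<in> qp.span (monom 1 ` {..<n})"
        by (intro qp.span_sum qp.span_scale qp.span_base) auto
      finally show ?thesis .
    qed
    moreover have "card (monom (1::rat) ` {..<n}) < card {..n}"
      using card_image_le[of "{..<n}" "monom (1::rat)"] by simp
    ultimately obtain c where c: "\<exists>i\<in>{..n}. c i \<noteq> 0" "(\<Sum>i\<le>n. smult (of_rat (c i)) ((B a ^^ i) a)) = 0"
      using qp.family_dependent[of "{..n}" "monom (1::rat) ` {..<n}" "\<lambda>i. (B a ^^ i) a"] mem[OF a(1)] by blast
    obtain k d where k: "k > 0" "\<forall>i\<in>{..n}. rat_of_int (d i) = of_int k * c i"
      using common_denominator[of "{..n}" c] by auto
    define F where "F = (\<Sum>i\<le>n. monom (d i) i)"
    have cF: "coeff F i = (if i \<le> n then d i else 0)" for i by (simp add: F_def coeff_sum)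
    have "F \<noteq> 0"
    proof
      assume "F = 0"
      then have "d i = 0" if "i \<le> n" for i using cF[of i] that by simp
      then show False using c(1) k by fastforce
    qed
    have dF: "degree F \<le> n" by (rule degree_le) (simp add: cF)
    have "(\<Sum>i\<le>degree F. of_int (coeff F i) * (B a ^^ i) a) = (\<Sum>i\<le>n. of_int (coeff F i) * (B a ^^ i) a)"
      by (rule sum.mono_neutral_left) (use dF in \<open>auto simp: coeff_eq_0\<close>)
    also have "\<dots> = (\<Sum>i\<le>n. smult (of_int k) (smult (of_rat (c i)) ((B a ^^ i) a)))"
      using k by (intro sum.cong refl) (simp add: of_int_poly cF)
    also have "\<dots> = smult (of_int k) (\<Sum>i\<le>n. smult (of_rat (c i)) ((B a ^^ i) a))"
      by (rule smult_sum_right[symmetric])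
    also have "\<dots> = 0" using c(2) by simp
    finally show ?thesis using \<open>F \<noteq> 0\<close> by blast
  qed
  then obtain f0 where "?P f0" by blast
  then obtain f where f: "?P f" and min: "\<And>f'. ?P f' \<Longrightarrow> degree f \<le> degree f'"
    using ex_has_least_nat[of ?P f0 degree] by auto
  have "coeff f 0 \<noteq> 0"
  proof
    assume c0: "coeff f 0 = 0"
    then obtain f' where f': "f = pCons 0 f'" by (cases f) auto
    then have "f' \<noteq> 0" using f by auto
    then have "0 = (\<Sum>i\<le>Suc (degree f'). of_int (coeff f i) * (B a ^^ i) a)" using f f' by simp
    also have "\<dots> = (\<Sum>i\<le>degree f'. of_int (coeff f' i) * B a ((B a ^^ i) a))"
      unfolding sum.atMost_Suc_shift f' by simp
    also have "\<dots> = B a (\<Sum>i\<le>degree f'. of_int (coeff f' i) * (B a ^^ i) a)"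
      using a mem by (simp add: B_sum_right B_of_int_right of_int_closed)
    finally have "(\<Sum>i\<le>degree f'. of_int (coeff f' i) * (B a ^^ i) a) = 0"
      using B_no_zero_divisors a mem by (metis (no_types, lifting) of_int_closed sum_closed)
    then have "degree f \<le> degree f'" using min \<open>f' \<noteq> 0\<close> by blast
    then show False using f' \<open>f' \<noteq> 0\<close> by simp
  qed
  moreover have "annihilates f a"
    unfolding annihilates_def
  proof
    fix x assume x: "x \<in> A"
    let ?y = "\<Sum>i\<le>degree f. of_int (coeff f i) * (B a ^^ i) x"
    have yA: "?y \<in> A" using mem x by (auto intro!: sum_closed of_int_closed)
    have "B a ?y = (\<Sum>i\<le>degree f. of_int (coeff f i) * B a ((B a ^^ i) x))"
      using a mem x by (simp add: B_sum_right B_of_int_right of_int_closed)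
    also have "\<dots> = (\<Sum>i\<le>degree f. of_int (coeff f i) * B x ((B a ^^ i) a))"
      using a x by (intro sum.cong refl) (metis B_commute B_funpow_commute)
    also have "\<dots> = B x (\<Sum>i\<le>degree f. of_int (coeff f i) * (B a ^^ i) a)"
      using a mem x by (simp add: B_sum_right B_of_int_right of_int_closed)
    also have "\<dots> = 0" using f x B_0_right by simp
    finally show "?y = 0" using B_no_zero_divisors a yA by blast
  qed
  ultimately show ?thesis by blast
qed

text \<open>A polynomial in the operator $T h = h(a\,\cdot)$ kills $h$. Split off linear factors $T - r$ one at a time, which is possible
  over the complex numbers: the last non-zero functional before $0$ is reached is an eigenvector of $T$. As all
  these operators commute, the eigenvector equations already satisfied by $h$ are inherited.\<close>

lemma eigenfunctional_step:
  assumes "a \<in> A" "additive_functional h" "\<exists>x\<in>A. h x \<noteq> 0" "G \<noteq> 0"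
    "\<And>x. x \<in> A \<Longrightarrow> formal_eval G (\<lambda>i. h ((B a ^^ i) x)) = 0"
  shows "\<exists>h' r. additive_functional h' \<and> (\<exists>x\<in>A. h' x \<noteq> 0) \<and> (\<forall>x\<in>A. h' (B a x) = r * h' x) \<and>
    (\<forall>b\<in>A. \<forall>\<mu>. (\<forall>x\<in>A. h (B b x) = \<mu> * h x) \<longrightarrow> (\<forall>x\<in>A. h' (B b x) = \<mu> * h' x))"
  using assms
proof (induction "degree G" arbitrary: G h)
  case 0
  then obtain c where c: "G = [:c:]" by (metis degree_eq_zeroE)
  then have "c * h x = 0" if "x \<in> A" for x using 0(6)[OF that] by (simp add: formal_eval_pCons)
  then have "h x = 0" if "x \<in> A" for x using that c 0(5) by auto
  then show ?case using 0(4) by blast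
next
  case (Suc d)
  have "\<not> constant (poly G)" using Suc(2) constant_degree[of G] by simp
  then obtain r where "poly G r = 0" using fundamental_theorem_of_algebra by blast
  then obtain Q where Q: "G = [:- r, 1:] * Q" by (auto simp: poly_eq_0_iff_dvd elim: dvdE)
  then have Q0: "Q \<noteq> 0" using Suc by auto
  then have dQ: "d = degree Q" using Suc(2) degree_mult_eq[of "[:- r, 1:]" Q] unfolding Q by simp
  define h1 where "h1 = (\<lambda>x. h (B a x) - r * h x)"
  show ?case
  proof (cases "\<exists>x\<in>A. h1 x \<noteq> 0")
    case False
    then have "\<forall>x\<in>A. h (B a x) = r * h x" by (auto simp: h1_def)
    then show ?thesis using Suc by blast
  next
    case True
    have add1: "additive_functional h1"
      using Suc(3,4) unfolding additive_functional_def h1_def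
      by (auto simp: B_add_right B_closed algebra_simps)
    have "formal_eval Q (\<lambda>i. h1 ((B a ^^ i) x)) = 0" if "x \<in> A" for x
      using Suc(7)[OF that] unfolding Q formal_eval_linear_factor h1_def by simp
    then obtain h' r' where h': "additive_functional h'" "\<exists>x\<in>A. h' x \<noteq> 0" "\<forall>x\<in>A. h' (B a x) = r' * h' x"
      "\<forall>b\<in>A. \<forall>\<mu>. (\<forall>x\<in>A. h1 (B b x) = \<mu> * h1 x) \<longrightarrow> (\<forall>x\<in>A. h' (B b x) = \<mu> * h' x)"
      using Suc(1)[OF dQ Suc(3) add1 True Q0] by blast
    have inherit: "\<forall>x\<in>A. h1 (B b x) = \<mu> * h1 x" if b: "b \<in> A" and mu: "\<forall>x\<in>A. h (B b x) = \<mu> * h x" for b \<mu>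
    proof
      fix x assume x: "x \<in> A"
      have "B a (B b x) = B b (B a x)" using Suc(3) b x by (metis B_assoc B_commute)
      then show "h1 (B b x) = \<mu> * h1 x"
        using mu x b Suc(3) B_closed by (simp add: h1_def algebra_simps)
    qed
    show ?thesis
    proof (intro exI[of _ h'] exI[of _ r'] conjI h'(1,2,3) ballI allI impI)
      fix b \<mu> x assume b: "b \<in> A" "\<forall>x\<in>A. h (B b x) = \<mu> * h x" and x: "x \<in> A"
      show "h' (B b x) = \<mu> * h' x" using h'(4)[rule_format, OF b(1) _ x] inherit[OF b] by blast
    qed
  qed
qed

text \<open>Treat the basis vectors one after another. An eigenvector for all of them is an eigenvector for every
  element, because each element has a multiple that is an integral combination of the basis.\<close>

lemma eigenfunctional_exists:
  "\<exists>h. additive_functional h \<and> (\<exists>x\<in>A. h x \<noteq> 0) \<and> (\<forall>a\<in>A. \<exists>\<mu>. \<forall>x\<in>A. h (B a x) = \<mu> * h x)"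
proof -
  have "j \<le> n \<Longrightarrow> \<exists>h. additive_functional h \<and> (\<exists>x\<in>A. h x \<noteq> 0) \<and> (\<forall>i<j. \<exists>\<mu>. \<forall>x\<in>A. h (B (monom 1 i) x) = \<mu> * h x)" for j
  proof (induction j)
    case 0
    show ?case
      by (intro exI[of _ "\<lambda>x. of_rat (coeff x 0)"])
        (use basis[OF n_pos] in \<open>auto simp: additive_functional_def of_rat_add intro!: bexI[of _ "monom 1 0"]\<close>)
  next
    case (Suc j)
    then obtain h where h: "additive_functional h" "\<exists>x\<in>A. h x \<noteq> 0" "\<forall>i<j. \<exists>\<mu>. \<forall>x\<in>A. h (B (monom 1 i) x) = \<mu> * h x"
      by auto
    have e: "monom 1 j \<in> A" "monom (1::rat) j \<noteq> 0" using Suc basis by auto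
    obtain f where f: "coeff f 0 \<noteq> 0" "annihilates f (monom 1 j)" using annihilator_exists[OF e] by blast
    let ?G = "map_poly complex_of_int f"
    have dG: "degree ?G = degree f" by (rule degree_map_poly) simp
    have G0: "?G \<noteq> 0" using f(1) by (metis coeff_map_poly coeff_0 of_int_0 of_int_eq_0_iff)
    have "formal_eval ?G (\<lambda>i. h ((B (monom 1 j) ^^ i) x)) = 0" if x: "x \<in> A" for x
    proof -
      have mem: "(B (monom 1 j) ^^ i) x \<in> A" for i using iterate_closed e x by blast
      have "formal_eval ?G (\<lambda>i. h ((B (monom 1 j) ^^ i) x)) = (\<Sum>i\<le>degree f. h (of_int (coeff f i) * (B (monom 1 j) ^^ i) x))"
        unfolding formal_eval_def dG using mem h by (simp add: coeff_map_poly functional_of_int)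
      also have "\<dots> = h (\<Sum>i\<le>degree f. of_int (coeff f i) * (B (monom 1 j) ^^ i) x)"
        using mem h by (intro functional_sum[symmetric]) (auto intro: of_int_closed)
      also have "\<dots> = 0" using f x h functional_0 unfolding annihilates_def by simp
      finally show ?thesis .
    qed
    then obtain h' r where h': "additive_functional h'" "\<exists>x\<in>A. h' x \<noteq> 0" "\<forall>x\<in>A. h' (B (monom 1 j) x) = r * h' x"
      "\<forall>b\<in>A. \<forall>\<mu>. (\<forall>x\<in>A. h (B b x) = \<mu> * h x) \<longrightarrow> (\<forall>x\<in>A. h' (B b x) = \<mu> * h' x)"
      using eigenfunctional_step[OF e(1) h(1,2) G0] by blast
    have "\<exists>\<mu>. \<forall>x\<in>A. h' (B (monom 1 i) x) = \<mu> * h' x" if i: "i < Suc j" for i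
    proof (cases "i = j")
      case True
      then show ?thesis using h'(3) by (intro exI[of _ r]) simp
    next
      case False
      then have "i < j" using i by simp
      then obtain \<mu> where mu: "\<forall>x\<in>A. h (B (monom 1 i) x) = \<mu> * h x" using h(3) by auto
      have iA: "monom 1 i \<in> A" using basis i Suc(2) by simp
      show ?thesis using h'(4)[rule_format, OF iA mu[rule_format]] by (intro exI[of _ \<mu>]) simp
    qed
    then show ?case using h'(1,2) by (intro exI[of _ h']) simp
  qed
  from this[OF order_refl] obtain h \<epsilon> where h: "additive_functional h" "\<exists>x\<in>A. h x \<noteq> 0"
    and l: "\<And>i x. i < n \<Longrightarrow> x \<in> A \<Longrightarrow> h (B (monom 1 i) x) = \<epsilon> i * h x" by metis
  have "\<exists>\<mu>. \<forall>x\<in>A. h (B a x) = \<mu> * h x" if a: "a \<in> A" for a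
  proof -
    obtain k c where k: "k > 0" "of_int k * a = (\<Sum>i<n. of_int (c i) * monom 1 i)" using integral_multiple a by blast
    have "h (B a x) = ((\<Sum>i<n. of_int (c i) * \<epsilon> i) / of_int k) * h x" if x: "x \<in> A" for x
    proof -
      have "of_int k * h (B a x) = h (B (of_int k * a) x)"
        using a x h by (simp add: B_of_int_left functional_of_int B_closed)
      also have "\<dots> = (\<Sum>i<n. of_int (c i) * h (B (monom 1 i) x))"
      proof -
        have "B (of_int k * a) x = (\<Sum>i<n. B (of_int (c i) * monom 1 i) x)"
          unfolding k(2) by (rule B_sum_left) (use x basis of_int_closed in auto)
        also have "\<dots> = (\<Sum>i<n. of_int (c i) * B (monom 1 i) x)"
          by (intro sum.cong refl B_of_int_left) (use x basis in auto)
        finally have "h (B (of_int k * a) x) = (\<Sum>i<n. h (of_int (c i) * B (monom 1 i) x))"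
          using functional_sum[OF h(1), of "{..<n}" "\<lambda>i. of_int (c i) * B (monom 1 i) x"] x basis B_closed of_int_closed
          by simp
        also have "\<dots> = (\<Sum>i<n. of_int (c i) * h (B (monom 1 i) x))"
          by (intro sum.cong refl functional_of_int[OF h(1)]) (use x basis B_closed in auto)
        finally show ?thesis .
      qed
      also have "\<dots> = (\<Sum>i<n. of_int (c i) * \<epsilon> i) * h x"
        using x by (simp add: l sum_distrib_right mult.assoc)
      finally show ?thesis using k(1) by (simp add: field_simps)
    qed
    then show ?thesis by blast
  qed
  then show ?thesis using h by blast
qed

text \<open>The eigenvalue of a common eigenvector is additive and multiplicative in \<open>a\<close>. It is injective: by an annihilator with
  non-zero constant coefficient, a non-zero \<open>a\<close> with eigenvalue $0$ would make the eigenvector vanish.\<close>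

lemma complex_embedding:
  obtains \<epsilon> where "additive_functional \<epsilon>" "\<And>a b. a \<in> A \<Longrightarrow> b \<in> A \<Longrightarrow> \<epsilon> (B a b) = \<epsilon> a * \<epsilon> b"
    "\<And>a. a \<in> A \<Longrightarrow> \<epsilon> a = 0 \<Longrightarrow> a = 0"
proof -
  obtain h \<epsilon> x0 where h: "additive_functional h" and x0: "x0 \<in> A" "h x0 \<noteq> 0"
    and l: "\<And>a x. a \<in> A \<Longrightarrow> x \<in> A \<Longrightarrow> h (B a x) = \<epsilon> a * h x"
    using eigenfunctional_exists by metis
  show ?thesis
  proof (rule that[of \<epsilon>])
    have "\<epsilon> (a + b) = \<epsilon> a + \<epsilon> b" if "a \<in> A" "b \<in> A" for a b
    proof -
      have "\<epsilon> (a + b) * h x0 = h (B a x0 + B b x0)" using that x0 l[of "a + b" x0] by (simp add: add_closed B_add_left)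
      also have "\<dots> = (\<epsilon> a + \<epsilon> b) * h x0" using that x0 l h by (simp add: functional_add B_closed distrib_right)
      finally show ?thesis using x0 by simp
    qed
    then show "additive_functional \<epsilon>" by (simp add: additive_functional_def)
    show mult: "\<epsilon> (B a b) = \<epsilon> a * \<epsilon> b" if "a \<in> A" "b \<in> A" for a b
    proof -
      have "\<epsilon> (B a b) * h x0 = h (B a (B b x0))" using that x0 l[of "B a b" x0] by (simp add: B_closed B_assoc)
      also have "\<dots> = \<epsilon> a * \<epsilon> b * h x0" using that x0 l by (simp add: B_closed)
      finally show ?thesis using x0 by simp
    qed
    show "a = 0" if a: "a \<in> A" "\<epsilon> a = 0" for a
    proof (rule ccontr)
      assume "a \<noteq> 0"
      then obtain f where f: "coeff f 0 \<noteq> 0" "annihilates f a" using annihilator_exists a by blast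
      have mem: "(B a ^^ i) x0 \<in> A" for i using iterate_closed a x0 by blast
      have h0: "h ((B a ^^ i) x0) = (if i = 0 then h x0 else 0)" for i
        by (cases i) (use l a mem in auto)
      have "0 = h (\<Sum>i\<le>degree f. of_int (coeff f i) * (B a ^^ i) x0)"
        using f x0 h functional_0 unfolding annihilates_def by simp
      also have "\<dots> = (\<Sum>i\<le>degree f. of_int (coeff f i) * h ((B a ^^ i) x0))"
        using mem h by (simp add: functional_sum functional_of_int of_int_closed)
      also have "\<dots> = (\<Sum>i\<le>degree f. if i = 0 then of_int (coeff f 0) * h x0 else 0)"
        unfolding h0 by (intro sum.cong) auto
      also have "\<dots> = of_int (coeff f 0) * h x0" by simp
      finally show False using f x0 by simp
    qed
  qed
qed

end

context finite_rank_product
begin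

text \<open>Since \<open>A\<close> might lack a unit, the primitive element theorem is applied to $\mathbb{Z} + \varepsilon(A)$. A
  generator $l + \varepsilon(a)$ may be replaced by $\varepsilon(a)$. The degree of its minimal polynomial is \<open>n\<close>,
  because $\varepsilon(A)$ spans an \<open>n\<close>-dimensional space that is contained in $\mathbb{Q}[y]$ and contains
  $y \mathbb{Q}[y]$, where $y = \varepsilon(a)$.\<close>

theorem degree_n_generator:
  assumes n1: "n > 1"
  shows "\<exists>f. irreducible f \<and> degree f = n \<and> (\<exists>a\<in>A. annihilates f a)"
proof -
  obtain \<epsilon> where add: "additive_functional \<epsilon>"
    and mult: "\<And>a b. a \<in> A \<Longrightarrow> b \<in> A \<Longrightarrow> \<epsilon> (B a b) = \<epsilon> a * \<epsilon> b"
    and inj: "\<And>a. a \<in> A \<Longrightarrow> \<epsilon> a = 0 \<Longrightarrow> a = 0"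
    using complex_embedding by blast
  define e where "e = (\<lambda>i. \<epsilon> (monom 1 i))"
  let ?V = "e ` {..<n}"
  have span: "\<epsilon> a \<in> qv.span ?V" if a: "a \<in> A" for a
  proof -
    obtain k c where k: "k > 0" "of_int k * a = (\<Sum>i<n. of_int (c i) * monom 1 i)" using integral_multiple a by blast
    have "of_int k * \<epsilon> a = \<epsilon> (of_int k * a)" using functional_of_int[OF add a] by simp
    also have "\<dots> = (\<Sum>i<n. \<epsilon> (of_int (c i) * monom 1 i))"
      unfolding k(2) by (rule functional_sum[OF add]) (use basis of_int_closed in auto)
    also have "\<dots> = (\<Sum>i<n. of_rat (of_int (c i)) * e i)"
      unfolding e_def by (intro sum.cong refl) (use basis functional_of_int[OF add] in auto)
    finally have "of_rat (1 / of_int k) * (of_int k * \<epsilon> a) = of_rat (1 / of_int k) * (\<Sum>i<n. of_rat (of_int (c i)) * e i)" by simp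
    moreover have "of_rat (1 / of_int k) * (of_int k * \<epsilon> a) = \<epsilon> a" using k(1) by (simp add: of_rat_divide)
    moreover have "of_rat (1 / of_int k) * (\<Sum>i<n. of_rat (of_int (c i)) * e i) \<in> qv.span ?V"
      by (intro qv.span_scale qv.span_sum qv.span_base) auto
    ultimately show ?thesis by simp
  qed
  have indep: "c i = 0" if c: "(\<Sum>i<n. of_rat (c i) * e i) = 0" and i: "i < n" for c :: "nat \<Rightarrow> rat" and i
  proof -
    obtain k d where k: "k > 0" "\<forall>i\<in>{..<n}. rat_of_int (d i) = of_int k * c i"
      using common_denominator[of "{..<n}" c] by auto
    then have d: "rat_of_int (d i) = of_int k * c i" if "i < n" for i using that by simp
    let ?x = "\<Sum>i<n. of_int (d i) * monom 1 i :: rat poly"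
    have xA: "?x \<in> A" by (intro sum_closed of_int_closed basis) auto
    have "\<epsilon> ?x = (\<Sum>i<n. \<epsilon> (of_int (d i) * monom 1 i))"
      by (rule functional_sum[OF add]) (use basis of_int_closed in auto)
    also have "\<dots> = (\<Sum>i<n. of_rat (of_int k) * (of_rat (c i) * e i))"
    proof (intro sum.cong refl)
      fix i assume "i \<in> {..<n}"
      then have i: "i < n" by simp
      have "\<epsilon> (of_int (d i) * monom 1 i) = of_rat (rat_of_int (d i)) * e i"
        using basis[OF i] functional_of_int[OF add] by (simp add: e_def)
      then show "\<epsilon> (of_int (d i) * monom 1 i) = of_rat (of_int k) * (of_rat (c i) * e i)"
        unfolding d[OF i] of_rat_mult by simp
    qed
    also have "\<dots> = 0" using c by (simp flip: sum_distrib_left)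
    finally have "?x = 0" using inj xA by blast
    then have "coeff ?x i = 0" by simp
    then have "rat_of_int (d i) = 0" using i by (simp add: coeff_sum of_int_poly smult_monom)
    then show ?thesis using d[OF i] k(1) by simp
  qed
  \<comment> \<open>The smallest subring with unit that contains the image of \<open>A\<close>.\<close>
  define K where "K = {of_int m + \<epsilon> a | m a. a \<in> A}"
  have eps0: "\<epsilon> 0 = 0" by (rule functional_0[OF add])
  have K1: "1 \<in> K"
  proof -
    have "1 = of_int 1 + \<epsilon> 0" using eps0 by simp
    then show ?thesis unfolding K_def using zero_closed by blast
  qed
  have Kd: "x - y \<in> K" if xy: "x \<in> K" "y \<in> K" for x y
  proof -
    obtain k l a b where x: "x = of_int k + \<epsilon> a" "a \<in> A" "y = of_int l + \<epsilon> b" "b \<in> A"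
      using xy unfolding K_def by blast
    have "x - y = of_int (k - l) + \<epsilon> (a + - b)"
      using x by (simp only: functional_add[OF add] functional_minus[OF add] minus_closed) simp
    then show ?thesis unfolding K_def using x add_closed minus_closed by blast
  qed
  have Km: "x * y \<in> K" if xy: "x \<in> K" "y \<in> K" for x y
  proof -
    obtain k l a b where x: "x = of_int k + \<epsilon> a" "a \<in> A" "y = of_int l + \<epsilon> b" "b \<in> A"
      using xy unfolding K_def by blast
    have mem: "of_int k * b \<in> A" "of_int l * a \<in> A" "B a b \<in> A" using x of_int_closed B_closed by auto
    have "\<epsilon> (of_int k * b + (of_int l * a + B a b)) = of_int k * \<epsilon> b + (of_int l * \<epsilon> a + \<epsilon> a * \<epsilon> b)"
      using x mem by (simp add: functional_add[OF add] functional_of_int[OF add] add_closed mult)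
    then have "x * y = of_int (k * l) + \<epsilon> (of_int k * b + (of_int l * a + B a b))"
      using x by (simp add: algebra_simps)
    then show ?thesis unfolding K_def using mem add_closed by blast
  qed
  let ?W = "insert 1 ?V"
  have VW: "qv.span ?V \<subseteq> qv.span ?W" by (rule qv.span_mono) auto
  have oneW: "1 \<in> qv.span ?W" by (rule qv.span_base) simp
  have KW: "K \<subseteq> qv.span ?W"
  proof
    fix x assume "x \<in> K"
    then obtain k a where x: "x = of_int k + \<epsilon> a" "a \<in> A" unfolding K_def by auto
    have "of_rat (of_int k) * 1 \<in> qv.span ?W" by (rule qv.span_scale[OF oneW])
    moreover have "\<epsilon> a \<in> qv.span ?W" using span x VW by blast
    ultimately show "x \<in> qv.span ?W" unfolding x using qv.span_add by force
  qed
  have "finite ?W" by simp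
  then obtain \<gamma> where g: "\<gamma> \<in> K" "K \<subseteq> Qadj \<gamma>" using primitive_element[OF K1 Kd Km _ KW] by blast
  then obtain l a where a: "\<gamma> = of_int l + \<epsilon> a" "a \<in> A" unfolding K_def by auto
  \<comment> \<open>\<open>y\<close> generates the same field as \<open>\<gamma>\<close> because they differ by an integer.\<close>
  define y where "y = \<epsilon> a"
  have "\<gamma> = of_rat (of_int l) + y" using a by (simp add: y_def)
  also have "\<dots> \<in> Qadj y" by (intro Qadj_add Qadj_of_rat Qadj_self)
  finally have gen: "K \<subseteq> Qadj y" using g Qadj_trans by blast
  have "\<epsilon> b \<in> K" if "b \<in> A" for b
  proof -
    have "\<epsilon> b = of_int 0 + \<epsilon> b" by simp
    then show ?thesis unfolding K_def using that by blast
  qed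
  then have gen': "\<epsilon> b \<in> Qadj y" if "b \<in> A" for b using that gen by blast
  have iter: "\<epsilon> ((B a ^^ i) x) = y ^ i * \<epsilon> x" if "x \<in> A" for x i
    by (induction i) (use that a iterate_closed in \<open>auto simp: mult y_def\<close>)
  have pow: "y ^ Suc i = \<epsilon> ((B a ^^ i) a)" for i using iter[OF a(2), of i] by (simp add: y_def mult.commute)
  have powV: "y ^ Suc i \<in> qv.span ?V" for i unfolding pow using span iterate_closed a by blast
  have "y ^ i \<in> qv.span ?W" for i using powV VW oneW by (cases i) auto
  then obtain m where m: "min_poly_of m y" using algebraic_in_finite_span[of ?W y] by auto
  define d where "d = degree m"
  have "n \<le> d"
  proof (rule ccontr)
    assume "\<not> n \<le> d"
    have "e i \<in> qv.span ((^) y ` {..<d})" if "i < n" for i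
      using Qadj_in_span_powers[OF m gen'[OF basis[OF that]]] unfolding e_def d_def .
    then have "e ` {..<n} \<subseteq> qv.span ((^) y ` {..<d})" by auto
    moreover have "card ((^) y ` {..<d}) < card {..<n}"
      using card_image_le[of "{..<d}" "(^) y"] \<open>\<not> n \<le> d\<close> by simp
    ultimately obtain c where "\<exists>i\<in>{..<n}. c i \<noteq> 0" "(\<Sum>i<n. of_rat (c i) * e i) = 0"
      using qv.family_dependent[of "{..<n}" "(^) y ` {..<d}" e] by auto
    then show False using indep by blast
  qed
  moreover have "d \<le> n"
  \<comment> \<open>$y = 0$ is excluded by $n > 1$ and $n \le d$; here it suffices that then $d \le 1$.\<close>
  proof (cases "y = 0")
    case True
    then have "evq [:0, 1:] y = 0" by simp
    then have "degree m \<le> degree [:0, 1::rat:]" using m unfolding min_poly_of_def by (metis pCons_eq_0_iff zero_neq_one)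
    then show ?thesis using n1 by (simp add: d_def)
  next
    case False
    show ?thesis
    proof (rule ccontr)
      assume "\<not> d \<le> n"
      have "(\<lambda>i. y ^ Suc i) ` {..<d} \<subseteq> qv.span ?V" using powV by blast
      moreover have "card ?V < card {..<d}" using card_image_le[of "{..<n}" e] \<open>\<not> d \<le> n\<close> by simp
      ultimately obtain c where c: "\<exists>i\<in>{..<d}. c i \<noteq> 0" "(\<Sum>i<d. of_rat (c i) * y ^ Suc i) = 0"
        using qv.family_dependent[of "{..<d}" ?V "\<lambda>i. y ^ Suc i"] by auto
      have "(\<Sum>i<d. of_rat (c i) * y ^ Suc i) = y * (\<Sum>i<d. of_rat (c i) * y ^ i)"
        by (simp add: sum_distrib_left mult.left_commute)
      then have "(\<Sum>i<degree m. of_rat (c i) * y ^ i) = 0" using c(2) False by (simp add: d_def)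
      then show False using powers_independent[OF m] c(1) unfolding d_def by blast
    qed
  qed
  ultimately have "degree m = n" by (simp add: d_def)
  then obtain f :: "int poly" where f: "irreducible f" "degree f = n" "evq (map_poly of_int f) y = 0"
    using irreducible_int_poly_of_min_poly[OF m] by auto
  have "annihilates f a"
    unfolding annihilates_def
  proof
    fix x assume x: "x \<in> A"
    have mem: "(B a ^^ i) x \<in> A" for i using iterate_closed a x by blast
    have "\<epsilon> (\<Sum>i\<le>degree f. of_int (coeff f i) * (B a ^^ i) x) = (\<Sum>i\<le>degree f. \<epsilon> (of_int (coeff f i) * (B a ^^ i) x))"
      by (rule functional_sum[OF add]) (use mem of_int_closed in auto)
    also have "\<dots> = (\<Sum>i\<le>degree f. of_int (coeff f i) * (y ^ i * \<epsilon> x))"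
      using mem x by (simp add: functional_of_int[OF add] iter)
    also have "\<dots> = (\<Sum>i<Suc (degree f). of_int (coeff f i) * y ^ i) * \<epsilon> x"
      by (simp add: sum_distrib_right mult.assoc lessThan_Suc_atMost)
    also have "(\<Sum>i<Suc (degree f). of_int (coeff f i) * y ^ i) = evq (map_poly of_int f) y"
      by (subst evq_altdef[of _ "Suc (degree f)"]) (simp_all add: coeff_map_poly)
    finally have "\<epsilon> (\<Sum>i\<le>degree f. of_int (coeff f i) * (B a ^^ i) x) = 0" using f(3) by simp
    then show "(\<Sum>i\<le>degree f. of_int (coeff f i) * (B a ^^ i) x) = 0"
      using inj mem by (metis (no_types, lifting) of_int_closed sum_closed)
  qed
  then show ?thesis using f a by blast
qed

end

section \<open>Coordinates on a torsion-free group of finite rank\<close>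

lemma finite_rank_independent_set:
  assumes "group_rank G = enat n" "n > 0"
  shows "\<exists>S. independent_mod 0 G S \<and> card S = n"
proof (rule ccontr)
  assume none: "\<not> ?thesis"
  have "card S \<le> n - 1" if S: "independent_mod 0 G S" for S
  proof -
    have "enat (card S) \<le> group_rank G" unfolding group_rank_def using S by (intro SUP_upper) simp
    then show ?thesis using none S assms by (metis enat_ord_simps(1) le_neq_implies_less less_Suc_eq_le Suc_pred')
  qed
  then have "group_rank G \<le> enat (n - 1)" unfolding group_rank_def by (intro SUP_least) simp
  then show False using assms by simp
qed

text \<open>With a maximal independent family $e_0, \ldots, e_{n-1}$, each $x$ has a power $x^k = \prod e_i^{c_i}$ with $k \neq 0$. The vector
  $(c_i / k)_i$ depends only on $x$ by independence and determines $x$ because $G$ is torsion-free.\<close>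

lemma coordinates:
  fixes G :: "'a monoid" (structure)
  assumes G: "comm_group G" and tf: "torsion_free G" and rank: "group_rank G = enat n" and n: "n > 0"
  shows "\<exists>A \<phi>. additive_model A G \<phi> \<and> (\<forall>i<n. monom 1 i \<in> A) \<and> (\<forall>x\<in>A. \<forall>i\<ge>n. coeff x i = (0 :: rat))"
proof -
  interpret G: comm_group G by fact
  obtain S where S: "independent_mod 0 G S" "card S = n" using finite_rank_independent_set[OF rank n] by blast
  have fin: "finite S" and SG: "S \<subseteq> carrier G"
    and ind: "\<And>c x. finprod G (\<lambda>x. x [^] (c x :: int)) S = \<one> \<Longrightarrow> x \<in> S \<Longrightarrow> c x = 0"
    using S unfolding independent_mod_def by auto
  obtain e where e: "bij_betw e {..<n} S" using ex_bij_betw_nat_finite[OF fin] S(2) by (auto simp: lessThan_atLeast0)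
  then have eG: "e i \<in> carrier G" if "i < n" for i using that SG by (auto simp: bij_betw_def)
  define L where "L = (\<lambda>c :: nat \<Rightarrow> int. finprod G (\<lambda>i. e i [^] c i) {..<n})"
  have LG: "L c \<in> carrier G" for c unfolding L_def using eG by (intro G.finprod_closed) auto
  have L_add: "L (\<lambda>i. c i + d i) = L c \<otimes> L d" for c d
  proof -
    have "L (\<lambda>i. c i + d i) = finprod G (\<lambda>i. e i [^] c i \<otimes> e i [^] d i) {..<n}"
      unfolding L_def using eG by (intro G.finprod_cong') (auto simp: G.int_pow_mult)
    then show ?thesis unfolding L_def using eG by (simp add: G.finprod_multf Pi_def)
  qed
  have L_mult: "L (\<lambda>i. k * c i) = L c [^] k" for k c
  proof -
    have "finprod G (\<lambda>i. e i [^] (k * c i)) J = finprod G (\<lambda>i. e i [^] c i) J [^] k"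
      if "J \<subseteq> {..<n}" for J
    proof -
      have "finite J" using that finite_subset by blast
      then show ?thesis using that
      proof (induction J rule: finite_induct)
        case (insert j J)
        have c: "finprod G (\<lambda>i. e i [^] c i) J \<in> carrier G" using insert eG by (intro G.finprod_closed) auto
        have "finprod G (\<lambda>i. e i [^] (k * c i)) (insert j J) = e j [^] (k * c j) \<otimes> finprod G (\<lambda>i. e i [^] (k * c i)) J"
          using insert eG by (intro G.finprod_insert) auto
        also have "e j [^] (k * c j) = (e j [^] c j) [^] k"
          using insert eG by (simp add: G.int_pow_pow mult.commute)
        also have "(e j [^] c j) [^] k \<otimes> finprod G (\<lambda>i. e i [^] (k * c i)) J
            = (e j [^] c j \<otimes> finprod G (\<lambda>i. e i [^] c i) J) [^] k"
          using insert eG c by (simp add: G.int_pow_distrib)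
        also have "e j [^] c j \<otimes> finprod G (\<lambda>i. e i [^] c i) J = finprod G (\<lambda>i. e i [^] c i) (insert j J)"
          using insert eG by (intro G.finprod_insert[symmetric]) auto
        finally show ?case .
      qed simp
    qed
    then show ?thesis unfolding L_def by blast
  qed
  have L_reindex: "finprod G (\<lambda>x. x [^] (c x :: int)) S = L (c \<circ> e)" for c
  proof -
    have S': "inj_on e {..<n}" "S = e ` {..<n}" using e by (auto simp: bij_betw_def)
    have "finprod G (\<lambda>x. x [^] c x) (e ` {..<n}) = finprod G (\<lambda>i. e i [^] c (e i)) {..<n}"
      by (rule G.finprod_reindex) (use S' SG in auto)
    then show ?thesis unfolding L_def S'(2) by (simp add: comp_def)
  qed
  have L_one: "c i = 0" if c: "L c = \<one>" and i: "i < n" for c i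
  proof -
    define c' where "c' = c \<circ> the_inv_into {..<n} e"
    have inv: "c' (e j) = c j" if "j < n" for j
      using that e unfolding c'_def bij_betw_def by (simp add: the_inv_into_f_f)
    then have "L (c' \<circ> e) = L c" unfolding L_def using eG by (intro G.finprod_cong') auto
    then have "c' (e i) = 0" using ind[of c'] c L_reindex e i by (auto simp: bij_betw_def)
    then show ?thesis using inv i by simp
  qed
  have L_inj: "c i = d i" if "L c = L d" "i < n" for c d i
  proof -
    have "L (\<lambda>i. c i + (-1) * d i) = L c \<otimes> L d [^] (-1 :: int)"
      using L_add[of c "\<lambda>i. (-1) * d i"] L_mult[of "-1" d] by simp
    also have "\<dots> = \<one>" using that(1) LG[of d] by (simp add: G.int_pow_neg)
    finally have "c i + (-1) * d i = 0" using L_one[OF _ that(2)] by blast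
    then show ?thesis by simp
  qed
  have L_delta: "L (\<lambda>i. if i = j then 1 else 0) = e j" if j: "j < n" for j
  proof -
    have "L (\<lambda>i. if i = j then 1 else 0) = finprod G (\<lambda>i. if j = i then e i else \<one>) {..<n}"
      unfolding L_def using eG by (intro G.finprod_cong') auto
    also have "\<dots> = e j" using j eG by (intro G.finprod_singleton) auto
    finally show ?thesis .
  qed
  have tf': "x = \<one>" if "x \<in> carrier G" "x [^] (k :: int) = \<one>" "k \<noteq> 0" for x k
  proof -
    have "x [^] nat \<bar>k\<bar> = \<one>"
    proof (cases "k \<ge> 0")
      case False
      then have "x [^] nat \<bar>k\<bar> = x [^] (- k)" by (simp add: int_pow_int[symmetric])
      then show ?thesis using that by (simp add: G.int_pow_neg)
    qed (use that in \<open>simp add: int_pow_int[symmetric]\<close>)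
    then show ?thesis using tf that unfolding torsion_free_def by (metis zero_less_abs_iff zero_less_nat_eq)
  qed
  have dep: "\<exists>k c. k \<noteq> 0 \<and> x [^] (k :: int) = L c" if x: "x \<in> carrier G" for x
  proof (cases "x \<in> S")
    case True
    then obtain j where j: "j < n" "x = e j" using e by (auto simp: bij_betw_def)
    then show ?thesis using L_delta[OF j(1)] eG by (intro exI[of _ 1] exI[of _ "\<lambda>i. if i = j then 1 else 0"]) simp
  next
    case False
    have "\<not> independent_mod 0 G (insert x S)"
    proof
      assume "independent_mod 0 G (insert x S)"
      then have "enat (card (insert x S)) \<le> group_rank G" unfolding group_rank_def by (intro SUP_upper) simp
      then show False using rank S(2) fin False by simp
    qed
    then obtain c y where c: "finprod G (\<lambda>x. x [^] (c x :: int)) (insert x S) = \<one>" "y \<in> insert x S" "c y \<noteq> 0"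
      using fin SG x unfolding independent_mod_def by auto
    have "finprod G (\<lambda>x. x [^] (c x :: int)) (insert x S) = x [^] c x \<otimes> L (c \<circ> e)"
      using fin SG x False by (subst G.finprod_insert) (auto simp: L_reindex)
    then have xL: "x [^] c x \<otimes> L (c \<circ> e) = \<one>" using c by simp
    have "c x \<noteq> 0"
    proof
      assume "c x = 0"
      then have "L (c \<circ> e) = \<one>" using xL LG by simp
      then show False using ind[of c y] c \<open>c x = 0\<close> L_reindex by auto
    qed
    moreover have "x [^] c x = L (\<lambda>i. (-1) * (c \<circ> e) i)"
    proof -
      have "x [^] c x = inv L (c \<circ> e)" using xL x LG by (intro G.inv_equality[symmetric]) auto
      also have "\<dots> = L (c \<circ> e) [^] (- 1 :: int)" using LG by (simp only: G.int_pow_neg G.int_pow_1)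
      finally show ?thesis by (simp only: L_mult)
    qed
    ultimately show ?thesis by blast
  qed
  \<comment> \<open>The coordinate vector of an arbitrarily chosen relation $x^k = \prod e_i^{c_i}$.\<close>
  define \<psi> where "\<psi> = (\<lambda>x. let (k, c) = SOME (k, c). k \<noteq> 0 \<and> x [^] (k :: int) = L c in
    \<Sum>i<n. monom (of_int (c i) / of_int k :: rat) i)"
  have psi: "\<psi> x = (\<Sum>i<n. monom (of_int (c i) / of_int k) i)"
    if x: "x \<in> carrier G" and k: "k \<noteq> 0" "x [^] k = L c" for x k c
  proof -
    define kc where "kc = (SOME (k, c). k \<noteq> 0 \<and> x [^] (k :: int) = L c)"
    obtain l d where l: "kc = (l, d)" by fastforce
    have "(\<lambda>(k, c). k \<noteq> 0 \<and> x [^] (k :: int) = L c) kc"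
      unfolding kc_def by (rule someI[of _ "(k, c)"]) (use k in simp)
    then have ld: "l \<noteq> 0" "x [^] l = L d" using l by auto
    have "L (\<lambda>i. l * c i) = L (\<lambda>i. k * d i)"
      unfolding L_mult k(2)[symmetric] ld(2)[symmetric] using x by (simp add: G.int_pow_pow mult.commute)
    then have "l * c i = k * d i" if "i < n" for i using L_inj[OF _ that] by blast
    then have "rat_of_int l * of_int (c i) = of_int k * of_int (d i)" if "i < n" for i
      using that by (metis of_int_mult)
    then have "(of_int (d i) / of_int l :: rat) = of_int (c i) / of_int k" if "i < n" for i
      using that k ld by (simp add: field_simps)
    then show ?thesis unfolding \<psi>_def kc_def[symmetric] l by simp
  qed
  have psi_add: "\<psi> (x \<otimes> y) = \<psi> x + \<psi> y" if xy: "x \<in> carrier G" "y \<in> carrier G" for x y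
  proof -
    obtain k c where k: "k \<noteq> 0" "x [^] (k :: int) = L c" using dep xy by blast
    obtain l d where l: "l \<noteq> 0" "y [^] (l :: int) = L d" using dep xy by blast
    have "(x \<otimes> y) [^] (k * l) = (x [^] k) [^] l \<otimes> (y [^] l) [^] k"
      using xy by (simp add: G.int_pow_distrib G.int_pow_pow mult.commute)
    also have "\<dots> = L (\<lambda>i. l * c i + k * d i)" unfolding k l L_add L_mult ..
    finally have kl: "(x \<otimes> y) [^] (k * l) = L (\<lambda>i. l * c i + k * d i)" .
    have "\<psi> (x \<otimes> y) = (\<Sum>i<n. monom (of_int (l * c i + k * d i) / of_int (k * l)) i)"
      by (rule psi[OF _ _ kl]) (use xy k l in auto)
    also have "\<dots> = (\<Sum>i<n. monom (of_int (c i) / of_int k) i + monom (of_int (d i) / of_int l) i)"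
      using k l by (intro sum.cong refl) (simp add: add_monom add_divide_distrib)
    also have "\<dots> = \<psi> x + \<psi> y" unfolding psi[OF xy(1) k] psi[OF xy(2) l] by (rule sum.distrib)
    finally show ?thesis .
  qed
  have psi_zero: "x = \<one>" if x: "x \<in> carrier G" and "\<psi> x = 0" for x
  proof -
    obtain k c where k: "k \<noteq> 0" "x [^] (k :: int) = L c" using dep x by blast
    have "c i = 0" if "i < n" for i
    proof -
      have "coeff (\<psi> x) i = of_int (c i) / of_int k" unfolding psi[OF x k] using that by (simp add: coeff_sum)
      then show ?thesis using \<open>\<psi> x = 0\<close> k by simp
    qed
    then have "L c = \<one>" unfolding L_def by (intro G.finprod_one_eqI) auto
    then show ?thesis using tf'[OF x _ k(1)] k by simp
  qed
  define A where "A = \<psi> ` carrier G"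
  have psi_diff: "\<psi> x - \<psi> y = \<psi> (x \<otimes> inv y)" if "x \<in> carrier G" "y \<in> carrier G" for x y
  proof -
    have "\<psi> (x \<otimes> inv y) + \<psi> y = \<psi> x"
      using that by (simp add: G.m_assoc flip: psi_add)
    then show ?thesis by (simp add: algebra_simps)
  qed
  have inj: "inj_on \<psi> (carrier G)"
  proof (rule inj_onI)
    fix x y assume xy: "x \<in> carrier G" "y \<in> carrier G" "\<psi> x = \<psi> y"
    then have "x \<otimes> inv y = \<one>" using psi_zero psi_diff[of x y] by simp
    then show "x = y" using xy by (metis G.inv_closed G.inv_equality G.inv_inv)
  qed
  define \<phi> where "\<phi> = the_inv_into (carrier G) \<psi>"
  have phi_psi: "\<phi> (\<psi> x) = x" if "x \<in> carrier G" for x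
    unfolding \<phi>_def using inj that by (rule the_inv_into_f_f)
  have psi0: "\<psi> \<one> = 0" using psi_add[of "\<one>" "\<one>"] by simp
  have "additive_model A G \<phi>"
  proof
    show "0 \<in> A" unfolding A_def using psi0 by (metis G.one_closed imageI)
    show "x - y \<in> A" if "x \<in> A" "y \<in> A" for x y using that psi_diff unfolding A_def by auto
    show "bij_betw \<phi> A (carrier G)" unfolding A_def \<phi>_def
      using bij_betw_the_inv_into[of \<psi> "carrier G" "\<psi> ` carrier G"] inj by (simp add: bij_betw_def)
    show "\<phi> (x + y) = \<phi> x \<otimes> \<phi> y" if xy: "x \<in> A" "y \<in> A" for x y
    proof -
      obtain u v where "u \<in> carrier G" "x = \<psi> u" "v \<in> carrier G" "y = \<psi> v" using xy unfolding A_def by auto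
      note uv = this
      have "\<phi> (x + y) = \<phi> (\<psi> (u \<otimes> v))" using uv by (simp only: psi_add)
      also have "\<dots> = u \<otimes> v" using uv by (intro phi_psi) simp
      finally show ?thesis using uv by (simp only: phi_psi)
    qed
  qed
  moreover have "monom 1 j \<in> A" if j: "j < n" for j
  proof -
    have ej: "e j [^] (1 :: int) = L (\<lambda>i. if i = j then 1 else 0)" using L_delta[OF j] eG[OF j] by simp
    have "\<psi> (e j) = (\<Sum>i<n. monom (of_int (if i = j then 1 else 0) / of_int 1) i)"
      by (rule psi[OF eG[OF j] _ ej]) simp
    also have "\<dots> = (\<Sum>i<n. if i = j then monom 1 j else 0)" by (intro sum.cong) auto
    also have "\<dots> = monom 1 j" using j by simp
    finally have "monom 1 j = \<psi> (e j)" ..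
    then show ?thesis unfolding A_def using eG[OF j] by blast
  qed
  moreover have "coeff x i = 0" if xi: "x \<in> A" "i \<ge> n" for x i
  proof -
    obtain u where u: "u \<in> carrier G" "x = \<psi> u" using xi unfolding A_def by auto
    obtain k c where k: "k \<noteq> 0" "u [^] (k :: int) = L c" using dep u by blast
    show ?thesis unfolding u psi[OF u(1) k] using xi(2) by (simp add: coeff_sum)
  qed
  ultimately show ?thesis by blast
qed

section \<open>From a group to a polynomial\<close>

lemma poly_map_of_int: "poly (map_poly of_int f) (of_int x :: rat) = of_int (poly f x)"
  by (induction f) (simp_all add: map_poly_pCons)

lemma inverse_power_small:
  assumes "prime p" "(e::real) > 0" shows "\<exists>N. \<forall>i\<ge>N. 1 / real p ^ i < e"
proof -
  have p: "real p > 1" using prime_gt_1_nat[OF assms(1)] by simp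
  obtain N where N: "inverse e < real p ^ N" using real_arch_pow[OF p] by blast
  have "1 / real p ^ i < e" if "i \<ge> N" for i
  proof -
    have "inverse e < real p ^ i" using N power_increasing[OF that, of "real p"] p by linarith
    then show ?thesis using assms(2) p by (simp add: field_simps)
  qed
  then show ?thesis by blast
qed

text \<open>The compatible approximate roots form a Cauchy sequence on which $f$ tends to $0$.\<close>

lemma root_prime_of_approximations:
  assumes p: "prime p" and s: "\<And>k. int p ^ k dvd poly f (s k)" "\<And>k. int p ^ k dvd s (Suc k) - s k"
  shows "p \<in> root_primes f"
proof -
  have dvd: "int p ^ k dvd s (k + d) - s k" for k d
  proof (induction d)
    case (Suc d)
    have "int p ^ k dvd int p ^ (k + d)" by (simp add: le_imp_power_dvd)
    then have "int p ^ k dvd s (Suc (k + d)) - s (k + d)" using s(2) dvd_trans by blast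
    then have "int p ^ k dvd (s (Suc (k + d)) - s (k + d)) + (s (k + d) - s k)" using Suc by (rule dvd_add)
    then show ?case by simp
  qed simp
  let ?s = "\<lambda>k. rat_of_int (s k)"
  have close: "padic_abs p (?s i - ?s j) \<le> 1 / real p ^ k" if "i \<ge> k" "j \<ge> k" for i j k
  proof -
    have "int p ^ k dvd s i - s k" "int p ^ k dvd s j - s k"
      using dvd[of k "i - k"] dvd[of k "j - k"] that by auto
    then have "int p ^ k dvd (s i - s k) - (s j - s k)" by (rule dvd_diff)
    then show ?thesis using padic_abs_of_int_le_iff[OF p, of "s i - s j" k] by simp
  qed
  have "padic_Cauchy p ?s"
    unfolding padic_Cauchy_def
  proof (intro allI impI)
    fix e :: real assume "e > 0"
    then obtain N where "1 / real p ^ N < e" using inverse_power_small[OF p] by blast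
    then show "\<exists>N. \<forall>i\<ge>N. \<forall>j\<ge>N. padic_abs p (?s i - ?s j) < e"
      using close by (intro exI[of _ N]) (meson le_less_trans)
  qed
  moreover have "padic_null p (\<lambda>i. poly (map_poly of_int f) (?s i))"
    unfolding padic_null_iff poly_map_of_int
  proof (intro allI impI)
    fix e :: real assume "e > 0"
    then obtain N where "\<forall>i\<ge>N. 1 / real p ^ i < e" using inverse_power_small[OF p] by blast
    then show "\<exists>N. \<forall>i\<ge>N. padic_abs p (rat_of_int (poly f (s i))) < e"
      using s(1) padic_abs_of_int_le_iff[OF p] by (intro exI[of _ N]) (meson le_less_trans)
  qed
  ultimately show ?thesis unfolding root_primes_def using p int_poly_root_in_padic_field_iff[OF p] by blast
qed

lemma type_of_char_eq_iff: "type_of_char \<chi> = type_of_char \<psi> \<longleftrightarrow> char_equiv \<chi> \<psi>"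
  by (rule height_type.abs_eq_iff)

lemma group_type_eq:
  assumes "\<And>x. x \<in> carrier G \<Longrightarrow> x \<noteq> \<one>\<^bsub>G\<^esub> \<Longrightarrow> element_type G x = t" "\<exists>x\<in>carrier G. x \<noteq> \<one>\<^bsub>G\<^esub>"
  shows "group_type G = t"
  unfolding group_type_def
proof (rule the_equality)
  show "\<forall>x\<in>carrier G - {\<one>\<^bsub>G\<^esub>}. element_type G x = t" using assms(1) by simp
  fix t' assume "\<forall>x\<in>carrier G - {\<one>\<^bsub>G\<^esub>}. element_type G x = t'"
  then show "t' = t" using assms by (metis DiffI singletonD)
qed

lemma element_type_of_homogeneous:
  assumes "homogeneous G" "x \<in> carrier G" "x \<noteq> \<one>\<^bsub>G\<^esub>"
  shows "element_type G x = group_type G"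
proof (rule group_type_eq[symmetric])
  show "element_type G y = element_type G x" if "y \<in> carrier G" "y \<noteq> \<one>\<^bsub>G\<^esub>" for y
    using assms(1)[unfolded homogeneous_def, rule_format, of y x] assms(2,3) that by simp
  show "\<exists>x\<in>carrier G. x \<noteq> \<one>\<^bsub>G\<^esub>" using assms(2,3) by blast
qed

text \<open>The constituents are put together: a single prime $p_0$ of $P_0$ provides the algebraic structure and with it $f$ and
  $a$; then every prime of $P_0$ provides a root of the same $f$.\<close>

theorem polynomial_of_group:
  fixes G :: "'a monoid"
  assumes G: "G \<in> MH - NIL" and rank: "group_rank G = enat n" and n: "n > 1"
    and type: "group_type G = t" and t: "t \<noteq> type_of_char (\<lambda>p. \<infinity>)"
  shows "idempotent_type t \<and> (\<exists>f :: int poly. irreducible f \<and> degree f = n \<and> finite_primes t \<subseteq> root_primes f)"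
proof -
  have cg: "comm_group G" and tf: "torsion_free G" and hom: "homogeneous G"
    and pr: "\<And>p. prime p \<Longrightarrow> p_rank p G \<le> 1"
    using G by (auto simp: MH_def murley_group_def)
  have nn: "\<not> nil_group G" using G rank cg tf by (auto simp: NIL_def)
  obtain A \<phi> where model: "additive_model A G \<phi>" and basis: "\<And>i. i < n \<Longrightarrow> monom 1 i \<in> A"
    and bounded: "\<And>x i. x \<in> A \<Longrightarrow> i \<ge> n \<Longrightarrow> coeff x i = (0 :: rat)"
    using coordinates[OF cg tf rank] n by (metis less_trans zero_less_one)
  interpret additive_model A G \<phi> by (rule model)
  define \<chi> where "\<chi> = (\<lambda>x p. height G p (\<phi> x))"
  have chi: "type_of_char (\<chi> x) = t" if "x \<in> A" "x \<noteq> 0" for x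
    using element_type_of_homogeneous[OF hom, of "\<phi> x"] that phi_eq_one type
    by (simp add: element_type_def \<chi>_def)
  have chi_ge: "enat k \<le> \<chi> x p \<longleftrightarrow> (\<exists>y\<in>A. x = of_nat p ^ k * y)" if "x \<in> A" for x k p
    unfolding \<chi>_def using height_ge_iff[OF that] .
  have fp: "finite_primes t = {p. prime p \<and> \<chi> x p \<noteq> \<infinity>}" if "x \<in> A" "x \<noteq> 0" for x
    using finite_primes.abs_eq[of "\<chi> x"] chi[OF that] by simp
  obtain B x0 y0 where B: "biadditive_on A B" and xy0: "x0 \<in> A" "y0 \<in> A" "B x0 y0 \<noteq> 0"
    using not_nil_groupD[OF nn] by blast
  have at_prime: "\<exists>g. padic_product A B p g" if p: "p \<in> finite_primes t" for p
  proof -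
    have pp: "prime p" using p fp[of "monom 1 0"] basis[of 0] n by auto
    obtain g where g: "g \<in> A" "\<forall>x\<in>A. \<exists>a::int. \<exists>y\<in>A. x = of_int a * g + of_nat p * y"
      using pr[OF pp] p_rank_le_1_iff[OF pp] by blast
    have "padic_product A B p g"
    proof
      fix x assume x: "x \<in> A" "\<And>k. \<exists>y\<in>A. x = of_nat p ^ k * y"
      show "x = 0"
      proof (rule ccontr)
        assume "x \<noteq> 0"
        then have "\<chi> x p \<noteq> \<infinity>" using fp[OF x(1)] p by auto
        then obtain k where "\<chi> x p = enat k" by auto
        then have "\<not> enat (Suc k) \<le> \<chi> x p" by simp
        then show False using chi_ge x by blast
      qed
    qed (use B xy0 pp g in auto)
    then show ?thesis by blast
  qed
  have "finite_primes t \<noteq> {}"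
  proof
    assume empty: "finite_primes t = {}"
    have e: "monom 1 0 \<in> A" "monom (1::rat) 0 \<noteq> 0" using basis[of 0] n by auto
    have no: "\<not> (prime p \<and> \<chi> (monom 1 0) p \<noteq> \<infinity>)" for p
      using fp[OF e] empty by blast
    have "char_equiv (\<chi> (monom 1 0)) (\<lambda>p. \<infinity>)"
    proof -
      have "{p. prime p \<and> \<chi> (monom 1 0) p \<noteq> \<infinity>} = {}" using no by blast
      then show ?thesis unfolding char_equiv_def using no by (metis finite.emptyI)
    qed
    then show False using chi[OF e] t type_of_char_eq_iff by metis
  qed
  then obtain p0 g0 where p0: "padic_product A B p0 g0" using at_prime by blast
  interpret P0: padic_product A B p0 g0 by (rule p0)
  interpret P0: finite_rank_product A B p0 g0 n
    by unfold_locales (use n basis bounded in auto)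
  have idem: "idempotent_type t"
  proof -
    let ?z = "B x0 y0"
    have nz: "x0 \<noteq> 0" "y0 \<noteq> 0" "?z \<noteq> 0" "?z \<in> A"
      using xy0 P0.B_0_left P0.B_0_right P0.B_closed by auto
    define \<theta> where "\<theta> = (\<lambda>p. if \<chi> x0 p = \<infinity> then \<infinity> else (0 :: enat))"
    have e: "char_equiv (\<chi> x0) (\<chi> y0)" "char_equiv (\<chi> x0) (\<chi> ?z)"
      using chi xy0 nz by (simp_all flip: type_of_char_eq_iff)
    have "\<theta> p = \<chi> x0 p" if eq: "\<chi> x0 p = \<chi> y0 p" "\<chi> x0 p = \<chi> ?z p" for p
    proof (cases "\<chi> x0 p")
      case (enat j)
      obtain u v where uv: "u \<in> A" "x0 = of_nat p ^ j * u" "v \<in> A" "y0 = of_nat p ^ j * v"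
        using chi_ge[of x0 j p] chi_ge[of y0 j p] xy0 eq enat by auto
      have "?z = of_nat (p ^ j) * (of_nat (p ^ j) * B u v)"
        using uv P0.B_of_nat_left[of u y0 "p ^ j"] P0.B_of_nat_right[of u v "p ^ j"] xy0 by simp
      then have "?z = of_nat p ^ (j + j) * B u v" by (simp add: power_add mult.assoc)
      then have "enat (j + j) \<le> \<chi> ?z p" using chi_ge[OF nz(4)] P0.B_closed uv by blast
      moreover have "\<chi> ?z p = enat j" using eq(2) enat by metis
      ultimately have "j = 0" by simp
      then show ?thesis using enat by (simp add: \<theta>_def zero_enat_def)
    qed (simp add: \<theta>_def)
    then have "{p. prime p \<and> \<theta> p \<noteq> \<chi> x0 p} \<subseteq> {p. prime p \<and> \<chi> x0 p \<noteq> \<chi> y0 p} \<union> {p. prime p \<and> \<chi> x0 p \<noteq> \<chi> ?z p}"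
      by blast
    then have "finite {p. prime p \<and> \<theta> p \<noteq> \<chi> x0 p}"
      using e unfolding char_equiv_def by (meson finite_UnI finite_subset)
    then have "char_equiv \<theta> (\<chi> x0)" unfolding char_equiv_def
      by (auto simp: \<theta>_def zero_enat_def split: if_splits)
    then have "type_of_char \<theta> = t" using chi xy0 nz by (simp flip: type_of_char_eq_iff)
    then show ?thesis unfolding idempotent_type_def by (intro exI[of _ \<theta>]) (simp add: \<theta>_def)
  qed
  obtain f a where f: "irreducible f" "degree f = n" and a: "a \<in> A" "P0.annihilates f a"
    using P0.degree_n_generator[OF n] by blast
  have "p \<in> root_primes f" if p: "p \<in> finite_primes t" for p
  proof -
    obtain g where g: "padic_product A B p g" using at_prime[OF p] by blast
    interpret P: padic_product A B p g by (rule g)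
    obtain s :: "nat \<Rightarrow> int" where "\<forall>k. int p ^ k dvd poly f (s k) \<and> int p ^ k dvd s (Suc k) - s k"
      using P.padic_root_of_annihilator[OF a(1), of f] a(2) unfolding P0.annihilates_def by blast
    then show ?thesis using root_prime_of_approximations[OF P.prime] by blast
  qed
  then show ?thesis using idem f by blast
qed

section \<open>From a polynomial to a group\<close>

lemma map_of_int_inj: "map_poly rat_of_int F = map_poly rat_of_int G \<Longrightarrow> F = G"
  by (rule poly_eqI) (metis coeff_map_poly of_int_0 of_int_eq_iff)

text \<open>A form of the lemma of Gauss. The primitive minimal polynomial $h$ of \<open>y\<close> divides $k f$ for some integer $k > 0$; being prime
  and not constant, $h$ divides $f$, which is irreducible.\<close>

lemma irreducible_int_poly_min_poly:
  assumes f: "irreducible f" and root: "evq (map_poly of_int f) y = 0"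
  shows "min_poly_of (map_poly of_int f) y"
proof -
  have f0: "f \<noteq> 0" using f by (simp add: irreducible_def)
  then obtain m where m: "min_poly_of m y" using min_poly_exists[of "map_poly of_int f" y] root by auto
  obtain h :: "int poly" where h: "irreducible h" "degree h = degree m" "evq (map_poly of_int h) y = 0"
    using irreducible_int_poly_of_min_poly[OF m] by blast
  have mh: "min_poly_of (map_poly of_int h) y"
    using m h unfolding min_poly_of_def by (auto simp: irreducible_def)
  obtain q where q: "map_poly rat_of_int f = map_poly of_int h * q" using min_poly_dvd[OF mh root] by (auto elim: dvdE)
  obtain k Q where Q: "k > 0" "map_poly rat_of_int Q = smult (of_int k) q" using clear_denominators by blast
  have "map_poly rat_of_int (smult k f) = map_poly of_int (h * Q)"
    by (simp add: map_poly_smult map_of_int_mult q Q)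
  then have "smult k f = h * Q" by (rule map_of_int_inj)
  then have "h dvd [:k:] * f" by simp
  moreover have "prime_elem h" using h(1) by (rule irreducible_imp_prime_elem)
  ultimately have "h dvd [:k:] \<or> h dvd f" using prime_elem_dvd_mult_iff by blast
  moreover have "\<not> h dvd [:k:]"
  proof
    assume "h dvd [:k:]"
    then have "degree h \<le> degree [:k:]" by (rule dvd_imp_degree_le) (use Q in simp)
    then show False using h(2) min_poly_degree_pos[OF m] by simp
  qed
  ultimately obtain u where u: "f = h * u" by (auto elim: dvdE)
  have "\<not> is_unit h" using h(1) by (simp add: irreducible_def)
  then have "is_unit u" using f u by (metis irreducibleD)
  then have "degree u = 0" by (auto simp: is_unit_poly_iff)
  then have "degree f = degree m" using u h(2) f0 by (simp add: degree_mult_eq)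
  then show ?thesis using m root f0 unfolding min_poly_of_def by simp
qed

text \<open>For \<open>p \<in> P\<close> the sequence \<open>s p\<close> represents a $p$-adic root of \<open>f\<close>, and
  $g(\gamma) \mapsto \lim g(s_{p,i})$ is the corresponding embedding of $\mathbb{Q}(\gamma)$ in the $p$-adic field.\<close>

locale local_integers =
  fixes f :: "int poly" and \<gamma> :: complex and P :: "nat set" and s :: "nat \<Rightarrow> nat \<Rightarrow> rat"
  assumes irreducible: "irreducible f"
    and root: "evq (map_poly of_int f) \<gamma> = 0"
    and primes: "p \<in> P \<Longrightarrow> prime p"
    and Cauchy: "p \<in> P \<Longrightarrow> padic_Cauchy p (s p)"
    and null: "p \<in> P \<Longrightarrow> padic_null p (\<lambda>i. poly (map_poly of_int f) (s p i))"
begin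

text \<open>The image of $x = g(\gamma)$ in the $p$-adic field is integral: values of a convergent sequence are eventually integral iff its limit
  is.\<close>

definition integral_at :: "nat \<Rightarrow> complex \<Rightarrow> bool" where
  "integral_at p x \<longleftrightarrow> (\<exists>g. evq g \<gamma> = x \<and> (\<exists>N. \<forall>i\<ge>N. padic_abs p (poly g (s p i)) \<le> 1))"

definition R :: "complex set" where
  "R = {x \<in> Qadj \<gamma>. \<forall>p\<in>P. integral_at p x}"

lemma min_poly: "min_poly_of (map_poly of_int f) \<gamma>"
  using irreducible_int_poly_min_poly[OF irreducible root] .

text \<open>Integrality does not depend on the representing polynomial. If $g(\gamma) = r$, then $f$ divides $g - r$ and
  $g(s_{p,i}) \to r$.\<close>

lemma integral_at_of_rat: assumes p: "p \<in> P" shows "integral_at p (of_rat r) \<longleftrightarrow> padic_abs p r \<le> 1"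
proof
  assume "padic_abs p r \<le> 1"
  then show "integral_at p (of_rat r)" unfolding integral_at_def by (intro exI[of _ "[:r:]"]) simp
next
  have pp: "prime p" using primes p .
  assume "integral_at p (of_rat r)"
  then obtain g N where g: "evq g \<gamma> = of_rat r" "\<forall>i\<ge>N. padic_abs p (poly g (s p i)) \<le> 1"
    unfolding integral_at_def by blast
  have "evq (g - [:r:]) \<gamma> = 0" using g by simp
  then obtain q where q: "g - [:r:] = map_poly of_int f * q" using min_poly_dvd[OF min_poly] by (meson dvdE)
  have "padic_null p (\<lambda>i. poly (map_poly of_int f) (s p i) * poly q (s p i))"
    using padic_null_mult[OF pp null[OF p] padic_Cauchy_poly[OF pp Cauchy[OF p]]] .
  then obtain M where M: "\<forall>i\<ge>M. padic_abs p (poly (map_poly of_int f) (s p i) * poly q (s p i)) < 1"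
    unfolding padic_null_iff by (meson zero_less_one)
  let ?i = "max M N"
  have "poly g (s p ?i) - r = poly (map_poly of_int f) (s p ?i) * poly q (s p ?i)"
    using arg_cong[OF q, of "\<lambda>h. poly h (s p ?i)"] by simp
  then have "r = poly g (s p ?i) - poly (map_poly of_int f) (s p ?i) * poly q (s p ?i)" by simp
  then have "padic_abs p r \<le> max (padic_abs p (poly g (s p ?i))) (padic_abs p (poly (map_poly of_int f) (s p ?i) * poly q (s p ?i)))"
    using padic_abs_diff[OF pp] by metis
  then show "padic_abs p r \<le> 1" using g(2) M by (smt (verit, best) max.cobounded1 max.cobounded2 max_def)
qed

lemma integral_at_diff: assumes p: "p \<in> P" and "integral_at p x" "integral_at p y" shows "integral_at p (x - y)"
proof -
  obtain g N where g: "evq g \<gamma> = x" "\<forall>i\<ge>N. padic_abs p (poly g (s p i)) \<le> 1" using assms unfolding integral_at_def by blast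
  obtain h M where h: "evq h \<gamma> = y" "\<forall>i\<ge>M. padic_abs p (poly h (s p i)) \<le> 1" using assms unfolding integral_at_def by blast
  have "padic_abs p (poly (g - h) (s p i)) \<le> 1" if "i \<ge> max N M" for i
    using padic_abs_diff[OF primes[OF p], of "poly g (s p i)" "poly h (s p i)"] g h that by force
  then show ?thesis unfolding integral_at_def using g h by (intro exI[of _ "g - h"] conjI exI[of _ "max N M"]) auto
qed

lemma integral_at_mult: assumes p: "p \<in> P" and "integral_at p x" "integral_at p y" shows "integral_at p (x * y)"
proof -
  obtain g N where g: "evq g \<gamma> = x" "\<forall>i\<ge>N. padic_abs p (poly g (s p i)) \<le> 1" using assms unfolding integral_at_def by blast
  obtain h M where h: "evq h \<gamma> = y" "\<forall>i\<ge>M. padic_abs p (poly h (s p i)) \<le> 1" using assms unfolding integral_at_def by blast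
  have "padic_abs p (poly (g * h) (s p i)) \<le> 1" if "i \<ge> max N M" for i
    using g h that by (simp add: padic_abs_mult[OF primes[OF p]] mult_le_one)
  then show ?thesis unfolding integral_at_def using g h by (intro exI[of _ "g * h"] conjI exI[of _ "max N M"]) auto
qed

lemma R_of_rat: "of_rat r \<in> R \<longleftrightarrow> (\<forall>p\<in>P. padic_abs p r \<le> 1)"
  unfolding R_def by (auto simp: integral_at_of_rat Qadj_of_rat)

lemma R_of_int: "of_int k \<in> R"
proof -
  have "of_rat (of_int k) \<in> R" unfolding R_of_rat using padic_abs_of_int_le_1 primes by blast
  then show ?thesis by simp
qed

lemma R_diff: "x \<in> R \<Longrightarrow> y \<in> R \<Longrightarrow> x - y \<in> R"
  unfolding R_def by (auto intro: integral_at_diff Qadj_diff)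

lemma R_mult: "x \<in> R \<Longrightarrow> y \<in> R \<Longrightarrow> x * y \<in> R"
  unfolding R_def by (auto intro: integral_at_mult Qadj_mult)

lemma R_add: "x \<in> R \<Longrightarrow> y \<in> R \<Longrightarrow> x + y \<in> R"
  using R_diff[of x "0 - y"] R_diff[of 0 y] R_of_int[of 0] by simp

lemma R_divide_other: assumes "prime q" "q \<notin> P" "x \<in> R" shows "x / of_nat q \<in> R"
proof -
  have "of_rat (1 / of_nat q) \<in> R"
    unfolding R_of_rat using padic_abs_inverse_of_nat[OF primes assms(1)] assms(2) by auto
  then have "x * of_rat (1 / of_nat q) \<in> R" using R_mult assms by blast
  then show ?thesis by (simp add: of_rat_divide)
qed

text \<open>The ring \<open>R\<close> contains no new fractions with denominator $p \in P$, so these $p$-heights of integers in \<open>R\<close> are the usual ones.\<close>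

lemma R_dvd: assumes p: "p \<in> P" and y: "y \<in> R" and m: "of_int m = of_nat p ^ k * y" shows "int p ^ k dvd m"
proof -
  have pp: "prime p" using primes p .
  have p0: "p > 0" using pp prime_gt_0_nat by simp
  have "y = of_int m / of_nat p ^ k" using m p0 by (simp add: field_simps)
  also have "\<dots> = of_rat (of_int m / of_nat p ^ k)" by (simp add: of_rat_divide of_rat_power)
  finally have "padic_abs p (of_int m / of_nat p ^ k) \<le> 1" using y R_of_rat p by blast
  then have le: "(1 / real p) ^ k * padic_abs p (of_int m / of_nat p ^ k) \<le> (1 / real p) ^ k * 1"
    by (intro mult_left_mono) simp_all
  have "of_int m = of_nat p ^ k * (of_int m / of_nat p ^ k :: rat)" using p0 by simp
  then have "padic_abs p (of_int m) = (1 / real p) ^ k * padic_abs p (of_int m / of_nat p ^ k)"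
    by (metis padic_abs_mult[OF pp] padic_abs_power[OF pp] padic_abs_of_nat_self[OF pp])
  then have "padic_abs p (of_int m) \<le> (1 / real p) ^ k * 1" using le by simp
  then have "padic_abs p (of_int m) \<le> 1 / real p ^ k" by (simp add: power_divide)
  then show ?thesis using padic_abs_of_int_le_iff[OF pp] by blast
qed

lemma padic_abs_sum_le:
  assumes p: "prime p" and "\<And>i. i \<in> I \<Longrightarrow> padic_abs p (h i) \<le> C" "C \<ge> 0" shows "padic_abs p (sum h I) \<le> C"
  using assms(2,3)
proof (induction I rule: infinite_finite_induct)
  case (insert i I)
  then show ?case using padic_abs_ultrametric[OF p, of "h i" "sum h I"] by force
qed auto

text \<open>With the leading coefficient $c$ of $f$ and $y = c s_{p,i}$, the number $c^{n-1} f(s_{p,i})$ is a monic integral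
  polynomial in $y$. If $|y| > 1$, the leading term $y^n$ dominates and $|c^{n-1} f(s_{p,i})| = |y|^n > 1$, which is impossible
  once $|f(s_{p,i})| < 1$.\<close>

lemma lead_coeff_times_root_integral: assumes p: "p \<in> P" shows "integral_at p (of_int (lead_coeff f) * \<gamma>)"
proof -
  have pp: "prime p" using primes p .
  define c where "c = lead_coeff f"
  define n where "n = degree f"
  have n: "n > 0" using min_poly_degree_pos[OF min_poly] by (simp add: n_def)
  obtain N where N: "\<forall>i\<ge>N. padic_abs p (poly (map_poly of_int f) (s p i)) < 1"
    using null[OF p] unfolding padic_null_iff by (meson zero_less_one)
  have "padic_abs p (of_int c * s p i) \<le> 1" if i: "i \<ge> N" for i
  proof (rule ccontr)
    define y where "y = of_int c * s p i"
    define v where "v = padic_abs p y"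
    assume "\<not> padic_abs p (of_int c * s p i) \<le> 1"
    then have v1: "v > 1" by (simp add: v_def y_def)
    have le1: "padic_abs p (of_int a) \<le> 1" for a using padic_abs_of_int_le_1[OF pp] .
    have "of_int c ^ (n - 1) * poly (map_poly of_int f) (s p i) = (\<Sum>k\<le>n. of_int c ^ (n - 1) * (of_int (coeff f k) * s p i ^ k))"
      by (simp add: poly_altdef sum_distrib_left coeff_map_poly n_def)
    also have "\<dots> = of_int c ^ (n - 1) * (of_int c * s p i ^ n) + (\<Sum>k<n. of_int c ^ (n - 1) * (of_int (coeff f k) * s p i ^ k))"
      by (simp add: c_def n_def flip: lessThan_Suc_atMost)
    also have "of_int c ^ (n - 1) * (of_int c * s p i ^ n) = y ^ n"
      using n by (cases n) (simp_all add: y_def power_mult_distrib)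
    also have "(\<Sum>k<n. of_int c ^ (n - 1) * (of_int (coeff f k) * s p i ^ k)) = (\<Sum>k<n. of_int (coeff f k * c ^ (n - 1 - k)) * y ^ k)"
    proof (intro sum.cong refl)
      fix k assume "k \<in> {..<n}"
      then have "of_int c ^ (n - 1) = (of_int c ^ (n - 1 - k) * of_int c ^ k :: rat)" by (simp flip: power_add)
      then show "of_int c ^ (n - 1) * (of_int (coeff f k) * s p i ^ k) = of_int (coeff f k * c ^ (n - 1 - k)) * y ^ k"
        by (simp add: y_def power_mult_distrib)
    qed
    finally have "y ^ n = of_int c ^ (n - 1) * poly (map_poly of_int f) (s p i) - (\<Sum>k<n. of_int (coeff f k * c ^ (n - 1 - k)) * y ^ k)"
      by simp
    then have "v ^ n \<le> max (padic_abs p (of_int c ^ (n - 1) * poly (map_poly of_int f) (s p i)))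
        (padic_abs p (\<Sum>k<n. of_int (coeff f k * c ^ (n - 1 - k)) * y ^ k))"
      using padic_abs_diff[OF pp] unfolding v_def padic_abs_power[OF pp, symmetric] by metis
    moreover have "padic_abs p (of_int c ^ (n - 1) * poly (map_poly of_int f) (s p i)) \<le> 1"
    proof -
      have "padic_abs p (of_int c ^ (n - 1)) \<le> 1" using le1[of "c ^ (n - 1)"] by simp
      then show ?thesis using N i unfolding padic_abs_mult[OF pp] by (intro mult_le_one) (auto intro: less_imp_le)
    qed
    then have "padic_abs p (of_int c ^ (n - 1) * poly (map_poly of_int f) (s p i)) \<le> v ^ (n - 1)"
      using one_le_power[of v "n - 1"] v1 by linarith
    moreover have "padic_abs p (\<Sum>k<n. of_int (coeff f k * c ^ (n - 1 - k)) * y ^ k) \<le> v ^ (n - 1)"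
    proof (rule padic_abs_sum_le[OF pp])
      fix k assume k: "k \<in> {..<n}"
      have "padic_abs p (of_int (coeff f k * c ^ (n - 1 - k)) * y ^ k) \<le> 1 * v ^ k"
        unfolding padic_abs_mult[OF pp] padic_abs_power[OF pp] v_def[symmetric]
        by (intro mult_right_mono le1) (use v1 in simp)
      also have "\<dots> \<le> v ^ (n - 1)" using v1 k by (simp add: power_increasing)
      finally show "padic_abs p (of_int (coeff f k * c ^ (n - 1 - k)) * y ^ k) \<le> v ^ (n - 1)" .
    qed (use v1 in simp)
    ultimately have "v ^ n \<le> v ^ (n - 1)" by simp
    moreover have "v ^ (n - 1) < v ^ n" using v1 n by (intro power_strict_increasing) auto
    ultimately show False by simp
  qed
  then show ?thesis unfolding integral_at_def c_def[symmetric]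
    by (intro exI[of _ "[:0, of_int c:]"]) (auto simp: mult.commute)
qed

text \<open>The numbers $\mathbb{Z}[c \gamma]$ lie in \<open>R\<close>, where $c$ is the leading coefficient of $f$. Denominators and powers of $c$ can be cleared.\<close>

lemma integral_multiple_in_R: assumes "x \<in> Qadj \<gamma>" shows "\<exists>m::int. m > 0 \<and> of_int m * x \<in> R"
proof -
  define c where "c = lead_coeff f"
  have c0: "c \<noteq> 0" using irreducible by (simp add: c_def irreducible_def)
  have "of_rat (of_int c) * \<gamma> \<in> Qadj \<gamma>" by (intro Qadj_mult Qadj_of_rat Qadj_self)
  then have b: "of_int c * \<gamma> \<in> R"
    unfolding R_def c_def using lead_coeff_times_root_integral by simp
  have "\<exists>m::int. m > 0 \<and> of_int m * evq g \<gamma> \<in> R" for g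
  proof (induction g)
    case 0 then show ?case using R_of_int[of 0] by (intro exI[of _ 1]) simp
  next
    case (pCons a g)
    then obtain m :: int where m: "m > 0" "of_int m * evq g \<gamma> \<in> R" by blast
    obtain u v where uv: "quotient_of a = (u, v)" by fastforce
    then have v: "v > 0" "a = of_int u / of_int v" using quotient_of_denom_pos quotient_of_div by auto
    have "of_int (c * c * m * v) * evq (pCons a g) \<gamma> =
        of_int (c * c * m * u) + of_int (c * v) * ((of_int c * \<gamma>) * (of_int m * evq g \<gamma>))"
      using v by (simp add: of_rat_divide algebra_simps)
    also have "\<dots> \<in> R" by (intro R_add R_of_int R_mult b m)
    \<comment> \<open>The factor is $c^2$ and not $c$ because the multiplier has to be positive.\<close>
    finally show ?case using m v c0 by (intro exI[of _ "c * c * m * v"]) (auto simp: zero_less_mult_iff)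
  qed
  then show ?thesis using assms unfolding Qadj_def by auto
qed

text \<open>The residue field of the $p$-adic integers is the prime field, so $x$ is congruent to an integer $a$ at $p$. The quotient $(x - a)/p$
  remains integral at all other primes of \<open>P\<close>, where $p$ is a unit.\<close>

lemma R_residue: assumes p: "p \<in> P" and x: "x \<in> R" shows "\<exists>a::int. \<exists>y\<in>R. x = of_int a + of_nat p * y"
proof -
  have pp: "prime p" using primes p .
  have p0: "p > 0" using pp prime_gt_0_nat by simp
  obtain g N where g: "evq g \<gamma> = x" "\<forall>i\<ge>N. padic_abs p (poly g (s p i)) \<le> 1"
    using x p unfolding R_def integral_at_def by blast
  obtain M where M: "\<forall>i\<ge>M. \<forall>j\<ge>M. padic_abs p (poly g (s p i) - poly g (s p j)) < 1 / real p"
    using padic_Cauchy_poly[OF pp Cauchy[OF p], of g] p0 unfolding padic_Cauchy_def by (meson divide_pos_pos of_nat_0_less_iff zero_less_one)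
  define r where "r = poly g (s p (max M N))"
  have "padic_abs p r \<le> 1" unfolding r_def using g by simp
  then obtain a where a: "padic_abs p (r - of_int a) \<le> 1 / real p" using padic_integer_residue[OF pp] by blast
  define y where "y = (x - of_int a) / of_nat p"
  have "x - of_int a \<in> R" by (intro R_diff x R_of_int)
  have yeq: "y = (x - of_int a) * of_rat (1 / of_nat p)" by (simp add: y_def of_rat_divide)
  have "integral_at q y" if q: "q \<in> P" for q
  proof (cases "q = p")
    case False
    have "integral_at q (of_rat (1 / of_nat p))"
      using False padic_abs_inverse_of_nat[OF primes[OF q] pp] integral_at_of_rat[OF q] by simp
    then show ?thesis unfolding yeq using \<open>x - of_int a \<in> R\<close> q integral_at_mult[OF q] unfolding R_def by blast
  next
    case True
    let ?h = "smult (1 / of_nat p) (g - [:of_int a:])"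
    have "padic_abs p (poly ?h (s p i)) \<le> 1" if i: "i \<ge> M" for i
    proof -
      have "padic_abs p (poly g (s p i) - r) \<le> 1 / real p" using M i unfolding r_def by (simp add: less_imp_le)
      then have "padic_abs p ((poly g (s p i) - r) + (r - of_int a)) \<le> 1 / real p"
        using a padic_abs_ultrametric[OF pp, of "poly g (s p i) - r" "r - of_int a"] by linarith
      then have "padic_abs p (poly g (s p i) - of_int a) \<le> 1 / real p" by simp
      then have "real p * padic_abs p (poly g (s p i) - of_int a) \<le> 1" using p0 by (simp add: field_simps)
      moreover have "poly ?h (s p i) = (1 / of_nat p) * (poly g (s p i) - of_int a)" by simp
      ultimately show ?thesis using padic_abs_inverse_of_nat[OF pp pp] by (simp only: padic_abs_mult[OF pp]) simp
    qed
    moreover have "evq ?h \<gamma> = y" by (simp add: yeq g)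
    ultimately show ?thesis unfolding integral_at_def True by blast
  qed
  moreover have "y \<in> Qadj \<gamma>"
    unfolding yeq using \<open>x - of_int a \<in> R\<close> by (intro Qadj_mult Qadj_of_rat) (simp add: R_def)
  ultimately have "y \<in> R" unfolding R_def by blast
  moreover have "x = of_int a + of_nat p * y" using p0 by (simp add: y_def)
  ultimately show ?thesis by blast
qed

lemma R_cofactor: assumes x: "x \<in> R" "x \<noteq> 0" shows "\<exists>m w. m > 0 \<and> w \<in> R \<and> x * w = of_int m"
proof -
  have "1 / x \<in> Qadj \<gamma>"
    using Qadj_divide[OF min_poly Qadj_of_rat[of 1], of x] x by (simp add: R_def)
  then obtain m :: int where "m > 0" "of_int m * (1 / x) \<in> R" using integral_multiple_in_R by blast
  then show ?thesis using x by (intro exI[of _ m] exI[of _ "of_int m * (1 / x)"]) simp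
qed

end

lemma countable_Qadj: "countable (Qadj \<gamma>)"
proof -
  have "evq g \<gamma> \<in> (\<lambda>l. evq (Poly l) \<gamma>) ` UNIV" for g
    by (rule range_eqI[of _ _ "coeffs g"]) simp
  then have "Qadj \<gamma> \<subseteq> range (\<lambda>l. evq (Poly l) \<gamma>)" unfolding Qadj_def by blast
  then show ?thesis by (rule countable_subset) (intro countable_image countableI_type)
qed

lemma countable_inj_into_infinite:
  assumes "countable A" "infinite (UNIV :: 'a set)"
  obtains \<iota> :: "'b \<Rightarrow> 'a" where "inj_on \<iota> A"
proof -
  obtain h :: "nat \<Rightarrow> 'a" where h: "inj h" using infinite_countable_subset[OF assms(2)] by blast
  obtain e :: "'b \<Rightarrow> nat" where "inj_on e A" using assms(1) unfolding countable_def by blast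
  then have "inj_on (h \<circ> e) A" using h by (intro comp_inj_on) (auto intro: inj_on_subset)
  then show ?thesis using that by blast
qed

text \<open>The elements of a countable group can be renamed by an injection \<open>\<iota>\<close> into any infinite type.\<close>

definition transported_group :: "('v::comm_ring_1 \<Rightarrow> 'a) \<Rightarrow> 'v set \<Rightarrow> 'a monoid" where
  "transported_group \<iota> A = \<lparr>carrier = \<iota> ` A,
     monoid.mult = (\<lambda>u v. \<iota> (the_inv_into A \<iota> u + the_inv_into A \<iota> v)), one = \<iota> 0\<rparr>"

lemma additive_model_transported_group:
  fixes A :: "'v::{idom, ring_char_0} set"
  assumes A: "Z_submodule A" and inj: "inj_on \<iota> A"
  shows "additive_model A (transported_group \<iota> A) \<iota>"
proof -
  interpret Z_submodule A by (rule A)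
  let ?G = "transported_group \<iota> A"
  have inv: "the_inv_into A \<iota> (\<iota> x) = x" if "x \<in> A" for x using inj that by (rule the_inv_into_f_f)
  have mult: "\<iota> x \<otimes>\<^bsub>?G\<^esub> \<iota> y = \<iota> (x + y)" if "x \<in> A" "y \<in> A" for x y
    using inv that by (simp add: transported_group_def)
  have car: "carrier ?G = \<iota> ` A" and one: "\<one>\<^bsub>?G\<^esub> = \<iota> 0" by (simp_all add: transported_group_def)
  have "comm_group ?G"
  proof (rule comm_groupI)
    fix x assume "x \<in> carrier ?G"
    then obtain u where u: "u \<in> A" "x = \<iota> u" by (auto simp: car)
    have "\<iota> (- u) \<otimes>\<^bsub>?G\<^esub> x = \<one>\<^bsub>?G\<^esub>" using mult[of "- u" u] u minus_closed one by simp
    then show "\<exists>y\<in>carrier ?G. y \<otimes>\<^bsub>?G\<^esub> x = \<one>\<^bsub>?G\<^esub>" using u minus_closed by (auto simp: car)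
  qed (auto simp: car one mult add_closed algebra_simps)
  then show ?thesis using inj by (intro additive_model.intro additive_model_axioms.intro A) (auto simp: car mult bij_betw_def)
qed

context local_integers
begin

lemma Z_submodule_R: "Z_submodule R"
  by unfold_locales (use R_of_int[of 0] R_diff in auto)

lemma Qadj_in_span: "x \<in> Qadj \<gamma> \<Longrightarrow> x \<in> qv.span ((^) \<gamma> ` {..<degree f})"
  using Qadj_in_span_powers[OF min_poly] by simp

text \<open>At most $n$ because $\mathbb{Q}(\gamma)$ has dimension $n$, at least $n$ because suitable multiples of the powers of $\gamma$ lie in
  \<open>R\<close>.\<close>

lemma group_rank_R:
  assumes "additive_model R G \<phi>" shows "group_rank G = enat (degree f)"
proof -
  interpret additive_model R G \<phi> by fact
  let ?L = "{S. S \<subseteq> R \<and> finite S \<and> Z_independent S}"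
  have "card S \<le> degree f" if S: "S \<in> ?L" for S
  proof (rule ccontr)
    assume big: "\<not> card S \<le> degree f"
    have "card ((^) \<gamma> ` {..<degree f}) < card S"
      using big card_image_le[of "{..<degree f}" "(^) \<gamma>"] by simp
    moreover have "id ` S \<subseteq> qv.span ((^) \<gamma> ` {..<degree f})"
      using S Qadj_in_span by (auto simp: R_def)
    ultimately obtain c where c: "\<exists>x\<in>S. c x \<noteq> 0" "(\<Sum>x\<in>S. of_rat (c x) * x) = 0"
      using qv.family_dependent[of S "(^) \<gamma> ` {..<degree f}" id] S by auto
    obtain k d where k: "k > 0" "\<forall>x\<in>S. rat_of_int (d x) = of_int k * c x" using common_denominator[of S c] S by auto
    have "(\<Sum>x\<in>S. of_int (d x) * x) = (\<Sum>x\<in>S. of_int k * (of_rat (c x) * x))"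
    proof (intro sum.cong refl)
      fix x assume "x \<in> S"
      then have "of_rat (rat_of_int (d x)) = (of_rat (of_int k * c x) :: complex)" using k by simp
      then show "of_int (d x) * x = of_int k * (of_rat (c x) * x)" by (simp add: of_rat_mult)
    qed
    also have "\<dots> = 0" using c(2) by (simp flip: sum_distrib_left)
    finally have "\<forall>x\<in>S. d x = 0" using S unfolding Z_independent_def by blast
    then have "\<forall>x\<in>S. c x = 0" using k by fastforce
    then show False using c(1) by blast
  qed
  then have le: "group_rank G \<le> enat (degree f)" unfolding group_rank_eq by (intro SUP_least) simp
  have "\<gamma> ^ i \<in> Qadj \<gamma>" for i unfolding Qadj_def by (rule range_eqI[of _ _ "monom 1 i"]) simp
  then have "\<forall>i. \<exists>m::int. m > 0 \<and> of_int m * \<gamma> ^ i \<in> R" using integral_multiple_in_R by blast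
  then obtain m :: "nat \<Rightarrow> int" where m: "\<And>i. m i > 0" "\<And>i. of_int (m i) * \<gamma> ^ i \<in> R" by metis
  define e where "e = (\<lambda>i. of_int (m i) * \<gamma> ^ i)"
  have ind: "c i = 0" if c: "(\<Sum>i<degree f. of_int (c i) * e i) = 0" and i: "i < degree f" for c :: "nat \<Rightarrow> int" and i
  proof -
    have "(\<Sum>i<degree f. of_rat (of_int (c i * m i)) * \<gamma> ^ i) = (\<Sum>i<degree f. of_int (c i) * e i)"
      by (simp add: e_def mult.assoc of_rat_mult)
    then have "rat_of_int (c i * m i) = 0" using powers_independent[OF min_poly, of "\<lambda>i. of_int (c i * m i)" i] c i by simp
    then show ?thesis using m(1)[of i] by simp
  qed
  have inj: "inj_on e {..<degree f}"
  proof (rule inj_onI, rule ccontr)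
    fix i j assume ij: "i \<in> {..<degree f}" "j \<in> {..<degree f}" "e i = e j" "i \<noteq> j"
    let ?c = "\<lambda>k. if k = i then 1 else if k = j then - 1 else (0 :: int)"
    have "(\<Sum>k<degree f. of_int (?c k) * e k) = (\<Sum>k\<in>{i, j}. of_int (?c k) * e k)"
      using ij by (intro sum.mono_neutral_right) auto
    also have "\<dots> = 0" using ij by simp
    finally have "?c i = 0" using ind[of ?c i] ij by blast
    then show False by simp
  qed
  have "e ` {..<degree f} \<in> ?L"
    unfolding Z_independent_def using m(2) ind by (auto simp: sum.reindex[OF inj] e_def[symmetric]) (auto simp: e_def)
  then have "enat (card (e ` {..<degree f})) \<le> group_rank G"
    unfolding group_rank_eq by (rule SUP_upper)
  then show ?thesis using le card_image[OF inj] by simp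
qed

text \<open>Here $m = x w$ is a multiple of $x$ in \<open>R\<close>, so $p^k \mid x$ implies $p^k \mid m$.\<close>

lemma height_R:
  assumes "additive_model R G \<phi>" and x: "x \<in> R" "x \<noteq> 0"
  obtains m :: int where "m > 0"
    "\<And>p k. p \<in> P \<Longrightarrow> enat k \<le> height G p (\<phi> x) \<Longrightarrow> int p ^ k dvd m"
    "\<And>p. prime p \<Longrightarrow> p \<notin> P \<Longrightarrow> height G p (\<phi> x) = \<infinity>"
proof -
  interpret additive_model R G \<phi> by fact
  obtain m w where m: "m > 0" "w \<in> R" "x * w = of_int m" using R_cofactor x by blast
  show ?thesis
  proof (rule that[OF m(1)])
    fix p k assume p: "p \<in> P" "enat k \<le> height G p (\<phi> x)"
    then obtain y where y: "y \<in> R" "x = of_nat p ^ k * y" using height_ge_iff[OF x(1)] by blast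
    have "of_int m = of_nat p ^ k * (y * w)" using m y by (simp add: mult.assoc)
    then show "int p ^ k dvd m" using R_dvd[OF p(1) R_mult[OF y(1) m(2)]] by blast
  next
    fix p assume p: "prime p" "p \<notin> P"
    have "\<exists>y\<in>R. x = of_nat p ^ k * y" for k
    proof (induction k)
      case (Suc k)
      then obtain y where y: "y \<in> R" "x = of_nat p ^ k * y" by blast
      then show ?case using R_divide_other[OF p y(1)] prime_gt_0_nat[OF p(1)]
        by (intro bexI[of _ "y / of_nat p"]) simp_all
    qed (use x in auto)
    then have ge: "enat k \<le> height G p (\<phi> x)" for k using height_ge_iff[OF x(1)] by blast
    show "height G p (\<phi> x) = \<infinity>"
    proof (cases "height G p (\<phi> x)")
      case (enat j) then show ?thesis using ge[of "Suc j"] by simp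
    qed
  qed
qed

text \<open>The heights of a non-zero element are $\infty$ outside \<open>P\<close> and finite on \<open>P\<close>, where they vanish unless $p$
  divides the fixed integer \<open>m\<close>. So they represent the idempotent type that is finite exactly on \<open>P\<close>. The finite heights
  also show that there are no non-zero divisible subgroups.\<close>

theorem group_of_R:
  assumes G: "additive_model R G \<phi>" and P: "P \<noteq> {}" and t: "idempotent_type t" "finite_primes t = P"
  shows "G \<in> MH - NIL \<and> group_rank G = enat (degree f) \<and> group_type G = t"
proof -
  interpret additive_model R G \<phi> by (rule G)
  obtain \<chi> where chi: "type_of_char \<chi> = t" "\<And>p. prime p \<Longrightarrow> \<chi> p = 0 \<or> \<chi> p = \<infinity>"
    using t unfolding idempotent_type_def by blast
  have chiP: "\<chi> p \<noteq> \<infinity> \<longleftrightarrow> p \<in> P" if "prime p" for p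
    using finite_primes.abs_eq[of \<chi>] chi(1) t(2) that by auto
  have rank: "group_rank G = enat (degree f)" using group_rank_R[OF G] .
  have type: "element_type G x = t" if x: "x \<in> carrier G" "x \<noteq> \<one>\<^bsub>G\<^esub>" for x
  proof -
    obtain u where u: "u \<in> R" "x = \<phi> u" "u \<noteq> 0" using phi_surj[OF x(1)] x(2) phi_0 by blast
    obtain m :: int where m: "m > 0" "\<And>p k. p \<in> P \<Longrightarrow> enat k \<le> height G p x \<Longrightarrow> int p ^ k dvd m"
      "\<And>p. prime p \<Longrightarrow> p \<notin> P \<Longrightarrow> height G p x = \<infinity>"
      using height_R[OF G u(1,3)] u(2) by blast
    have fin: "height G p x \<noteq> \<infinity>" if p: "p \<in> P" for p
    proof
      assume "height G p x = \<infinity>"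
      \<comment> \<open>Any $k$ with $p^k > m$ gives a contradiction; $k = m$ is one.\<close>
      then have "int p ^ nat m dvd m" using m(2)[OF p] by simp
      then have "int p ^ nat m \<le> m" using m(1) by (rule zdvd_imp_le)
      moreover have "nat m < 2 ^ nat m" by simp
      moreover have "int 2 ^ nat m \<le> int p ^ nat m" using prime_ge_2_nat[OF primes[OF p]] by (intro power_mono) auto
      ultimately show False using m(1)
        by (metis int_nat_eq less_le_trans not_le of_nat_less_iff of_nat_power order_less_imp_le)
    qed
    have zero: "height G p x = 0" if p: "p \<in> P" "\<not> int p dvd m" for p
    proof (rule ccontr)
      assume "height G p x \<noteq> 0"
      then have "enat 1 \<le> height G p x" by (cases "height G p x") (auto simp: zero_enat_def)
      then show False using m(2)[OF p(1), of 1] p(2) by simp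
    qed
    have "height G p x = \<chi> p \<or> int p dvd m" if p: "prime p" for p
      using zero[of p] m(3)[OF p] chiP[OF p] chi(2)[OF p] by (cases "p \<in> P") auto
    then have "{p. prime p \<and> height G p x \<noteq> \<chi> p} \<subseteq> {p. p dvd nat m}"
      using m(1) by (auto simp: int_dvd_int_iff[symmetric])
    moreover have "finite {p. p dvd nat m}" using m(1) by simp
    ultimately have "finite {p. prime p \<and> height G p x \<noteq> \<chi> p}" by (rule finite_subset)
    moreover have "height G p x \<noteq> \<infinity> \<and> \<chi> p \<noteq> \<infinity>" if "prime p" "height G p x \<noteq> \<chi> p" for p
      using that m(3)[of p] fin[of p] chiP[of p] by (cases "p \<in> P") auto
    ultimately have "char_equiv (\<lambda>p. height G p x) \<chi>" unfolding char_equiv_def by blast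
    then show ?thesis unfolding element_type_def chi(1)[symmetric] type_of_char_eq_iff .
  qed
  have "1 \<in> R" using R_of_int[of 1] by simp
  then have ex: "\<exists>x\<in>carrier G. x \<noteq> \<one>\<^bsub>G\<^esub>" using phi_closed phi_eq_one by (metis zero_neq_one)
  have gt: "group_type G = t" by (rule group_type_eq[OF type ex])
  have hom: "homogeneous G" unfolding homogeneous_def using type by simp
  have "p_rank p G \<le> 1" if p: "prime p" for p
  proof (cases "p \<in> P")
    case True
    have "\<exists>a::int. \<exists>y\<in>R. x = of_int a * 1 + of_nat p * y" if "x \<in> R" for x
      using R_residue[OF True that] by simp
    then show ?thesis unfolding p_rank_le_1_iff[OF p] using \<open>1 \<in> R\<close> by blast
  next
    case False
    have "x = of_int 0 * 0 + of_nat p * (x / of_nat p)" for x :: complex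
      using prime_gt_0_nat[OF p] by simp
    then show ?thesis unfolding p_rank_le_1_iff[OF p] using R_divide_other[OF p False] zero_closed by blast
  qed
  moreover have "reduced_group G"
    unfolding reduced_group_def
  proof (intro allI impI)
    fix D assume D: "subgroup D G \<and> divisible_group (G\<lparr>carrier := D\<rparr>)"
    then have sub: "D \<subseteq> carrier G" "\<one>\<^bsub>G\<^esub> \<in> D" using subgroup.subset subgroup.one_closed by auto
    have "x = \<one>\<^bsub>G\<^esub>" if x: "x \<in> D" for x
    proof (rule ccontr)
      assume x1: "x \<noteq> \<one>\<^bsub>G\<^esub>"
      obtain p where p: "p \<in> P" using P by blast
      obtain u where u: "u \<in> R" "x = \<phi> u" "u \<noteq> 0" using phi_surj[of x] x sub x1 phi_0 by blast
      have "enat k \<le> height G p x" for k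
      proof -
        have "\<exists>y\<in>D. y [^]\<^bsub>G\<lparr>carrier := D\<rparr>\<^esub> (p ^ k) = x"
          using D x prime_gt_0_nat[OF primes[OF p]] unfolding divisible_group_def by simp
        then obtain y where y: "y \<in> D" "y [^]\<^bsub>G\<^esub> (p ^ k) = x" by (auto simp: nat_pow_def)
        obtain v where v: "v \<in> R" "y = \<phi> v" using phi_surj[of y] y sub by blast
        have "\<phi> u = \<phi> (of_nat (p ^ k) * v)" using y v u phi_nat_pow by metis
        then have "u = of_nat p ^ k * v" using u v phi_inj of_nat_closed by (metis of_nat_power)
        then show ?thesis unfolding u(2) height_ge_iff[OF u(1)] using v by blast
      qed
      then have inf: "height G p x = \<infinity>" by (metis enat_ord_simps(1) not_enat_eq not_less_eq_eq order_refl)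
      have "type_of_char (\<lambda>p. height G p x) = type_of_char \<chi>"
        using type[of x] x sub x1 chi(1) unfolding element_type_def by auto
      then have "char_equiv (\<lambda>p. height G p x) \<chi>" unfolding type_of_char_eq_iff .
      moreover have "\<chi> p \<noteq> \<infinity>" using chiP[OF primes[OF p]] p by simp
      ultimately show False unfolding char_equiv_def using inf primes[OF p] by metis
    qed
    then show "D = {\<one>\<^bsub>G\<^esub>}" using sub by blast
  qed
  ultimately have "murley_group G"
    unfolding murley_group_def using comm_group torsion_free rank by simp
  moreover have "\<not> nil_group G"
    by (rule not_nil_groupI[of "(*)" 1 1])
      (use \<open>1 \<in> R\<close> R_mult in \<open>auto simp: biadditive_on_def algebra_simps\<close>)
  ultimately show ?thesis using hom rank gt by (simp add: MH_def NIL_def)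
qed

end

theorem group_of_polynomial:
  assumes inf: "infinite (UNIV :: 'a set)" and t: "idempotent_type t" "t \<noteq> type_of_char (\<lambda>p. \<infinity>)"
    and f: "irreducible f" "degree f > 0" "finite_primes t \<subseteq> root_primes f"
  shows "\<exists>G :: 'a monoid. G \<in> MH - NIL \<and> group_rank G = enat (degree f) \<and> group_type G = t"
proof -
  define P where "P = finite_primes t"
  obtain \<chi> where chi: "type_of_char \<chi> = t" using t unfolding idempotent_type_def by blast
  have fp: "P = {p. prime p \<and> \<chi> p \<noteq> \<infinity>}" using finite_primes.abs_eq[of \<chi>] chi by (simp add: P_def)
  have "P \<noteq> {}"
  proof
    assume "P = {}"
    then have "\<chi> p = \<infinity>" if "prime p" for p using fp that by blast
    then have "char_equiv \<chi> (\<lambda>p. \<infinity>)" unfolding char_equiv_def by (metis (mono_tags, lifting) Collect_empty_eq finite.emptyI)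
    then show False using t(2) chi type_of_char_eq_iff by metis
  qed
  have "\<exists>s. padic_Cauchy p s \<and> padic_null p (\<lambda>i. poly (map_poly of_int f) (s i))" if "p \<in> P" for p
    using f(3) that int_poly_root_in_padic_field_iff unfolding root_primes_def P_def by blast
  then obtain s where s: "\<And>p. p \<in> P \<Longrightarrow> padic_Cauchy p (s p)"
    "\<And>p. p \<in> P \<Longrightarrow> padic_null p (\<lambda>i. poly (map_poly of_int f) (s p i))" by metis
  have "degree (map_poly complex_of_int f) = degree f" by (rule degree_map_poly) simp
  then have "\<not> constant (poly (map_poly complex_of_int f))" using f(2) by (simp add: constant_degree)
  then obtain \<gamma> where g: "poly (map_poly complex_of_int f) \<gamma> = 0" using fundamental_theorem_of_algebra by blast
  have "evq (map_poly of_int f) \<gamma> = poly (map_poly complex_of_int f) \<gamma>"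
    unfolding evq_def by (simp add: map_poly_map_poly comp_def)
  then have root: "evq (map_poly of_int f) \<gamma> = 0" using g by simp
  interpret local_integers f \<gamma> P s
    by unfold_locales (use f(1) root s fp in auto)
  have "countable R" using countable_Qadj by (rule countable_subset[rotated]) (auto simp: R_def)
  then obtain \<iota> :: "complex \<Rightarrow> 'a" where i: "inj_on \<iota> R" using countable_inj_into_infinite[OF _ inf] by blast
  show ?thesis
    using group_of_R[OF additive_model_transported_group[OF Z_submodule_R i] \<open>P \<noteq> {}\<close> t(1)] P_def by blast
qed

theorem theorem17:
  fixes n :: nat and t :: height_type
  assumes "infinite (UNIV :: 'a set)"
    and "n > 1"
    and "t \<noteq> type_of_char (\<lambda>p. \<infinity>)"
  shows "(\<exists>G :: 'a monoid. G \<in> MH - NIL \<and> group_rank G = enat n \<and> group_type G = t) \<longleftrightarrow>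
    idempotent_type t \<and>
    (\<exists>f :: int poly. irreducible f \<and> Polynomial.degree f = n \<and> finite_primes t \<subseteq> root_primes f)"
proof
  assume "\<exists>G :: 'a monoid. G \<in> MH - NIL \<and> group_rank G = enat n \<and> group_type G = t"
  then show "idempotent_type t \<and>
    (\<exists>f :: int poly. irreducible f \<and> degree f = n \<and> finite_primes t \<subseteq> root_primes f)"
    using polynomial_of_group assms by blast
next
  assume "idempotent_type t \<and>
    (\<exists>f :: int poly. irreducible f \<and> degree f = n \<and> finite_primes t \<subseteq> root_primes f)"
  then show "\<exists>G :: 'a monoid. G \<in> MH - NIL \<and> group_rank G = enat n \<and> group_type G = t"
    using group_of_polynomial[OF assms(1) _ assms(3)] assms(2) by fastforce
qed

end
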